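(* Let $0\le\alpha<1$, let $\beta_1,\beta_2,\delta_1,\delta_2\ge 0$ and $\alpha_1,\alpha_2,\gamma_1,\gamma_2>0$ be real, and let $|\sigma|<1$. Let $f=h+\overline{g}\in K_{\hat H^o}$. Write $W_i=W_{(\alpha_i,\beta_i),(\gamma_i,\delta_i)}$ for $i=1,2$. If $$W_1''(1)+(2-\alpha)\big(W_1'(1)-1\big)-\alpha\big(W_1(1)-1\big)+|\sigma|\Big(W_2''(1)+\alpha\big(W_2'(1)-W_2(1)\big)\Big)\le 2(1-\alpha),$$ then $L(f)=H+\overline{\sigma G}\in HS^*(\alpha)$.
   Context: $D=\{z\in\mathbb C:|z|<1\}$. $\hat H$ is the class of complex-valued harmonic functions $f=h+\overline g$ on $D$ with $h,g$ analytic in $D$, $h(z)=z+\sum_{n=2}^\infty A_nz^n$, $g(z)=\sum_{n=1}^\infty B_nz^n$, $|B_1|<1$. $S_{\hat H}$ is the class of sense-preserving univalent functions in $\hat H$, and $S_{\hat H^o}$ is the subclass with $g'(0)=B_1=0$. $K_{\hat H^o}$ is the class of $f\in S_{\hat H^o}$ such that $f(D)$ is convex. For $0\le\alpha<1$, $HS^*(\alpha)$ (harmonic starlike functions of order $\alpha$) is the class of $f\in\hat H$ with $\frac{\partial}{\partial\theta}\arg f(re^{i\theta})>\alpha$ for all $0<r<1$, $0\le\theta\le2\pi$. Normalized four-parameter Wright function: for real $a,c>0$ and $b,d\ge0$, $$W_{(a,b),(c,d)}(z)=z+\sum_{n=2}^\infty\frac{\Gamma(a)\Gamma(c)}{\Gamma(a+(n-1)b)\,\Gamma(c+(n-1)d)}z^n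 .$$ $W(1),W'(1),W''(1)$ denote the sums at $z=1$ of this series and of its termwise derivatives; a hypothesis involving them is understood to include that they are finite (automatic if $b+d>0$). The operator $L$ (depending on $\alpha_i,\beta_i,\gamma_i,\delta_i$, $i=1,2$, and $\sigma$) is $L(f)=H+\overline{\sigma G}$, where $H=h*W_{(\alpha_1,\beta_1),(\gamma_1,\delta_1)}$ and $G=g*W_{(\alpha_2,\beta_2),(\gamma_2,\delta_2)}$; here $*$ is the Hadamard product $\left(\sum a_nz^n\right)*\left(\sum b_nz^n\right)=\sum a_nb_nz^n$. *)

theory Defs
  imports "HOL-Complex_Analysis.Complex_Analysis"
begin

abbreviation unit_disc :: "complex set" where
  "unit_disc \<equiv> ball 0 1"

text \<open>A function on the disc is represented by a total function on \<open>complex\<close>; its values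
  outside the disc are irrelevant to every definition below.  The pair \<open>(h, g)\<close> is uniquely
  determined on the disc by \<open>f\<close>, because \<open>g 0 = 0\<close>.\<close>

definition harmonic_decomp ::
    "(complex \<Rightarrow> complex) \<Rightarrow> (complex \<Rightarrow> complex) \<Rightarrow> (complex \<Rightarrow> complex) \<Rightarrow> bool" where
  "harmonic_decomp f h g \<longleftrightarrow>
     h holomorphic_on unit_disc \<and> g holomorphic_on unit_disc \<and>
     h 0 = 0 \<and> deriv h 0 = 1 \<and> g 0 = 0 \<and> norm (deriv g 0) < 1 \<and>
     (\<forall>z\<in>unit_disc. f z = h z + cnj (g z))"

definition H_hat :: "(complex \<Rightarrow> complex) set" where
  "H_hat = {f. \<exists>h g. harmonic_decomp f h g}"

text \<open>Positive Jacobian determinant of \<open>f\<close> as a map of the real plane; for \<open>f = h + cnj g\<close> it is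
  \<open>|h'|^2 - |g'|^2\<close>.\<close>

definition sense_preserving_on :: "complex set \<Rightarrow> (complex \<Rightarrow> complex) \<Rightarrow> bool" where
  "sense_preserving_on S f \<longleftrightarrow>
     (\<forall>z\<in>S. \<exists>f'. (f has_derivative f') (at z) \<and>
        Re (f' 1) * Im (f' \<i>) - Im (f' 1) * Re (f' \<i>) > 0)"

definition S_hat :: "(complex \<Rightarrow> complex) set" where
  "S_hat = {f \<in> H_hat. sense_preserving_on unit_disc f \<and> inj_on f unit_disc}"

definition S_hat0 :: "(complex \<Rightarrow> complex) set" where
  "S_hat0 = {f \<in> S_hat. \<exists>h g. harmonic_decomp f h g \<and> deriv g 0 = 0}"

definition K_hat0 :: "(complex \<Rightarrow> complex) set" where
  "K_hat0 = {f \<in> S_hat0. convex (f ` unit_disc)}"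

text \<open>The derivative of the argument along a curve is the derivative of a local branch of the
  argument.  Such a branch is continuous at \<open>t\<close>, so two of them differ near \<open>t\<close> by a constant
  and the value \<open>D\<close> is unique.  Nonvanishing is required explicitly, since \<open>arg 0\<close> is undefined.\<close>

definition has_arg_derivative :: "(real \<Rightarrow> complex) \<Rightarrow> real \<Rightarrow> real \<Rightarrow> bool" where
  "has_arg_derivative c D t \<longleftrightarrow>
     (\<exists>\<phi>. (\<forall>\<^sub>F s in nhds t. c s \<noteq> 0 \<and> c s = rcis (norm (c s)) (\<phi> s)) \<and>
          (\<phi> has_real_derivative D) (at t))"

definition HS_star :: "real \<Rightarrow> (complex \<Rightarrow> complex) set" where
  "HS_star \<alpha> = {f \<in> H_hat. \<forall>r \<theta>. 0 < r \<and> r < 1 \<and> 0 \<le> \<theta> \<and> \<theta> \<le> 2 * pi \<longrightarrow>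
     (\<exists>D. has_arg_derivative (\<lambda>t. f (rcis r t)) D \<theta> \<and> D > \<alpha>)}"

definition wright_coeff :: "real \<Rightarrow> real \<Rightarrow> real \<Rightarrow> real \<Rightarrow> nat \<Rightarrow> real" where
  "wright_coeff a b c d n =
     (if n = 0 then 0 else if n = 1 then 1
      else Gamma a * Gamma c / (Gamma (a + (real n - 1) * b) * Gamma (c + (real n - 1) * d)))"

definition wright :: "real \<Rightarrow> real \<Rightarrow> real \<Rightarrow> real \<Rightarrow> complex \<Rightarrow> complex" where
  "wright a b c d z = (\<Sum>n. of_real (wright_coeff a b c d n) * z ^ n)"

text \<open>Coefficients of the \<open>k\<close>-th termwise derivative of the series, which are also its terms at
  \<open>z = 1\<close>.  Values at \<open>1\<close> are defined through these series rather than by differentiating the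
  function, because for \<open>b = d = 0\<close> the point \<open>1\<close> lies on the boundary of the disc of convergence.\<close>

definition wright_deriv_coeff ::
    "nat \<Rightarrow> real \<Rightarrow> real \<Rightarrow> real \<Rightarrow> real \<Rightarrow> nat \<Rightarrow> real" where
  "wright_deriv_coeff k a b c d = (diffs ^^ k) (wright_coeff a b c d)"

definition wright_deriv_at_1 ::
    "nat \<Rightarrow> real \<Rightarrow> real \<Rightarrow> real \<Rightarrow> real \<Rightarrow> real" where
  "wright_deriv_at_1 k a b c d = (\<Sum>n. wright_deriv_coeff k a b c d n)"

definition hadamard :: "(complex \<Rightarrow> complex) \<Rightarrow> (complex \<Rightarrow> complex) \<Rightarrow> complex \<Rightarrow> complex" where
  "hadamard p q z = (\<Sum>n. fps_nth (fps_expansion p 0) n * fps_nth (fps_expansion q 0) n * z ^ n)"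

text \<open>The operator \<open>L\<close> applied to \<open>f = h + cnj g\<close>, given through the pair \<open>(h, g)\<close>.\<close>

definition wright_op ::
    "real \<Rightarrow> real \<Rightarrow> real \<Rightarrow> real \<Rightarrow> real \<Rightarrow> real \<Rightarrow> real \<Rightarrow> real \<Rightarrow> complex \<Rightarrow>
     (complex \<Rightarrow> complex) \<Rightarrow> (complex \<Rightarrow> complex) \<Rightarrow> complex \<Rightarrow> complex" where
  "wright_op \<alpha>1 \<beta>1 \<gamma>1 \<delta>1 \<alpha>2 \<beta>2 \<gamma>2 \<delta>2 \<sigma> h g z =
     hadamard h (wright \<alpha>1 \<beta>1 \<gamma>1 \<delta>1) z + cnj (\<sigma> * hadamard g (wright \<alpha>2 \<beta>2 \<gamma>2 \<delta>2) z)"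

end

theory Submission
  imports Defs
begin

text \<open>Let \<open>f = h + cnj g\<close> map the disc onto a convex domain. The coefficient bounds
  \<open>|A n| \<le> (n + 1) / 2\<close> and \<open>|B n| \<le> (n - 1) / 2\<close> of Clunie and Sheil-Small turn the hypothesis into
  \<open>(\<Sum>n\<ge>2. (n - \<alpha>) |a n| + (n + \<alpha>) |b n|) \<le> 1 - \<alpha>\<close> for the coefficients \<open>a n\<close>, \<open>b n\<close> of the image under the
  operator, which implies starlikeness of order \<open>\<alpha>\<close>.

  For the bounds, exhaust the image by strictly convex domains and reparametrize by Riemann maps, so that
  \<open>f\<close> extends to a homeomorphism of the closed disc onto the closure of a strictly convex domain. Then
  \<open>u = Re (c * f)\<close> has on the unit circle one maximum and one minimum and is monotone in between, and by
  the intermediate value theorem some direction \<open>c\<close> makes these two points antipodal, say \<open>p\<close> and \<open>- p\<close>.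
  Hyperbolic translations towards \<open>p\<close> then increase \<open>u\<close> on the circle, hence in the disc, which means that
  \<open>(c * h' + cnj c * g') * (p - cnj p * z\<^sup>2)\<close> has nonnegative real part. Caratheodory's inequality for this
  function and for \<open>(1 - \<omega>) / (1 + \<omega>)\<close>, where \<open>\<omega>\<close> is the dilatation up to a unimodular factor, yields the bounds.\<close>


section \<open>Coefficients of functions with positive real part\<close>

text \<open>Two obstacles force the reparametrization. A convex harmonic map need not extend well to
  the circle: its image may be unbounded and a whole arc may collapse to a point. Nor can it be cut
  down by dilation, since images of smaller concentric discs need not be convex. So the image is
  shrunk instead of the disc, and the conformal parameter \<open>\<phi>\<close> keeps
  \<open>f o \<phi>\<close> harmonic. Continuity up to the circle comes from a length-area estimate
  for \<open>\<phi>\<close>, carried over by uniform continuity of \<open>f\<close> on a compact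
  set; convexity of the target replaces any study of its boundary curve. Strict convexity makes the
  maxima of \<open>u\<close> unique and leaves each level of \<open>u\<close> at most two points of
  the circle.

  The constants are those of the half-plane map: \<open>h'\<close> and \<open>g'\<close> are
  majorized by \<open>1 / (1 - z)^3\<close> and \<open>z / (1 - z)^3\<close>, whose coefficients at
  \<open>n - 1\<close>, divided by \<open>n\<close>, are \<open>(n + 1) / 2\<close> and
  \<open>(n - 1) / 2\<close>. The hypothesis has its shape because \<open>(n - \<alpha>) (n + 1) = n
  (n - 1) + (2 - \<alpha>) n - \<alpha>\<close> and
  \<open>(n + \<alpha>) (n - 1) = n (n - 1) + \<alpha> (n - 1)\<close>.\<close>

abbreviation tcoeff :: "(complex \<Rightarrow> complex) \<Rightarrow> nat \<Rightarrow> complex" where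
  "tcoeff f n \<equiv> fps_nth (fps_expansion f 0) n"

lemma has_fps_expansion_tcoeff:
  assumes "f holomorphic_on unit_disc"
  shows "f has_fps_expansion fps_expansion f 0"
  using assms has_fps_expansion_fps_expansion[of unit_disc f] by simp

lemma tcoeff_sums:
  assumes "f holomorphic_on unit_disc" "z \<in> unit_disc"
  shows "(\<lambda>n. tcoeff f n * z ^ n) sums f z"
  using holomorphic_power_series[of f 0 1 z] assms by (simp add: fps_expansion_def)

lemma tcoeff_circle_integral:
  assumes f: "f holomorphic_on unit_disc" and r: "0 < (r::real)" "r < 1"
  shows "((\<lambda>t. f (r * cis t) * cis (- (n * t))) has_integral 2 * pi * tcoeff f n * r ^ n) {0..2*pi}"
proof -
  have sub: "cball 0 r \<subseteq> unit_disc" using r by auto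
  have c: "continuous_on (cball 0 r) f"
    using f sub holomorphic_on_imp_continuous_on continuous_on_subset by blast
  have h: "f holomorphic_on ball 0 r"
    using f holomorphic_on_subset r by (metis sub ball_subset_cball order_trans)
  have "((\<lambda>u. f u / u ^ Suc n) has_contour_integral ((2 * pi * \<i>) / fact n * (deriv ^^ n) f 0)) (circlepath 0 r)"
    using Cauchy_has_contour_integral_higher_derivative_circlepath[OF c h, of 0 n] r by simp
  then have "((\<lambda>t. f (r * cis t) / (r * cis t) ^ Suc n * r * \<i> * cis t) has_integral
      ((2 * pi * \<i>) / fact n * (deriv ^^ n) f 0)) {0..2*pi}"
    unfolding circlepath_def by (subst (asm) has_contour_integral_part_circlepath_iff) auto
  from has_integral_mult_right[OF this, of "of_real r ^ n / \<i>"]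
  have "((\<lambda>t. of_real r ^ n / \<i> * (f (r * cis t) / (r * cis t) ^ Suc n * r * \<i> * cis t)) has_integral
     of_real r ^ n / \<i> * ((2 * pi * \<i>) / fact n * (deriv ^^ n) f 0)) {0..2*pi}" .
  moreover have "of_real r ^ n / \<i> * (f (r * cis t) / (r * cis t) ^ Suc n * r * \<i> * cis t)
     = f (r * cis t) * cis (- (n * t))" for t :: real
  proof -
    have "cis (- (n * t)) = inverse (cis t ^ n)"
      by (simp add: Complex.DeMoivre)
    then show ?thesis using r by (simp add: field_simps power_mult_distrib)
  qed
  moreover have "of_real r ^ n / \<i> * ((2 * pi * \<i>) / fact n * (deriv ^^ n) f 0) = 2 * pi * tcoeff f n * r ^ n"
    by (simp add: fps_expansion_def field_simps)
  ultimately show ?thesis by (simp only: of_real_power)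
qed

lemma negative_coeff_circle_integral:
  assumes f: "f holomorphic_on unit_disc" and r: "0 < (r::real)" "r < 1" and n: "n \<ge> (1::nat)"
  shows "((\<lambda>t. f (r * cis t) * cis (n * t)) has_integral 0) {0..2*pi}"
proof -
  have hol: "(\<lambda>z. f z * z ^ n) holomorphic_on unit_disc"
    using f by (intro holomorphic_intros)
  have "(\<lambda>z. f z * z ^ n) has_fps_expansion fps_expansion f 0 * fps_X ^ n"
    using has_fps_expansion_tcoeff[OF f] by (intro fps_expansion_intros)
  then have "tcoeff (\<lambda>z. f z * z ^ n) 0 = 0"
    using n by (simp only: fps_expansion_eqI) simp
  from has_integral_mult_right[OF tcoeff_circle_integral[OF hol r, of 0], of "1 / r ^ n"] this
  have "((\<lambda>t. 1 / r ^ n * (f (r * cis t) * (r * cis t) ^ n)) has_integral 0) {0..2*pi}"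
    by simp
  moreover have "1 / r ^ n * (f (r * cis t) * (r * cis t) ^ n) = f (r * cis t) * cis (n * t)" for t :: real
    using r by (simp add: power_mult_distrib Complex.DeMoivre)
  ultimately show ?thesis by simp
qed

text \<open>The negative Fourier coefficients of \<open>f\<close> vanish on every circle, so adding
  a conjugated zero integral expresses the coefficient through \<open>2 * Re f\<close>. Positivity
  lets the norm pass under the integral and the mean value property evaluates what is left; then
  \<open>r\<close> tends to 1.\<close>

lemma tcoeff_Caratheodory:
  assumes f: "f holomorphic_on unit_disc" and pos: "\<And>z. z \<in> unit_disc \<Longrightarrow> 0 \<le> Re (f z)"
    and n: "n \<ge> 1"
  shows "norm (tcoeff f n) \<le> 2 * Re (f 0)"
proof -
  have *: "norm (tcoeff f n) * r ^ n \<le> 2 * Re (f 0)" if r: "0 < (r::real)" "r < 1" for r :: real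
  proof -
    have "((\<lambda>t. cnj (f (r * cis t) * cis (n * t))) has_integral cnj 0) {0..2*pi}"
      using negative_coeff_circle_integral[OF f r n] by (subst (asm) has_integral_cnj[symmetric]) (simp only: o_def)
    then have "((\<lambda>t. f (r * cis t) * cis (- (n * t)) + cnj (f (r * cis t) * cis (n * t))) has_integral
        2 * pi * tcoeff f n * r ^ n + cnj 0) {0..2*pi}"
      by (intro has_integral_add) (use tcoeff_circle_integral[OF f r, of n] in \<open>simp only: of_real_power\<close>)
    moreover have "f (r * cis t) * cis (- (n * t)) + cnj (f (r * cis t) * cis (n * t)) =
        2 * Re (f (r * cis t)) * cis (- (n * t))" for t :: real
    proof -
      have "f (r * cis t) * cis (- (n * t)) + cnj (f (r * cis t) * cis (n * t)) =
         (f (r * cis t) + cnj (f (r * cis t))) * cis (- (n * t))"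
        by (simp only: complex_cnj_mult cis_cnj ring_distribs)
      then show ?thesis by (simp only: complex_add_cnj of_real_mult of_real_numeral)
    qed
    ultimately have 1: "((\<lambda>t. 2 * Re (f (r * cis t)) * cis (- (n * t))) has_integral
        2 * pi * tcoeff f n * r ^ n) {0..2*pi}" by (simp only: complex_cnj_zero add_0_right)
    have "tcoeff f 0 = f 0" by (simp add: fps_expansion_def)
    then have "((\<lambda>t. f (r * cis t)) has_integral 2 * pi * f 0) {0..2*pi}"
      using tcoeff_circle_integral[OF f r, of 0] by simp
    then have "((\<lambda>t. Re (f (r * cis t))) has_integral Re (2 * pi * f 0)) {0..2*pi}"
      by (rule has_integral_Re)
    then have 2: "((\<lambda>t. 2 * Re (f (r * cis t))) has_integral 2 * Re (2 * pi * f 0)) {0..2*pi}"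
      by (rule has_integral_mult_right)
    have "norm (2 * pi * tcoeff f n * r ^ n) \<le> 2 * Re (2 * pi * f 0)"
      using integral_norm_bound_integral[of "\<lambda>t. 2 * Re (f (r * cis t)) * cis (- (n * t))" "{0..2*pi}"
          "\<lambda>t. 2 * Re (f (r * cis t))"] 1 2 pos r
      proof -
      have "norm (integral {0..2*pi} (\<lambda>t. 2 * Re (f (r * cis t)) * cis (- (n * t))))
        \<le> integral {0..2*pi} (\<lambda>t. 2 * Re (f (r * cis t)))"
      proof (rule integral_norm_bound_integral)
        fix t :: real
        show "norm (2 * Re (f (r * cis t)) * cis (- (n * t))) \<le> 2 * Re (f (r * cis t))"
          using pos[of "r * cis t"] r by (simp add: norm_mult)
      next
        show "(\<lambda>t. complex_of_real (2 * Re (f (r * cis t))) * cis (- (n * t))) integrable_on {0..2*pi}"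
          by (rule has_integral_integrable[OF 1])
        show "(\<lambda>t. 2 * Re (f (r * cis t))) integrable_on {0..2*pi}"
          by (rule has_integral_integrable[OF 2])
      qed
      then show ?thesis
        by (simp only: integral_unique[OF 1] integral_unique[OF 2])
    qed
    then have "2 * pi * (norm (tcoeff f n) * r ^ n) \<le> 2 * pi * (2 * Re (f 0))"
      using r by (simp add: norm_mult norm_power mult.commute)
    then show ?thesis by (subst (asm) mult_le_cancel_left_pos) auto
  qed
  have "((\<lambda>r. norm (tcoeff f n) * r ^ n) \<longlongrightarrow> norm (tcoeff f n) * 1 ^ n) (at_left 1)"
    by (rule tendsto_mult[OF tendsto_const tendsto_power[OF tendsto_ident_at]])
  moreover have "\<forall>\<^sub>F r in at_left (1::real). norm (tcoeff f n) * r ^ n \<le> 2 * Re (f 0)"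
    using eventually_at_left_real[of 0 "1::real"] * by (simp add: eventually_mono)
  ultimately have "norm (tcoeff f n) * 1 ^ n \<le> 2 * Re (f 0)"
    by (rule tendsto_upperbound) simp
  then show ?thesis by simp
qed

lemma sum_arith_prog_real: "(\<Sum>i=0..n. real (n - i) + 1) = (real n + 1) * (real n + 2) / 2"
proof -
  have "(\<Sum>i=0..n. real (n - i) + 1) = (\<Sum>i=0..n. real i + 1)"
    by (rule sum.reindex_bij_witness[of _ "\<lambda>i. n - i" "\<lambda>i. n - i"]) auto
  also have "\<dots> = (real n + 1) * (real n + 2) / 2"
    by (induction n) (auto simp: field_simps)
  finally show ?thesis .
qed

text \<open>Dividing by \<open>p - cnj p * z^2\<close> costs one power of \<open>1/(1-z)\<close> in the coefficient majorant,
  and so does dividing by \<open>1 + e * \<omega>\<close>, where \<open>\<omega> = g'/h'\<close> is the dilatation.\<close>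

lemma shear_coeff_bounds:
  assumes h: "h holomorphic_on unit_disc" and g: "g holomorphic_on unit_disc"
    and gh: "\<And>z. z \<in> unit_disc \<Longrightarrow> norm (g z) < norm (h z)" and g0: "g 0 = 0"
    and unit: "norm e = 1" "norm c = 1" "norm p = 1"
    and pos: "\<And>z. z \<in> unit_disc \<Longrightarrow> 0 \<le> Re (c * (h z + e * g z) * (p - cnj p * z\<^sup>2))"
  shows "norm (tcoeff h n) \<le> norm (h 0) * ((real n + 1) * (real n + 2) / 2)"
    and "norm (tcoeff g n) \<le> norm (h 0) * (real n * (real n + 1) / 2)"
proof -
  define t where "t = norm (h 0)"
  define F where "F = (\<lambda>z. h z + e * g z)"
  define P where "P = (\<lambda>z. c * F z * (p - cnj p * z\<^sup>2))"
  define Q where "Q = (\<lambda>z. h z / F z)"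
  have hnz: "h z \<noteq> 0" if "z \<in> unit_disc" for z
    using gh[OF that] by auto
  have Fnz: "F z \<noteq> 0" if "z \<in> unit_disc" for z
  proof
    assume "F z = 0"
    then have "norm (h z) = norm (e * g z)"
      unfolding F_def by (metis add_eq_0_iff norm_minus_cancel)
    then show False using gh[OF that] unit by (simp add: norm_mult)
  qed
  have F: "F holomorphic_on unit_disc" and P: "P holomorphic_on unit_disc"
    unfolding F_def P_def by (intro holomorphic_intros h g)+
  have Q: "Q holomorphic_on unit_disc"
    unfolding Q_def using h F Fnz by (intro holomorphic_intros) auto
  have t: "t \<ge> 0" "norm (P 0) = t"
    unfolding t_def P_def F_def using g0 unit by (auto simp: norm_mult)
  then have "Re (P 0) \<le> t" using complex_Re_le_cmod[of "P 0"] by simp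
  have Pn: "norm (tcoeff P n) \<le> 2 * t" if "n \<ge> 1" for n
    using tcoeff_Caratheodory[OF P _ that] pos \<open>Re (P 0) \<le> t\<close> unfolding P_def F_def by fastforce
  have PF: "fps_expansion P 0 = fps_const c * fps_expansion F 0 * (fps_const p - fps_const (cnj p) * fps_X ^ 2)"
    unfolding P_def by (intro fps_expansion_eqI fps_expansion_intros has_fps_expansion_tcoeff F)
  \<comment> \<open>Comparing coefficients in \<open>P = c * F * (p - cnj p * z^2)\<close> gives a
    recurrence of step 2 with unimodular factors; adding \<open>2 * t\<close> at every second index
    produces the linear bound \<open>Fn\<close>.\<close>
  have FP: "norm (tcoeff F n) \<le> norm (tcoeff P n) + (if n \<ge> 2 then norm (tcoeff F (n - 2)) else 0)" for n
  proof -
    have "fps_const c * fps_expansion F 0 * (fps_const p - fps_const (cnj p) * fps_X ^ 2)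
      = fps_const (c * p) * fps_expansion F 0 - fps_const (c * cnj p) * (fps_X ^ 2 * fps_expansion F 0)"
      by (simp add: algebra_simps flip: fps_const_mult)
    then have "tcoeff P n = c * p * tcoeff F n - c * cnj p * (if n < 2 then 0 else tcoeff F (n - 2))"
      unfolding PF by (simp add: fps_X_power_mult_nth)
    then have "c * p * tcoeff F n = tcoeff P n + c * cnj p * (if n < 2 then 0 else tcoeff F (n - 2))"
      by simp
    then have "norm (c * p * tcoeff F n) \<le> norm (tcoeff P n) + norm (c * cnj p * (if n < 2 then 0 else tcoeff F (n - 2)))"
      by (metis norm_triangle_ineq)
    then show ?thesis using unit by (auto simp: norm_mult split: if_splits)
  qed
  have Fn: "norm (tcoeff F n) \<le> t * (real n + 1)" for n
  proof (induction n rule: less_induct)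
    case (less n)
    consider "n = 0" | "n = 1" | "n \<ge> 2" by linarith
    then show ?case
    proof cases
      case 1
      then show ?thesis using FP[of 0] t by (simp add: fps_expansion_def)
    next
      case 2
      then show ?thesis using FP[of 1] Pn[of 1] by simp
    next
      case 3
      then have "norm (tcoeff F n) \<le> 2 * t + t * (real (n - 2) + 1)"
        using FP[of n] Pn[of n] less[of "n - 2"] by auto
      then show ?thesis using 3 by (simp add: of_nat_diff algebra_simps)
    qed
  qed
  \<comment> \<open>\<open>2 * Q - 1\<close> is the Cayley transform
    \<open>(1 - w) / (1 + w)\<close> of \<open>w = e * g / h\<close>, which has norm below
    1.\<close>
  have Qpos: "0 \<le> Re (2 * Q z - 1)" if z: "z \<in> unit_disc" for z
  proof -
    define w where "w = e * g z / h z"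
    have w: "norm w < 1" using gh[OF z] hnz[OF z] unit by (simp add: w_def norm_mult norm_divide)
    then have "1 + w \<noteq> 0" by (metis add_eq_0_iff norm_minus_cancel norm_one less_irrefl)
    have Qw: "Q z = 1 / (1 + w)"
      using hnz[OF z] Fnz[OF z] unfolding Q_def F_def w_def by (simp add: field_simps)
    then have "2 * Q z - 1 = (1 - w) / (1 + w)"
      unfolding Qw using \<open>1 + w \<noteq> 0\<close> by (simp add: field_simps)
    moreover have "Re ((1 - w) / (1 + w)) = (1 - (norm w)\<^sup>2) / (norm (1 + w))\<^sup>2"
      by (simp add: Re_divide cmod_power2) (simp add: power2_eq_square algebra_simps)
    moreover have "(norm w)\<^sup>2 \<le> 1" using w by (simp add: abs_square_le_1)
    ultimately show ?thesis by simp
  qed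
  have Q0: "Q 0 = 1"
    using hnz[of 0] g0 by (simp add: Q_def F_def)
  have Qn: "norm (tcoeff Q n) \<le> 1" for n
  proof (cases "n \<ge> 1")
    case True
    have "(\<lambda>z. 2 * Q z - 1) holomorphic_on unit_disc" by (intro holomorphic_intros Q)
    from tcoeff_Caratheodory[OF this Qpos True]
    have "norm (tcoeff (\<lambda>z. 2 * Q z - 1) n) \<le> 2" using Q0 by simp
    moreover have "fps_expansion (\<lambda>z. 2 * Q z - 1) 0 = fps_const 2 * fps_expansion Q 0 - 1"
      by (intro fps_expansion_eqI fps_expansion_intros has_fps_expansion_tcoeff Q)
    ultimately show ?thesis using True by (simp add: norm_mult)
  next
    case False
    then have "n = 0" by simp
    then show ?thesis by (simp add: Q0 fps_expansion_def)
  qed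
  have "fps_expansion h 0 = fps_expansion (\<lambda>z. Q z * F z) 0"
    by (rule fps_expansion_cong) (auto simp: Q_def Fnz eventually_nhds intro!: exI[of _ unit_disc])
  also have "\<dots> = fps_expansion Q 0 * fps_expansion F 0"
    by (intro fps_expansion_eqI fps_expansion_intros has_fps_expansion_tcoeff F Q)
  finally have hf: "fps_expansion h 0 = fps_expansion Q 0 * fps_expansion F 0" .
  have conv: "norm (\<Sum>i=0..n. q i * tcoeff F (n - i)) \<le> t * (\<Sum>i=0..n. norm (q i) * (real (n - i) + 1))"
    for q :: "nat \<Rightarrow> complex"
  proof -
    have "norm (\<Sum>i=0..n. q i * tcoeff F (n - i)) \<le> (\<Sum>i=0..n. norm (q i) * (t * (real (n - i) + 1)))"
      by (rule sum_norm_le) (simp only: norm_mult, intro mult_left_mono Fn norm_ge_zero)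
    then show ?thesis by (simp add: sum_distrib_left mult_ac)
  qed
  have "norm (tcoeff h n) \<le> t * (\<Sum>i=0..n. norm (tcoeff Q i) * (real (n - i) + 1))"
    unfolding hf fps_mult_nth by (rule conv)
  also have "\<dots> \<le> t * (\<Sum>i=0..n. 1 * (real (n - i) + 1))"
    using t by (intro mult_left_mono sum_mono mult_right_mono Qn) auto
  finally show "norm (tcoeff h n) \<le> norm (h 0) * ((real n + 1) * (real n + 2) / 2)"
    by (simp only: t_def sum_arith_prog_real mult_1)
  \<comment> \<open>Here \<open>e * g = F - h = (1 - Q) * F\<close>, and \<open>1 - Q\<close> has no
    constant term; this lowers the majorant of \<open>g\<close> by one index against that of
    \<open>h\<close>.\<close>
  have "fps_expansion F 0 = fps_expansion h 0 + fps_const e * fps_expansion g 0"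
    unfolding F_def by (intro fps_expansion_eqI fps_expansion_intros has_fps_expansion_tcoeff h g)
  then have "fps_const e * fps_expansion g 0 = (1 - fps_expansion Q 0) * fps_expansion F 0"
    unfolding hf by (simp add: algebra_simps)
  then have "e * tcoeff g n = fps_nth ((1 - fps_expansion Q 0) * fps_expansion F 0) n"
    by (metis fps_mult_left_const_nth)
  then have "norm (tcoeff g n) = norm (fps_nth ((1 - fps_expansion Q 0) * fps_expansion F 0) n)"
    using unit by (metis norm_mult mult_1)
  also have "\<dots> \<le> t * (\<Sum>i=0..n. norm (fps_nth (1 - fps_expansion Q 0) i) * (real (n - i) + 1))"
    unfolding fps_mult_nth by (rule conv)
  also have "\<dots> \<le> t * (\<Sum>i=0..n. (if i = 0 then 0 else 1) * (real (n - i) + 1))"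
  proof (intro mult_left_mono sum_mono mult_right_mono)
    show "norm (fps_nth (1 - fps_expansion Q 0) i) \<le> (if i = 0 then 0 else 1)" for i
      using Qn[of i] Q0 by (auto simp: fps_expansion_def)
  qed (use t in auto)
  also have "(\<Sum>i=0..n. (if i = 0 then 0 else 1) * (real (n - i) + 1)) = (\<Sum>i=0..n. real (n - i) + 1) - (real n + 1)"
  proof -
    have "(\<Sum>i=0..n. (if i = 0 then 0 else 1) * (real (n - i) + 1)) =
       (\<Sum>i=0..n. (real (n - i) + 1) - (if i = 0 then real n + 1 else 0))"
      by (rule sum.cong) auto
    then show ?thesis by (simp add: sum_subtractf sum.delta)
  qed
  finally show "norm (tcoeff g n) \<le> norm (h 0) * (real n * (real n + 1) / 2)"
    by (simp only: t_def sum_arith_prog_real) (simp add: field_simps)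
qed

section \<open>A sufficient condition for starlikeness\<close>

text \<open>The quotient \<open>q s = c s / c t\<close> equals 1 at \<open>t\<close>, away from the
  branch cut, so the principal logarithm of \<open>q\<close> supplies a branch of the argument
  differentiable at \<open>t\<close>, wherever \<open>c t\<close> lies.\<close>

lemma has_arg_derivativeI:
  fixes c :: "real \<Rightarrow> complex"
  assumes c: "(c has_vector_derivative c') (at t)" and nz: "c t \<noteq> 0"
  shows "has_arg_derivative c (Im (c' / c t)) t"
proof -
  define q where "q = (\<lambda>s. c s / c t)"
  define \<phi> where "\<phi> = (\<lambda>s. Im (Ln (q s)) + Arg (c t))"
  have cc: "isCont c t" using c has_vector_derivative_continuous by blast
  have nz_ev: "\<forall>\<^sub>F s in nhds t. c s \<noteq> 0"
    using cc nz by (metis tendsto_imp_eventually_ne tendsto_at_iff_tendsto_nhds isCont_def)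
  have q: "(q has_vector_derivative c' / c t) (at t)"
    unfolding q_def using c by (auto intro!: derivative_eq_intros)
  have qt: "q t = 1" using nz by (simp add: q_def)
  have "(Ln has_field_derivative inverse (q t)) (at (q t))"
    by (rule has_field_derivative_Ln) (simp add: qt)
  from field_vector_diff_chain_at[OF q this]
  have "((Ln \<circ> q) has_vector_derivative c' / c t) (at t)" by (simp add: qt)
  then have "((\<lambda>s. Im (Ln (q s))) has_vector_derivative Im (c' / c t)) (at t)"
    using bounded_linear.has_vector_derivative[OF bounded_linear_Im] by (simp only: o_def)
  then have "((\<lambda>s. Im (Ln (q s))) has_real_derivative Im (c' / c t)) (at t)"
    by (simp add: has_real_derivative_iff_has_vector_derivative)
  then have "(\<phi> has_real_derivative Im (c' / c t)) (at t)"
    unfolding \<phi>_def using DERIV_add[OF _ DERIV_const] by fastforce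
  moreover have "\<forall>\<^sub>F s in nhds t. c s \<noteq> 0 \<and> c s = rcis (norm (c s)) (\<phi> s)"
  proof (rule eventually_mono[OF nz_ev])
    fix s assume s: "c s \<noteq> 0"
    have "c s = q s * c t" using nz by (simp add: q_def)
    also have "\<dots> = rcis (norm (q s)) (Arg (q s)) * rcis (norm (c t)) (Arg (c t))"
      by (simp only: rcis_cmod_Arg)
    also have "\<dots> = rcis (norm (q s) * norm (c t)) (Arg (q s) + Arg (c t))"
      by (simp only: rcis_mult)
    also have "norm (q s) * norm (c t) = norm (c s)" using nz by (simp add: q_def norm_divide)
    also have "Arg (q s) = Im (Ln (q s))" using s nz by (simp add: q_def Arg_def)
    finally show "c s \<noteq> 0 \<and> c s = rcis (norm (c s)) (\<phi> s)" using s by (simp add: \<phi>_def)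
  qed
  ultimately show ?thesis unfolding has_arg_derivative_def by blast
qed

text \<open>The half-plane \<open>Re q > \<alpha>\<close> consists of the points nearer to
  \<open>1 + \<alpha>\<close> than to its mirror image \<open>\<alpha> - 1\<close>. Multiplied
  through by \<open>z\<close>, the inequality also yields \<open>z \<noteq> 0\<close>.\<close>

lemma Re_divide_greater_if_norm_less:
  fixes w z :: complex
  assumes "norm (w - (1 + \<alpha>) * z) < norm (w + (1 - \<alpha>) * z)"
  shows "z \<noteq> 0 \<and> Re (w / z) > \<alpha>"
proof -
  have nz: "z \<noteq> 0" using assms by auto
  define q where "q = w / z"
  have "w = q * z" using nz by (simp add: q_def)
  then have "w - (1 + \<alpha>) * z = (q - (1 + \<alpha>)) * z" "w + (1 - \<alpha>) * z = (q + (1 - \<alpha>)) * z"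
    by (auto simp: algebra_simps)
  then have "norm (q - (1 + \<alpha>)) < norm (q + (1 - \<alpha>))"
    using assms nz by (simp add: norm_mult)
  then have "(norm (q - (1 + \<alpha>)))\<^sup>2 < (norm (q + (1 - \<alpha>)))\<^sup>2"
    by (simp add: power_strict_mono)
  then have "Re q > \<alpha>"
    unfolding cmod_power2 by (simp add: power2_eq_square algebra_simps)
  with nz show ?thesis by (simp add: q_def)
qed

text \<open>With \<open>w0\<close> the value and \<open>i * w1\<close> its derivative in the angle,
  the claim \<open>Re (w1 / w0) > \<alpha>\<close> is put in the form \<open>norm (w1 - (1 +
  \<alpha>) * w0) < norm (w1 + (1 - \<alpha>) * w0)\<close>. The leading terms have norms
  \<open>\<alpha> * r\<close> and \<open>(2 - \<alpha>) * r\<close>, and the coefficient sum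
  controls the two remainders together.\<close>

lemma HS_star_if_coeff_sum_le:
  fixes h g :: "complex \<Rightarrow> complex" and \<alpha> :: real
  assumes \<alpha>: "0 \<le> \<alpha>" "\<alpha> < 1"
    and h: "h holomorphic_on unit_disc" and g: "g holomorphic_on unit_disc"
    and h01: "h 0 = 0" "deriv h 0 = 1" and g01: "g 0 = 0" "deriv g 0 = 0"
    and summ: "summable (\<lambda>n. (real (n + 2) - \<alpha>) * norm (tcoeff h (n + 2)) + (real (n + 2) + \<alpha>) * norm (tcoeff g (n + 2)))"
    and le: "(\<Sum>n. (real (n + 2) - \<alpha>) * norm (tcoeff h (n + 2)) + (real (n + 2) + \<alpha>) * norm (tcoeff g (n + 2))) \<le> 1 - \<alpha>"
  shows "(\<lambda>z. h z + cnj (g z)) \<in> HS_star \<alpha>"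
proof -
  define F where "F = (\<lambda>z. h z + cnj (g z))"
  have "harmonic_decomp F h g"
    using h g h01 g01 by (simp add: harmonic_decomp_def F_def)
  then have "F \<in> H_hat" by (auto simp: H_hat_def)
  moreover have "\<exists>D. has_arg_derivative (\<lambda>t. F (rcis r t)) D \<theta> \<and> D > \<alpha>"
    if r: "0 < r" "r < 1" for r \<theta> :: real
  proof -
    define z where "z = rcis r \<theta>"
    have z: "z \<in> unit_disc" "norm z = r" using r by (auto simp: z_def)
    define w0 where "w0 = F z"
    define w1 where "w1 = z * deriv h z - cnj (z * deriv g z)"
    define a where "a = tcoeff h"
    define b where "b = tcoeff g"
    have ab: "a 0 = 0" "a 1 = 1" "b 0 = 0" "b 1 = 0"
      using h01 g01 by (auto simp: a_def b_def fps_expansion_def)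
    have ser: "(\<lambda>n. fps_nth (fps_expansion f 0) n * z ^ n) sums f z"
      "(\<lambda>n. of_nat n * (fps_nth (fps_expansion f 0) n * z ^ n)) sums (z * deriv f z)"
      if f: "f holomorphic_on unit_disc" for f
    proof -
      show "(\<lambda>n. fps_nth (fps_expansion f 0) n * z ^ n) sums f z" by (rule tcoeff_sums[OF f z(1)])
      have "(\<lambda>w. w * deriv f w) holomorphic_on unit_disc"
        by (intro holomorphic_intros f) auto
      from tcoeff_sums[OF this z(1)]
      have "(\<lambda>n. tcoeff (\<lambda>w. w * deriv f w) n * z ^ n) sums (z * deriv f z)" .
      moreover have "fps_expansion (\<lambda>w. w * deriv f w) 0 = fps_X * fps_deriv (fps_expansion f 0)"
        by (intro fps_expansion_eqI fps_expansion_intros has_fps_expansion_tcoeff f)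
      ultimately show "(\<lambda>n. of_nat n * (fps_nth (fps_expansion f 0) n * z ^ n)) sums (z * deriv f z)"
        by (elim sums_cong[THEN iffD1, rotated]) (auto simp: fps_X_mult_nth algebra_simps of_nat_diff)
    qed
    have lin: "(\<lambda>n. (of_nat n + of_real k) * a n * z ^ n - cnj ((of_nat n - of_real k) * b n * z ^ n)) sums (w1 + of_real k * w0)" for k :: real
    proof -
      have 1: "(\<lambda>n. of_nat n * (a n * z ^ n) + of_real k * (a n * z ^ n)) sums (z * deriv h z + of_real k * h z)"
        unfolding a_def by (intro sums_add sums_mult ser h)
      have 2: "(\<lambda>n. cnj (of_nat n * (b n * z ^ n) - of_real k * (b n * z ^ n))) sums cnj (z * deriv g z - of_real k * g z)"
        unfolding b_def sums_cnj by (intro sums_diff sums_mult ser g)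
      have eq: "w1 + of_real k * w0 = (z * deriv h z + of_real k * h z) - cnj (z * deriv g z - of_real k * g z)"
        by (simp add: w0_def w1_def F_def algebra_simps)
      show ?thesis
        unfolding eq by (rule sums_cong[THEN iffD1, OF _ sums_diff[OF 1 2]]) (simp add: algebra_simps)
    qed
    define x where "x = (\<lambda>n. (real (n + 2) - \<alpha>) * norm (a (n + 2)) + (real (n + 2) + \<alpha>) * norm (b (n + 2)))"
    define u where "u = (\<lambda>k n. (of_nat n + complex_of_real k) * a n * z ^ n - cnj ((of_nat n - of_real k) * b n * z ^ n))"
    have nu: "norm (u k n) \<le> (\<bar>real n + k\<bar> * norm (a n) + \<bar>real n - k\<bar> * norm (b n)) * r ^ n" for k n
    proof -
      have "norm (u k n) \<le> norm ((of_nat n + complex_of_real k) * a n * z ^ n) + norm ((of_nat n - complex_of_real k) * b n * z ^ n)"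
        unfolding u_def using norm_triangle_ineq4 complex_mod_cnj by metis
      moreover have "norm (of_nat n + complex_of_real k) = \<bar>real n + k\<bar>" "norm (of_nat n - complex_of_real k) = \<bar>real n - k\<bar>"
        by (metis of_real_of_nat_eq of_real_add norm_of_real, metis of_real_of_nat_eq of_real_diff norm_of_real)
      ultimately show ?thesis using z by (simp only: norm_mult norm_power) (simp only: distrib_right)
    qed
    have tail: "(\<lambda>n. u k (n + 2)) sums (w1 + of_real k * w0 - (1 + of_real k) * z)" for k
    proof -
      have "(\<lambda>n. u k (n + 2)) sums (w1 + of_real k * w0 - (\<Sum>i<2. u k i))"
        using lin[of k] unfolding u_def by (rule sums_split_initial_segment)
      moreover have "(\<Sum>i<2. u k i) = (1 + of_real k) * z"
        using ab by (simp add: u_def eval_nat_numeral)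
      ultimately show ?thesis by simp
    qed
    define C where "C = (\<lambda>k n. \<bar>real (n+2) + k\<bar> * norm (a (n+2)) + \<bar>real (n+2) - k\<bar> * norm (b (n+2)))"
    have xn: "x n \<ge> 0" for n unfolding x_def using \<alpha> by (intro add_nonneg_nonneg mult_nonneg_nonneg) auto
    \<comment> \<open>With \<open>m = n + 2\<close>, the absolute values for the two choices of
      \<open>k\<close> add up to \<open>2 * (m - \<alpha>)\<close> and
      \<open>2 * (m + \<alpha>)\<close>: this is the origin of the weights in the
      hypothesis.\<close>
    have Csum: "C (1 - \<alpha>) n + C (- (1 + \<alpha>)) n = 2 * x n" for n
      unfolding C_def x_def using \<alpha> by (simp add: abs_if algebra_simps)
    have Cnn: "C k n \<ge> 0" for k n by (simp add: C_def)
    have sx: "summable x" using summ unfolding x_def a_def b_def .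
    have sC: "summable (\<lambda>n. C k n * r ^ 2)" if "k = 1 - \<alpha> \<or> k = - (1 + \<alpha>)" for k
    proof (rule summable_mult2, rule summable_comparison_test[of _ "\<lambda>n. 2 * x n"])
      show "\<exists>N. \<forall>n\<ge>N. norm (C k n) \<le> 2 * x n"
        using Csum Cnn that by (metis abs_of_nonneg add_increasing add_increasing2 order_refl real_norm_def)
    qed (intro summable_mult sx)
    have tailbd: "norm (w1 + of_real k * w0 - (1 + of_real k) * z) \<le> (\<Sum>n. C k n * r ^ 2)"
      if "k = 1 - \<alpha> \<or> k = - (1 + \<alpha>)" for k
    proof -
      have "norm (u k (n + 2)) \<le> C k n * r ^ 2" for n
      proof -
        have "norm (u k (n + 2)) \<le> C k n * r ^ (n + 2)" using nu[of k "n + 2"] unfolding C_def by simp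
        also have "\<dots> \<le> C k n * r ^ 2" using r Cnn by (intro mult_left_mono power_decreasing) auto
        finally show ?thesis .
      qed
      then have "norm (\<Sum>n. u k (n + 2)) \<le> (\<Sum>n. C k n * r ^ 2)"
        using sC[OF that] by (intro norm_suminf_le)
      then show ?thesis using tail[of k] by (simp add: sums_iff)
    qed
    have tot: "(\<Sum>n. C (1 - \<alpha>) n * r ^ 2) + (\<Sum>n. C (- (1 + \<alpha>)) n * r ^ 2) = 2 * suminf x * r ^ 2"
    proof -
      have "(\<Sum>n. C (1 - \<alpha>) n * r ^ 2) + (\<Sum>n. C (- (1 + \<alpha>)) n * r ^ 2)
         = (\<Sum>n. C (1 - \<alpha>) n * r ^ 2 + C (- (1 + \<alpha>)) n * r ^ 2)"
        by (intro suminf_add sC) auto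
      also have "\<dots> = (\<Sum>n. x n * (2 * r ^ 2))"
        using Csum by (intro suminf_cong) (simp flip: distrib_right)
      also have "\<dots> = suminf x * (2 * r ^ 2)" by (rule suminf_mult2[symmetric]) (rule sx)
      finally show ?thesis by simp
    qed
    have "suminf x \<le> 1 - \<alpha>" using le unfolding x_def a_def b_def .
    moreover have "suminf x \<ge> 0" using sx xn by (intro suminf_nonneg) auto
    \<comment> \<open>The remainders start at exponent 2 and the leading terms at exponent 1; this
      makes the conclusion strict although the hypothesis is not.\<close>
    moreover have "r ^ 2 < r" using r by (simp add: power2_eq_square)
    ultimately have "suminf x * r ^ 2 < (1 - \<alpha>) * r"
      using \<alpha> r by (meson mult_left_mono mult_right_mono mult_strict_left_mono order_le_less_trans diff_gt_0_iff_gt zero_le_power less_imp_le)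
    define X where "X = w1 + of_real (1 - \<alpha>) * w0"
    define Y where "Y = w1 + of_real (- (1 + \<alpha>)) * w0"
    have "norm (X - (1 + of_real (1 - \<alpha>)) * z) + norm (Y - (1 + of_real (- (1 + \<alpha>))) * z) \<le> 2 * suminf x * r ^ 2"
      using tailbd[of "1 - \<alpha>"] tailbd[of "- (1 + \<alpha>)"] tot unfolding X_def Y_def by simp
    moreover have "norm ((1 + complex_of_real (1 - \<alpha>)) * z) = (2 - \<alpha>) * r"
    proof -
      have "1 + complex_of_real (1 - \<alpha>) = of_real (2 - \<alpha>)" by simp
      then show ?thesis using z \<alpha> by (simp only: norm_mult norm_of_real)
    qed
    moreover have "norm ((1 + complex_of_real (- (1 + \<alpha>))) * z) = \<alpha> * r"
      using z \<alpha> by (simp add: norm_mult)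
    moreover have "norm X \<ge> norm ((1 + complex_of_real (1 - \<alpha>)) * z) - norm (X - (1 + of_real (1 - \<alpha>)) * z)"
      by (metis norm_minus_commute norm_triangle_ineq2 diff_le_eq add.commute)
    moreover have "norm Y \<le> norm ((1 + complex_of_real (- (1 + \<alpha>))) * z) + norm (Y - (1 + of_real (- (1 + \<alpha>))) * z)"
      by (metis norm_triangle_sub)
    ultimately have "norm Y < norm X"
      using \<open>suminf x * r ^ 2 < (1 - \<alpha>) * r\<close> by (simp add: algebra_simps)
    moreover have "Y = w1 - (1 + of_real \<alpha>) * w0" "X = w1 + (1 - of_real \<alpha>) * w0"
      by (simp_all add: X_def Y_def algebra_simps)
    ultimately have fin: "w0 \<noteq> 0 \<and> Re (w1 / w0) > \<alpha>"
      using Re_divide_greater_if_norm_less by metis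
    have dr: "((\<lambda>t. rcis r t) has_vector_derivative \<i> * z) (at \<theta>)"
    proof -
      have "((\<lambda>w. of_real r * exp (\<i> * w)) has_field_derivative \<i> * z) (at (of_real \<theta>))"
        by (auto intro!: derivative_eq_intros simp: z_def rcis_def cis_conv_exp)
      from has_vector_derivative_real_field[OF this] show ?thesis
        by (simp add: rcis_def cis_conv_exp)
    qed
    have dd: "((\<lambda>t. f (rcis r t)) has_vector_derivative \<i> * (z * deriv f z)) (at \<theta>)"
      if f: "f holomorphic_on unit_disc" for f
    proof -
      have "(f has_field_derivative deriv f z) (at (rcis r \<theta>))"
        using holomorphic_derivI[OF f open_ball z(1)] by (simp add: z_def)
      from field_vector_diff_chain_at[OF dr this] show ?thesis by (simp add: o_def algebra_simps)
    qed
    have "((\<lambda>t. F (rcis r t)) has_vector_derivative \<i> * (z * deriv h z) + cnj (\<i> * (z * deriv g z))) (at \<theta>)"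
      unfolding F_def by (intro has_vector_derivative_add has_vector_derivative_cnj dd h g)
    moreover have "\<i> * (z * deriv h z) + cnj (\<i> * (z * deriv g z)) = \<i> * w1"
      by (simp add: w1_def algebra_simps)
    ultimately have "((\<lambda>t. F (rcis r t)) has_vector_derivative \<i> * w1) (at \<theta>)" by simp
    from has_arg_derivativeI[OF this] fin
    have "has_arg_derivative (\<lambda>t. F (rcis r t)) (Im (\<i> * w1 / w0)) \<theta>"
      by (simp add: w0_def z_def)
    moreover have "Im (\<i> * w1 / w0) = Re (w1 / w0)" by (metis Im_i_times times_divide_eq_right)
    ultimately show ?thesis using fin by auto
  qed
  ultimately show ?thesis by (simp add: HS_star_def F_def)
qed

section \<open>Length and area\<close>

lemma borel_measurable_Complex_pair:
  "(\<lambda>(x, y). Complex x y) \<in> borel_measurable (lborel \<Otimes>\<^sub>M lborel)"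
proof -
  have "continuous_on UNIV (\<lambda>(x, y). Complex x y)"
    by (auto simp: case_prod_beta Complex_eq intro!: continuous_intros)
  then show ?thesis unfolding lborel_prod by (simp add: borel_measurable_continuous_onI)
qed

lemma lborel_complex_eq_distr_prod:
  "(lborel :: complex measure) = distr (lborel \<Otimes>\<^sub>M lborel) borel (\<lambda>(x, y). Complex x y)"
proof (rule lborel_eqI)
  note m = borel_measurable_Complex_pair
  fix l u :: complex assume "\<And>b. b \<in> Basis \<Longrightarrow> l \<bullet> b \<le> u \<bullet> b"
  from this[of 1] this[of \<i>] have le: "Re l \<le> Re u" "Im l \<le> Im u" by (simp_all add: Basis_complex_def)
  have "(\<lambda>(x, y). Complex x y) -` box l u = {Re l<..<Re u} \<times> {Im l<..<Im u}"
    by (auto simp: in_box_complex_iff box_complex_eq)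
  then show "emeasure (distr (lborel \<Otimes>\<^sub>M lborel) borel (\<lambda>(x, y). Complex x y)) (box l u) = ennreal (\<Prod>b\<in>Basis. (u - l) \<bullet> b)"
    using le by (simp add: emeasure_distr[OF m] space_pair_measure lborel.emeasure_pair_measure_Times Basis_complex_def ennreal_mult)
qed simp

definition vec_to_complex :: "real ^ 2 \<Rightarrow> complex" where "vec_to_complex v = Complex (v $ 1) (v $ 2)"
definition complex_to_vec :: "complex \<Rightarrow> real ^ 2" where "complex_to_vec z = vector [Re z, Im z]"

lemma vec_complex_inverse [simp]:
  "vec_to_complex (complex_to_vec z) = z" "complex_to_vec (vec_to_complex v) = v"
  by (auto simp: vec_to_complex_def complex_to_vec_def vec_eq_iff forall_2)

lemma bounded_linear_vec_to_complex: "bounded_linear vec_to_complex"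
  unfolding linear_conv_bounded_linear[symmetric]
  by (auto intro!: linearI simp: vec_to_complex_def complex_eq_iff)

lemma bounded_linear_complex_to_vec: "bounded_linear complex_to_vec"
  unfolding linear_conv_bounded_linear[symmetric]
  by (auto intro!: linearI simp: complex_to_vec_def vec_eq_iff forall_2)

text \<open>The area formula is applied in \<open>real ^ 2\<close>, while the length-area argument
  integrates over real and imaginary part in turn; both are compared through Lebesgue measure on
  \<open>complex\<close>.\<close>

lemma lborel_complex_eq_distr_vec:
  "(lborel :: complex measure) = distr lborel borel vec_to_complex"
proof (rule lborel_eqI)
  have m: "vec_to_complex \<in> borel_measurable lborel"
    using linear_continuous_on[OF bounded_linear_vec_to_complex] by (simp add: borel_measurable_continuous_onI)
  fix l u :: complex assume "\<And>b. b \<in> Basis \<Longrightarrow> l \<bullet> b \<le> u \<bullet> b"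
  from this[of 1] this[of \<i>] have le: "Re l \<le> Re u" "Im l \<le> Im u" by (simp_all add: Basis_complex_def)
  have "vec_to_complex -` box l u = box (complex_to_vec l) (complex_to_vec u)"
    by (auto simp: in_box_complex_iff mem_box_cart forall_2 vec_to_complex_def complex_to_vec_def)
  moreover have "emeasure lborel (box (complex_to_vec l) (complex_to_vec u)) = ennreal (\<Prod>b\<in>Basis. (u - l) \<bullet> b)"
  proof -
    have "(\<Prod>b\<in>Basis. (complex_to_vec u - complex_to_vec l) \<bullet> b) = (\<Prod>i\<in>UNIV. (complex_to_vec u - complex_to_vec l) \<bullet> axis i (1::real))"
      unfolding Basis_vec_def by (simp add: prod.reindex inj_on_def axis_eq_axis UNION_singleton_eq_range)
    also have "\<dots> = (Re u - Re l) * (Im u - Im l)"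
      by (simp add: UNIV_2 inner_axis complex_to_vec_def)
    finally have eq: "(\<Prod>b\<in>Basis. (complex_to_vec u - complex_to_vec l) \<bullet> b) = (Re u - Re l) * (Im u - Im l)" .
    have "complex_to_vec l $ i \<le> complex_to_vec u $ i" for i
      using exhaust_2[of i] le by (auto simp: complex_to_vec_def)
    then show ?thesis using eq
      by (subst emeasure_lborel_box) (auto simp: Basis_vec_def inner_axis Basis_complex_def)
  qed
  ultimately show "emeasure (distr lborel borel vec_to_complex) (box l u) = ennreal (\<Prod>b\<in>Basis. (u - l) \<bullet> b)"
    by (simp add: emeasure_distr[OF m])
qed simp

lemma det_matrix_complex_mult:
  "det (matrix (\<lambda>v. complex_to_vec (d * vec_to_complex v))) = (norm d)\<^sup>2"
  unfolding cmod_power2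
  by (simp add: det_2 matrix_def complex_to_vec_def vec_to_complex_def axis_def power2_eq_square)

text \<open>For injective \<open>\<phi>\<close> the integral is the area of the image of
  \<open>U\<close>, since a holomorphic map has Jacobian \<open>norm (deriv \<phi> z) ^ 2\<close>.
  The order of quantifiers matters: \<open>C\<close> depends neither on \<open>\<phi>\<close> nor on
  \<open>U\<close>.\<close>

lemma nn_integral_norm_deriv_sq_le:
  "\<exists>C>0. \<forall>\<phi> U. open U \<longrightarrow> \<phi> holomorphic_on U \<longrightarrow> inj_on \<phi> U \<longrightarrow> \<phi> ` U \<subseteq> unit_disc \<longrightarrow>
      (\<integral>\<^sup>+x. \<integral>\<^sup>+y. ennreal ((norm (deriv \<phi> (Complex x y)))\<^sup>2) * indicator U (Complex x y) \<partial>lborel \<partial>lborel) \<le> ennreal C"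
proof -
  have cont: "continuous_on A complex_to_vec" "continuous_on B vec_to_complex" for A B
    by (intro linear_continuous_on bounded_linear_complex_to_vec bounded_linear_vec_to_complex)+
  have im: "complex_to_vec ` A = vec_to_complex -` A" for A
    by (force simp: image_iff)
  define B where "B = complex_to_vec ` unit_disc"
  have B: "B \<in> lmeasurable"
  proof (rule lmeasurable_open)
    show "bounded B" unfolding B_def
      using bounded_linear_image[OF bounded_ball bounded_linear_complex_to_vec] .
    show "open B" unfolding B_def im by (rule open_vimage[OF open_ball cont(2)])
  qed
  have *: "(\<integral>\<^sup>+x. \<integral>\<^sup>+y. ennreal ((norm (deriv \<phi> (Complex x y)))\<^sup>2) * indicator U (Complex x y) \<partial>lborel \<partial>lborel)
      \<le> ennreal (measure lebesgue B + 1)"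
    if U: "open U" and hol: "\<phi> holomorphic_on U" and inj: "inj_on \<phi> U" and sub: "\<phi> ` U \<subseteq> unit_disc" for \<phi> U
  proof -
  define f where "f = (\<lambda>z. ennreal ((norm (deriv \<phi> z))\<^sup>2) * indicator U z)"
  define S where "S = vec_to_complex -` U"
  define g where "g = complex_to_vec \<circ> \<phi> \<circ> vec_to_complex"
  define g' where "g' = (\<lambda>x v. complex_to_vec (deriv \<phi> (vec_to_complex x) * vec_to_complex v))"
  have "open S" unfolding S_def by (rule open_vimage[OF U cont(2)])
  have gS: "g ` S = complex_to_vec ` (\<phi> ` U)"
  proof -
    have "vec_to_complex ` S = U" unfolding S_def by (force intro: image_eqI[of _ _ "complex_to_vec _"])
    then show ?thesis unfolding g_def by (metis image_comp)
  qed
  have "open (\<phi> ` U)" by (rule open_mapping_thm3[OF hol U inj])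
  then have "open (g ` S)" unfolding gS im by (rule open_vimage[OF _ cont(2)])
  moreover have gB: "g ` S \<subseteq> B" unfolding gS B_def using sub by blast
  ultimately have m: "g ` S \<in> lmeasurable"
    using B lmeasurable_open bounded_subset bounded_linear_image[OF bounded_ball bounded_linear_complex_to_vec]
    unfolding B_def by metis
  have der: "(g has_derivative g' x) (at x within S)" if "x \<in> S" for x
  proof -
    have "(\<phi> has_field_derivative deriv \<phi> (vec_to_complex x)) (at (vec_to_complex x))"
      using holomorphic_derivI[OF hol U] that by (auto simp: S_def)
    then have "(\<phi> has_derivative (*) (deriv \<phi> (vec_to_complex x))) (at (vec_to_complex x))"
      by (simp add: has_field_derivative_def)
    from has_derivative_compose[OF has_derivative_compose[OF
        bounded_linear_imp_has_derivative[OF bounded_linear_vec_to_complex] this]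
        bounded_linear_imp_has_derivative[OF bounded_linear_complex_to_vec]]
    show ?thesis unfolding g_def g'_def o_def by (simp add: has_derivative_at_withinI)
  qed
  have injg: "inj_on g S"
    using inj unfolding g_def S_def inj_on_def o_def by (metis vec_complex_inverse vimageE)
  have "((\<lambda>x. \<bar>det (matrix (g' x))\<bar>) has_integral measure lebesgue (g ` S)) S"
    using has_measure_differentiable_image[of S g g' "measure lebesgue (g ` S)"] m der injg \<open>open S\<close> by auto
  then have "((\<lambda>x. (norm (deriv \<phi> (vec_to_complex x)))\<^sup>2) has_integral measure lebesgue (g ` S)) S"
    by (simp add: g'_def det_matrix_complex_mult)
  from nn_integral_has_integral_lebesgue'[OF _ this]
  have *: "(\<integral>\<^sup>+x. f (vec_to_complex x) \<partial>lborel) = ennreal (measure lebesgue (g ` S))"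
    by (simp add: f_def S_def indicator_def)
  have mono: "measure lebesgue (g ` S) \<le> measure lebesgue B"
    by (rule measure_mono_fmeasurable[OF gB _ B]) (use m in auto)
  have fm: "f \<in> borel_measurable borel"
  proof -
    have "continuous_on U (deriv \<phi>)"
      using hol U by (intro holomorphic_on_imp_continuous_on holomorphic_deriv)
    then have "(\<lambda>z. indicator U z *\<^sub>R (norm (deriv \<phi> z))\<^sup>2) \<in> borel_measurable borel"
      using U by (intro borel_measurable_continuous_on_indicator continuous_intros) auto
    then have "(\<lambda>z. ennreal (indicator U z *\<^sub>R (norm (deriv \<phi> z))\<^sup>2)) \<in> borel_measurable borel" by simp
    moreover have "f = (\<lambda>z. ennreal (indicator U z *\<^sub>R (norm (deriv \<phi> z))\<^sup>2))"
      by (auto simp: f_def fun_eq_iff indicator_def)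
    ultimately show ?thesis by simp
  qed
  have mv: "vec_to_complex \<in> borel_measurable lborel"
    using cont(2) by (simp add: borel_measurable_continuous_onI)
  have mc: "(\<lambda>(x, y). Complex x y) \<in> borel_measurable (lborel \<Otimes>\<^sub>M lborel)"
    by (rule borel_measurable_Complex_pair)
  have "(\<integral>\<^sup>+x. f (vec_to_complex x) \<partial>lborel) = (\<integral>\<^sup>+z. f z \<partial>lborel)"
    by (subst lborel_complex_eq_distr_vec) (simp add: nn_integral_distr[OF mv] fm)
  also have "\<dots> = (\<integral>\<^sup>+p. f (case p of (x, y) \<Rightarrow> Complex x y) \<partial>(lborel \<Otimes>\<^sub>M lborel))"
    by (subst lborel_complex_eq_distr_prod) (simp add: nn_integral_distr[OF mc] fm)
  also have "\<dots> = (\<integral>\<^sup>+x. \<integral>\<^sup>+y. f (Complex x y) \<partial>lborel \<partial>lborel)"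
    by (subst lborel.nn_integral_fst[symmetric]) (use measurable_compose[OF mc fm] in \<open>simp_all\<close>)
  finally show "(\<integral>\<^sup>+x. \<integral>\<^sup>+y. ennreal ((norm (deriv \<phi> (Complex x y)))\<^sup>2) * indicator U (Complex x y) \<partial>lborel \<partial>lborel)
      \<le> ennreal (measure lebesgue B + 1)"
    using * mono unfolding f_def by (metis ennreal_leI add_increasing2 zero_le_one)
  qed
  show ?thesis
  proof (intro exI conjI allI impI)
    show "measure lebesgue B + 1 > 0" by (simp add: add_nonneg_pos)
  qed (rule *)
qed

section \<open>Short crosscuts by length and area\<close>

lemma energy_lower_bound:
  fixes \<psi> :: "complex \<Rightarrow> complex"
  assumes U: "open U" and hol: "\<psi> holomorphic_on U" and ab: "a \<le> b" "b - a \<le> L" "L > 0"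
    and seg: "\<And>y. y \<in> {a..b} \<Longrightarrow> Complex x y \<in> U"
    and big: "\<eta> > 0" "norm (\<psi> (Complex x b) - \<psi> (Complex x a)) \<ge> \<eta>"
  shows "ennreal (\<eta>\<^sup>2 / L) \<le> (\<integral>\<^sup>+y. ennreal ((norm (deriv \<psi> (Complex x y)))\<^sup>2) * indicator U (Complex x y) \<partial>lborel)"
proof -
  define d where "d = (\<lambda>y. deriv \<psi> (Complex x y))"
  have contC: "continuous_on A (Complex x)" for A
    unfolding Complex_eq by (intro continuous_intros)
  have contd: "continuous_on {a..b} d"
    unfolding d_def
  proof (rule continuous_on_compose2[OF _ contC])
    show "continuous_on U (deriv \<psi>)"
      using hol U by (intro holomorphic_on_imp_continuous_on holomorphic_deriv)
  qed (use seg in auto)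
  have "((\<lambda>y. \<psi> (Complex x y)) has_vector_derivative \<i> * d y) (at y within {a..b})" if "y \<in> {a..b}" for y
  proof -
    have "((\<lambda>y. Complex x y) has_vector_derivative \<i>) (at y within {a..b})"
      unfolding Complex_eq by (auto intro!: derivative_eq_intros)
    moreover have "(\<psi> has_field_derivative d y) (at (Complex x y))"
      unfolding d_def using holomorphic_derivI[OF hol U seg[OF that]] .
    ultimately show ?thesis
      using field_vector_diff_chain_within[of "Complex x" \<i> y "{a..b}" \<psi> "d y"]
      by (simp add: o_def has_field_derivative_at_within)
  qed
  from fundamental_theorem_of_calculus[OF ab(1) this]
  have ftc: "((\<lambda>y. \<i> * d y) has_integral (\<psi> (Complex x b) - \<psi> (Complex x a))) {a..b}" by simp
  define J where "J = integral {a..b} (\<lambda>y. (norm (d y))\<^sup>2)"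
  have J: "((\<lambda>y. (norm (d y))\<^sup>2) has_integral J) {a..b}"
    unfolding J_def by (intro integrable_integral integrable_continuous_interval continuous_intros contd)
  \<comment> \<open>Cauchy-Schwarz in linearized form: \<open>norm (d y)\<close> is at most
    \<open>s / 2 * norm (d y) ^ 2 + 1 / (2 * s)\<close>, and this \<open>s\<close> makes the
    constant term integrate to at most \<open>\<eta> / 2\<close>.\<close>
  define s where "s = L / \<eta>"
  have s: "s > 0" using ab big by (simp add: s_def)
  have bound: "((\<lambda>y. s / 2 * (norm (d y))\<^sup>2 + 1 / (2 * s)) has_integral s / 2 * J + (b - a) * (1 / (2 * s))) {a..b}"
    using has_integral_const_real[of "1 / (2 * s)" a b] ab(1)
    by (intro has_integral_add has_integral_mult_right J) simp
  have "norm (integral {a..b} (\<lambda>y. \<i> * d y)) \<le> integral {a..b} (\<lambda>y. s / 2 * (norm (d y))\<^sup>2 + 1 / (2 * s))"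
  proof (rule integral_norm_bound_integral)
    fix y
    have "0 \<le> (s * norm (d y) - 1)\<^sup>2 / (2 * s)" using s by simp
    also have "\<dots> = s / 2 * (norm (d y))\<^sup>2 + 1 / (2 * s) - norm (d y)"
      using s by (simp add: field_simps power2_eq_square)
    finally show "norm (\<i> * d y) \<le> s / 2 * (norm (d y))\<^sup>2 + 1 / (2 * s)" by (simp add: norm_mult)
  next
    show "(\<lambda>y. \<i> * d y) integrable_on {a..b}" by (rule has_integral_integrable[OF ftc])
    show "(\<lambda>y. s / 2 * (norm (d y))\<^sup>2 + 1 / (2 * s)) integrable_on {a..b}" by (rule has_integral_integrable[OF bound])
  qed
  then have "\<eta> \<le> s / 2 * J + (b - a) * (1 / (2 * s))"
    unfolding integral_unique[OF ftc] integral_unique[OF bound] using big by simp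
  also have "\<dots> \<le> s / 2 * J + L * (1 / (2 * s))"
    using ab s by (intro add_left_mono mult_right_mono) auto
  also have "\<dots> = L * J / (2 * \<eta>) + \<eta> / 2" using ab big by (simp add: s_def)
  finally have "\<eta>\<^sup>2 / L \<le> J" using ab big by (simp add: field_simps power2_eq_square)
  then have "ennreal (\<eta>\<^sup>2 / L) \<le> ennreal J" by (rule ennreal_leI)
  also have "\<dots> = (\<integral>\<^sup>+y. ennreal ((norm (d y))\<^sup>2) * indicator {a..b} y \<partial>lborel)"
    by (rule nn_integral_has_integral_lebesgue'[OF _ J, symmetric]) simp
  also have "\<dots> \<le> (\<integral>\<^sup>+y. ennreal ((norm (d y))\<^sup>2) * indicator U (Complex x y) \<partial>lborel)"
    using seg by (intro nn_integral_mono mult_left_mono) (auto simp: indicator_def)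
  finally show ?thesis unfolding d_def .
qed

lemma norm_one_minus_exp_less_1_iff:
  "norm (1 - exp (Complex x y)) < 1 \<longleftrightarrow> exp x < 2 * cos y"
proof -
  have "(norm (1 - exp (Complex x y)))\<^sup>2 = (1 - exp x * cos y)\<^sup>2 + (exp x * sin y)\<^sup>2"
    unfolding cmod_power2 by (simp add: Re_exp Im_exp)
  also have "\<dots> = 1 - 2 * exp x * cos y + exp x * exp x * ((sin y)\<^sup>2 + (cos y)\<^sup>2)"
    by (simp only: power2_eq_square algebra_simps)
  also have "\<dots> = 1 + exp x * (exp x - 2 * cos y)" by (simp add: algebra_simps)
  finally have "(norm (1 - exp (Complex x y)))\<^sup>2 < 1\<^sup>2 \<longleftrightarrow> exp x * (exp x - 2 * cos y) < 0" by simp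
  moreover have "(norm (1 - exp (Complex x y)))\<^sup>2 < 1\<^sup>2 \<longleftrightarrow> norm (1 - exp (Complex x y)) < 1"
    by (simp add: abs_square_less_1)
  ultimately show ?thesis by (simp add: mult_less_0_iff)
qed

lemma cos_between_ge_min:
  fixes y y1 y2 :: real
  assumes "y1 \<le> y" "y \<le> y2" "\<bar>y1\<bar> < pi / 2" "\<bar>y2\<bar> < pi / 2"
  shows "cos y \<ge> min (cos y1) (cos y2)"
proof -
  define m where "m = (if \<bar>y1\<bar> \<le> \<bar>y2\<bar> then y2 else y1)"
  have "\<bar>y\<bar> \<le> \<bar>m\<bar>" "\<bar>m\<bar> \<le> pi" using assms unfolding m_def by auto
  then have "cos \<bar>m\<bar> \<le> cos \<bar>y\<bar>" by (intro cos_monotone_0_pi_le) auto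
  then show ?thesis by (auto simp: m_def split: if_splits)
qed

text \<open>In the coordinates \<open>w = log (1 - z / \<zeta>)\<close> the circles around the
  boundary point \<open>\<zeta>\<close> become vertical segments of length at most \<open>pi\<close>.\<close>

lemma short_crosscut:
  fixes \<eta> :: real
  assumes "\<eta> > 0"
  shows "\<exists>\<delta>. 0 < \<delta> \<and> \<delta> < 1 \<and> (\<forall>\<phi> \<zeta>. \<phi> holomorphic_on unit_disc \<longrightarrow> inj_on \<phi> unit_disc \<longrightarrow> \<phi> ` unit_disc \<subseteq> unit_disc \<longrightarrow> norm \<zeta> = 1 \<longrightarrow>
      (\<exists>\<rho>. \<delta> < \<rho> \<and> \<rho> < 1 \<and> (\<forall>z\<in>unit_disc \<inter> sphere \<zeta> \<rho>. \<forall>w\<in>unit_disc \<inter> sphere \<zeta> \<rho>. norm (\<phi> z - \<phi> w) < \<eta>)))"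
proof -
  obtain C where C: "C > 0"
    "\<And>\<phi> U. \<lbrakk>open U; \<phi> holomorphic_on U; inj_on \<phi> U; \<phi> ` U \<subseteq> unit_disc\<rbrakk> \<Longrightarrow>
      (\<integral>\<^sup>+x. \<integral>\<^sup>+y. ennreal ((norm (deriv \<phi> (Complex x y)))\<^sup>2) * indicator U (Complex x y) \<partial>lborel \<partial>lborel) \<le> ennreal C"
    using nn_integral_norm_deriv_sq_le by (elim exE conjE) simp
  \<comment> \<open>Chosen so that \<open>\<eta>^2 / pi * M = C + 1\<close>: if every crosscut of
    radius \<open>exp x\<close> with \<open>- M < x < 0\<close> were long, the area would exceed
    \<open>C\<close>. Since \<open>C\<close> is uniform, so is the radius
    \<open>exp (- M)\<close>.\<close>
  define M where "M = (C + 1) * pi / \<eta>\<^sup>2"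
  have M: "M > 0" using C assms by (simp add: M_def)
  show ?thesis
  proof (rule exI[of _ "exp (- M)"], intro conjI allI impI)
    show "0 < exp (- M)" "exp (- M) < 1" using M by auto
    fix \<phi> and \<zeta> :: complex
    assume hol: "\<phi> holomorphic_on unit_disc" and inj: "inj_on \<phi> unit_disc"
      and sub: "\<phi> ` unit_disc \<subseteq> unit_disc" and \<zeta>: "norm \<zeta> = 1"
    show "\<exists>\<rho>. exp (- M) < \<rho> \<and> \<rho> < 1 \<and> (\<forall>z\<in>unit_disc \<inter> sphere \<zeta> \<rho>. \<forall>w\<in>unit_disc \<inter> sphere \<zeta> \<rho>. norm (\<phi> z - \<phi> w) < \<eta>)"
    proof (rule ccontr)
      assume contr: "\<not> ?thesis"
      define e where "e = (\<lambda>w. \<zeta> * (1 - exp w))"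
      \<comment> \<open>The bound on \<open>Im w\<close> keeps one branch of the logarithm and makes
        \<open>e\<close> injective on \<open>U\<close>; no point of the disc is lost, because
        \<open>Re (1 - z / \<zeta>) > 0\<close> there.\<close>
      define U where "U = {w. \<bar>Im w\<bar> < pi / 2 \<and> norm (1 - exp w) < 1}"
      define \<psi> where "\<psi> = (\<lambda>w. \<phi> (e w))"
      have U: "open U" unfolding U_def
        by (intro open_Collect_conj open_Collect_less continuous_intros)
      have eU: "e w \<in> unit_disc" if "w \<in> U" for w
        using that \<zeta> by (simp add: e_def U_def norm_mult)
      have inje: "inj_on e U"
      proof
        fix v w assume vw: "v \<in> U" "w \<in> U" and "e v = e w"
        then have "exp v = exp w" using \<zeta> by (auto simp: e_def)
        moreover have "- pi < Im v" "Im v \<le> pi" "- pi < Im w" "Im w \<le> pi"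
          using vw by (auto simp: U_def)
        ultimately show "v = w" by (metis Ln_exp)
      qed
      have hol\<psi>: "\<psi> holomorphic_on U"
        unfolding \<psi>_def using eU
        by (intro holomorphic_on_compose_gen[OF _ hol, unfolded o_def]) (auto simp: e_def intro!: holomorphic_intros)
      have inj\<psi>: "inj_on \<psi> U"
        using inje inj eU unfolding \<psi>_def inj_on_def by blast
      have sub\<psi>: "\<psi> ` U \<subseteq> unit_disc" using eU sub unfolding \<psi>_def by blast
      define I where "I = (\<lambda>x. \<integral>\<^sup>+y. ennreal ((norm (deriv \<psi> (Complex x y)))\<^sup>2) * indicator U (Complex x y) \<partial>lborel)"
      have coord: "\<exists>y. \<bar>y\<bar> < pi / 2 \<and> z = e (Complex x y)" if z: "z \<in> unit_disc \<inter> sphere \<zeta> (exp x)" for z x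
      proof -
        define v where "v = 1 - z / \<zeta>"
        have zv: "z = \<zeta> * (1 - v)" using \<zeta> by (auto simp: v_def)
        have "norm (\<zeta> - z) = exp x" using z by (simp add: dist_norm)
        moreover have "\<zeta> - z = \<zeta> * v" using zv by (simp add: algebra_simps)
        ultimately have nv: "norm v = exp x" using \<zeta> by (simp add: norm_mult)
        have "norm (1 - v) < 1" using z zv \<zeta> by (simp add: norm_mult)
        then have "Re (1 - v) < 1" by (meson complex_Re_le_cmod le_less_trans)
        then have Rev: "Re v > 0" by simp
        then have vnz: "v \<noteq> 0" by auto
        have "\<bar>Im (Ln v)\<bar> < pi / 2" using Re_Ln_pos_lt[OF vnz] Rev by simp
        moreover have "Complex x (Im (Ln v)) = Ln v"
          using vnz nv by (simp add: complex_eq_iff)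
        ultimately show ?thesis using zv vnz by (intro exI[of _ "Im (Ln v)"]) (simp add: e_def)
      qed
      have lower: "ennreal (\<eta>\<^sup>2 / pi) \<le> I x" if x: "x \<in> {-M<..<0}" for x
      proof -
        from x have "exp (- M) < exp x" "exp x < 1" by auto
        with contr obtain z w where zw: "z \<in> unit_disc \<inter> sphere \<zeta> (exp x)" "w \<in> unit_disc \<inter> sphere \<zeta> (exp x)"
          "norm (\<phi> z - \<phi> w) \<ge> \<eta>" by (meson not_less)
        obtain y1 y2 where y: "\<bar>y1\<bar> < pi / 2" "z = e (Complex x y1)" "\<bar>y2\<bar> < pi / 2" "w = e (Complex x y2)"
          using coord[OF zw(1)] coord[OF zw(2)] by blast
        have U12: "exp x < 2 * cos y1" "exp x < 2 * cos y2"
          using zw(1,2) \<zeta> unfolding y norm_one_minus_exp_less_1_iff[symmetric] by (auto simp: e_def norm_mult)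
        have *: "ennreal (\<eta>\<^sup>2 / pi) \<le> I x"
          if ab: "a \<le> b" "\<bar>a\<bar> < pi / 2" "\<bar>b\<bar> < pi / 2" "exp x < 2 * cos a" "exp x < 2 * cos b"
            "norm (\<psi> (Complex x b) - \<psi> (Complex x a)) \<ge> \<eta>" for a b
          unfolding I_def
        proof (rule energy_lower_bound[OF U hol\<psi> ab(1)])
          show "b - a \<le> pi" using ab by simp
          fix y assume "y \<in> {a..b}"
          then have "cos y \<ge> min (cos a) (cos b)" "\<bar>y\<bar> < pi / 2"
            using ab cos_between_ge_min[of a y b] by auto
          then show "Complex x y \<in> U"
            using ab(4,5) unfolding U_def mem_Collect_eq norm_one_minus_exp_less_1_iff by auto
        qed (use ab assms in auto)
        show ?thesis
        proof (cases "y1 \<le> y2")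
          case True
          then show ?thesis using *[of y1 y2] y U12 zw(3) by (simp add: \<psi>_def norm_minus_commute)
        next
          case False
          then show ?thesis using *[of y2 y1] y U12 zw(3) by (simp add: \<psi>_def)
        qed
      qed
      have "ennreal (C + 1) = ennreal (\<eta>\<^sup>2 / pi) * emeasure lborel {-M<..<0}"
        using M assms by (simp add: M_def flip: ennreal_mult)
      also have "\<dots> = (\<integral>\<^sup>+x. ennreal (\<eta>\<^sup>2 / pi) * indicator {-M<..<0} x \<partial>lborel)"
        by (simp add: nn_integral_cmult_indicator)
      also have "\<dots> \<le> (\<integral>\<^sup>+x. I x \<partial>lborel)"
        using lower by (intro nn_integral_mono) (auto simp: indicator_def)
      also have "\<dots> \<le> ennreal C" unfolding I_def by (rule C(2)[OF U hol\<psi> inj\<psi> sub\<psi>])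
      finally show False using C(1) by simp
    qed
  qed
qed

section \<open>Boundary behaviour\<close>

lemma norm_less_1_open_segment:
  assumes "norm a \<le> 1" "norm b \<le> 1" "x \<in> open_segment a b"
  shows "norm (x :: complex) < 1"
  using dist_decreases_open_segment[OF assms(3), of 0] assms(1,2) by auto

text \<open>For \<open>y = (1 - s) x + s x0\<close> convexity puts the ball of radius
  \<open>s * d\<close> around \<open>y\<close> into \<open>V\<close>, so
  \<open>norm (y - a) \<ge> s * d\<close>; also
  \<open>norm (y - a) \<ge> norm (x - a) - s * R\<close>. Weighting the two by \<open>R\<close> and
  \<open>d\<close> eliminates \<open>s\<close>.\<close>

lemma segment_avoids_boundary_point:
  fixes V :: "complex set"
  assumes "convex V" "ball x0 d \<subseteq> V" "d > 0" "x \<in> V" "a \<notin> V" "norm (x - x0) \<le> R"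
    and y: "y \<in> closed_segment x x0"
  shows "norm (y - a) * (R + d) \<ge> norm (x - a) * d"
proof -
  obtain s where s: "0 \<le> s" "s \<le> 1" "y = (1 - s) *\<^sub>R x + s *\<^sub>R x0"
    using y by (auto simp: in_segment)
  have R: "R \<ge> 0" using assms(6) norm_ge_zero order_trans by blast
  have 1: "norm (y - a) \<ge> s * d"
  proof (rule ccontr)
    assume "\<not> ?thesis"
    then have lt: "norm (a - y) < s * d" by (simp add: norm_minus_commute)
    then have "s > 0" using s assms(3) by (metis less_eq_real_def mult_zero_left norm_not_less_zero)
    \<comment> \<open>The homothety with centre \<open>x\<close> and ratio \<open>s\<close> sends
      \<open>v\<close> to \<open>a\<close> and \<open>x0\<close> to \<open>y\<close>.\<close>
    define v where "v = x0 + (1 / s) *\<^sub>R (a - y)"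
    have nv: "norm (v - x0) = norm (a - y) / s" using \<open>s > 0\<close> unfolding v_def by simp
    have "norm (v - x0) < d" unfolding nv using lt \<open>s > 0\<close> by (simp add: pos_divide_less_eq mult.commute)
    then have "v \<in> V" using assms(2) by (auto simp: dist_norm norm_minus_commute)
    moreover have "a = (1 - s) *\<^sub>R x + s *\<^sub>R v"
      using \<open>s > 0\<close> s(3) by (simp add: v_def algebra_simps)
    ultimately show False
      using assms(1,4,5) s by (simp add: convex_alt)
  qed
  have "y - x = s *\<^sub>R (x0 - x)" using s by (simp add: algebra_simps)
  then have "norm (y - x) \<le> s * R"
    using s assms(6) by (simp add: mult_left_mono norm_minus_commute)
  moreover have "norm (x - a) \<le> norm (y - a) + norm (y - x)"
    by (metis norm_minus_commute norm_triangle_sub add.commute diff_add_cancel norm_triangle_ineq add_diff_eq diff_diff_eq2)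
  ultimately have 2: "norm (x - a) \<le> norm (y - a) + s * R" by simp
  have "norm (x - a) * d \<le> norm (y - a) * d + s * R * d"
    using 2 assms(3) by (metis distrib_right mult_right_mono less_imp_le)
  also have "s * R * d \<le> norm (y - a) * R"
    using 1 R by (metis mult.assoc mult.commute mult_right_mono)
  finally show ?thesis by (simp add: algebra_simps)
qed

text \<open>If the image of a crosscut is short, it lies close to a boundary point, and by the previous
  lemma it cannot separate a far away point from \<open>F 0\<close>; so the image of the small side is small.\<close>

lemma small_side_of_short_crosscut:
  fixes F :: "complex \<Rightarrow> complex"
  assumes contF: "continuous_on unit_disc F" and inj: "inj_on F unit_disc"
    and V: "F ` unit_disc = V" "convex V"
    and d: "d > 0" "ball (F 0) d \<subseteq> V" and R: "\<And>x. x \<in> V \<Longrightarrow> norm (x - F 0) \<le> R"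
    and \<zeta>: "norm \<zeta> = 1" and \<rho>: "0 < \<rho>" "\<rho> < 1" and \<epsilon>: "\<epsilon> > 0"
    and short: "\<And>z w. \<lbrakk>z \<in> unit_disc \<inter> sphere \<zeta> \<rho>; w \<in> unit_disc \<inter> sphere \<zeta> \<rho>\<rbrakk> \<Longrightarrow> norm (F z - F w) * (2 * (R + d)) < \<epsilon> * d"
    and zw: "z \<in> unit_disc \<inter> ball \<zeta> \<rho>" "w \<in> unit_disc \<inter> ball \<zeta> \<rho>"
  shows "norm (F z - F w) < 2 * \<epsilon>"
proof -
  obtain g where g: "homeomorphism unit_disc V F g"
    using invariance_of_domain_homeomorphism[OF open_ball contF _ inj] V by auto
  define T where "T = unit_disc \<inter> sphere \<zeta> \<rho>"
  have "F 0 \<in> V" using V(1) by auto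
  then have Rd: "R + d > 0" using R[of "F 0"] d by simp
  have "T \<noteq> {}"
  proof -
    have "\<zeta> - (1 - \<rho>) *\<^sub>R \<zeta> = \<rho> *\<^sub>R \<zeta>" by (simp add: algebra_simps)
    then have "norm ((1 - \<rho>) *\<^sub>R \<zeta>) < 1" "dist \<zeta> ((1 - \<rho>) *\<^sub>R \<zeta>) = \<rho>"
      using \<zeta> \<rho> by (auto simp: dist_norm)
    then show ?thesis unfolding T_def by (metis IntI emptyE mem_ball_0 mem_sphere)
  qed
  then obtain z1 where z1: "z1 \<in> T" by auto
  \<comment> \<open>Otherwise the crosscut \<open>T\<close> would be closed in the full circle, as
    the trace of the compact set \<open>K\<close> inside the disc. Being also relatively open, it
    would be the whole circle, which leaves the disc at \<open>(1 + \<rho>) \<zeta>\<close>.\<close>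
  have "\<not> closure (F ` T) \<subseteq> V"
  proof
    assume sub: "closure (F ` T) \<subseteq> V"
    have "bounded V" unfolding bounded_iff
      using R by (metis (no_types, opaque_lifting) norm_triangle_sub add.commute order_trans add_left_mono)
    then have "bounded (F ` T)"
      using sub bounded_subset closure_subset by metis
    then have "compact (closure (F ` T))" by (simp add: compact_closure)
    then have cK: "compact (g ` closure (F ` T))"
      using g sub by (meson compact_continuous_image continuous_on_subset homeomorphism_cont2)
    define K where "K = g ` closure (F ` T)"
    have KD: "K \<subseteq> unit_disc" using g sub unfolding K_def by (auto simp: homeomorphism_def)
    have TK: "T \<subseteq> K"
    proof
      fix x assume x: "x \<in> T"
      then have "g (F x) = x" using g by (auto simp: T_def homeomorphism_def)
      then show "x \<in> K" unfolding K_def using x closure_subset by (metis image_eqI subsetD)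
    qed
    have "T = sphere \<zeta> \<rho> \<inter> K" using TK KD unfolding T_def by auto
    then have "closedin (top_of_set (sphere \<zeta> \<rho>)) T"
      using cK closedin_closed_Int compact_imp_closed unfolding K_def by metis
    moreover have "openin (top_of_set (sphere \<zeta> \<rho>)) T"
      unfolding T_def by (metis Int_commute open_ball openin_open_Int)
    moreover have "connected (sphere \<zeta> \<rho>)" by (rule connected_sphere) simp
    ultimately have "T = sphere \<zeta> \<rho>" using \<open>T \<noteq> {}\<close> unfolding connected_clopen by blast
    moreover have "(1 + \<rho>) *\<^sub>R \<zeta> \<in> sphere \<zeta> \<rho>"
      using \<zeta> \<rho> by (simp add: dist_norm algebra_simps)
    ultimately have "(1 + \<rho>) *\<^sub>R \<zeta> \<in> unit_disc" unfolding T_def by blast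
    then show False using \<zeta> \<rho> by simp
  qed
  then obtain a where a: "a \<in> closure (F ` T)" "a \<notin> V" by auto
  have near: "norm (F x - a) * (R + d) < \<epsilon> * d" if x: "x \<in> T" for x
  proof -
    have "\<epsilon> * d / (2 * (R + d)) > 0" using \<epsilon> d Rd by simp
    then obtain b where b: "b \<in> T" "dist (F b) a < \<epsilon> * d / (2 * (R + d))"
      using a(1) unfolding closure_approachable by blast
    then have "norm (F b - a) * (2 * (R + d)) < \<epsilon> * d"
      using Rd by (simp add: dist_norm field_simps)
    moreover have "norm (F x - F b) * (2 * (R + d)) < \<epsilon> * d"
      using short x b unfolding T_def by blast
    moreover have "norm (F x - a) * (2 * (R + d)) \<le> (norm (F x - F b) + norm (F b - a)) * (2 * (R + d))"
      using Rd norm_triangle_ineq[of "F x - F b" "F b - a"] by (intro mult_right_mono) auto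
    ultimately show ?thesis by (simp add: algebra_simps)
  qed
  \<comment> \<open>If \<open>F x\<close> is far from \<open>a\<close>, the whole segment from
    \<open>F x\<close> to \<open>F 0\<close> keeps away from \<open>a\<close>. Its preimage joins
    \<open>x\<close> to 0, which lies outside the ball because \<open>\<rho> < 1\<close>, so it
    crosses the circle around \<open>\<zeta>\<close> at a point whose image is near
    \<open>a\<close>.\<close>
  have close: "norm (F x - a) < \<epsilon>" if x: "x \<in> unit_disc \<inter> ball \<zeta> \<rho>" for x
  proof (rule ccontr)
    assume "\<not> ?thesis"
    then have far: "norm (F x - a) \<ge> \<epsilon>" by simp
    define S where "S = closed_segment (F x) (F 0)"
    have FV: "F x \<in> V" "F 0 \<in> V" using V x by auto
    then have SV: "S \<subseteq> V" unfolding S_def using V(2) by (simp add: closed_segment_subset)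
    have "connected (g ` S)"
      using g SV by (intro connected_continuous_image) (auto simp: S_def homeomorphism_def intro: continuous_on_subset)
    moreover have "g ` S \<inter> ball \<zeta> \<rho> \<noteq> {}"
    proof -
      have "g (F x) = x" using g x by (auto simp: homeomorphism_def)
      then show ?thesis using x unfolding S_def by (metis IntD2 IntI emptyE ends_in_segment(1) imageI)
    qed
    moreover have "g ` S - ball \<zeta> \<rho> \<noteq> {}"
    proof -
      have "g (F 0) = 0" using g by (auto simp: homeomorphism_def)
      moreover have "0 \<notin> ball \<zeta> \<rho>" using \<zeta> \<rho> by (simp add: dist_norm)
      ultimately show ?thesis unfolding S_def by (metis DiffI emptyE ends_in_segment(2) imageI)
    qed
    ultimately have "g ` S \<inter> frontier (ball \<zeta> \<rho>) \<noteq> {}" by (rule connected_Int_frontier)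
    then have "g ` S \<inter> sphere \<zeta> \<rho> \<noteq> {}" by (simp only: frontier_ball[OF \<rho>(1)] not_False_eq_True)
    then obtain y where y: "y \<in> S" "g y \<in> sphere \<zeta> \<rho>" by blast
    then have "g y \<in> T" "F (g y) = y" using g SV unfolding T_def by (auto simp: homeomorphism_def)
    then have "norm (y - a) * (R + d) < \<epsilon> * d" using near by metis
    moreover have "norm (y - a) * (R + d) \<ge> norm (F x - a) * d"
      by (rule segment_avoids_boundary_point[OF V(2) d(2,1) FV(1) a(2) R[OF FV(1)]]) (use y S_def in auto)
    moreover have "norm (F x - a) * d \<ge> \<epsilon> * d" using far d by (intro mult_right_mono) auto
    ultimately show False by linarith
  qed
  have "norm (F z - F w) \<le> norm (F z - a) + norm (F w - a)"
    using norm_triangle_ineq4[of "F z - a" "F w - a"] by simp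
  then show ?thesis using close[OF zw(1)] close[OF zw(2)] by simp
qed

text \<open>The lower bound \<open>\<delta>\<close> on the crosscut radii does not depend on
  \<open>\<zeta>\<close>, so \<open>F\<close> varies little on every cap of radius
  \<open>\<delta>\<close> centred on the circle. The caps take care of an outer annulus,
  Heine-Cantor of the remaining compact disc.\<close>

lemma uniformly_continuous_on_disc_if_short_crosscuts:
  fixes F :: "complex \<Rightarrow> complex"
  assumes contF: "continuous_on unit_disc F" and inj: "inj_on F unit_disc"
    and V: "open V" "F ` unit_disc = V" "convex V" "bounded V"
    and short: "\<And>\<epsilon>. \<epsilon> > 0 \<Longrightarrow> \<exists>\<delta>. 0 < \<delta> \<and> \<delta> < 1 \<and> (\<forall>\<zeta>. norm \<zeta> = 1 \<longrightarrow>
      (\<exists>\<rho>. \<delta> < \<rho> \<and> \<rho> < 1 \<and> (\<forall>z\<in>unit_disc \<inter> sphere \<zeta> \<rho>. \<forall>w\<in>unit_disc \<inter> sphere \<zeta> \<rho>. norm (F z - F w) < \<epsilon>)))"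
  shows "uniformly_continuous_on unit_disc F"
proof -
  have "F 0 \<in> V" using V by auto
  then obtain d where d: "d > 0" "ball (F 0) d \<subseteq> V" using V(1) openE by blast
  obtain R0 where R0: "\<And>x. x \<in> V \<Longrightarrow> norm (x - F 0) \<le> R0"
    using V(4) unfolding bounded_any_center[of _ "F 0"] by (metis dist_norm norm_minus_commute)
  have Rd: "R0 + d > 0" using R0[of "F 0"] \<open>F 0 \<in> V\<close> d by simp
  have small: "\<exists>\<delta>. 0 < \<delta> \<and> \<delta> < 1 \<and> (\<forall>\<zeta> z w. norm \<zeta> = 1 \<longrightarrow> z \<in> unit_disc \<inter> ball \<zeta> \<delta> \<longrightarrow> w \<in> unit_disc \<inter> ball \<zeta> \<delta> \<longrightarrow> norm (F z - F w) < 2 * \<epsilon>)"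
    if \<epsilon>: "\<epsilon> > 0" for \<epsilon>
  proof -
    have "\<epsilon> * d / (2 * (R0 + d)) > 0" using \<epsilon> d Rd by simp
    from short[OF this] obtain \<delta> where \<delta>: "0 < \<delta>" "\<delta> < 1"
      "\<And>\<zeta>. norm \<zeta> = 1 \<Longrightarrow> \<exists>\<rho>. \<delta> < \<rho> \<and> \<rho> < 1 \<and> (\<forall>z\<in>unit_disc \<inter> sphere \<zeta> \<rho>. \<forall>w\<in>unit_disc \<inter> sphere \<zeta> \<rho>. norm (F z - F w) < \<epsilon> * d / (2 * (R0 + d)))"
      by blast
    have "norm (F z - F w) < 2 * \<epsilon>"
      if \<zeta>: "norm \<zeta> = 1" and zw: "z \<in> unit_disc \<inter> ball \<zeta> \<delta>" "w \<in> unit_disc \<inter> ball \<zeta> \<delta>" for \<zeta> z w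
    proof -
      obtain \<rho> where \<rho>: "\<delta> < \<rho>" "\<rho> < 1"
        "\<forall>z\<in>unit_disc \<inter> sphere \<zeta> \<rho>. \<forall>w\<in>unit_disc \<inter> sphere \<zeta> \<rho>. norm (F z - F w) < \<epsilon> * d / (2 * (R0 + d))"
        using \<delta>(3)[OF \<zeta>] by blast
      show ?thesis
      proof (rule small_side_of_short_crosscut[OF contF inj V(2,3) d R0 \<zeta> _ \<rho>(2) \<epsilon>])
        show "norm (F z - F w) * (2 * (R0 + d)) < \<epsilon> * d"
          if "z \<in> unit_disc \<inter> sphere \<zeta> \<rho>" "w \<in> unit_disc \<inter> sphere \<zeta> \<rho>" for z w
          using bspec[OF bspec[OF \<rho>(3) that(1)] that(2)] Rd by (simp add: pos_less_divide_eq)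
      qed (use \<delta> \<rho> zw in auto)
    qed
    then show ?thesis using \<delta>(1,2) by blast
  qed
  show ?thesis
    unfolding uniformly_continuous_on_def
  proof (intro allI impI)
    fix e :: real assume "e > 0"
    then have e2: "e / 2 > 0" by simp
    from small[OF e2] obtain \<delta> where \<delta>: "0 < \<delta>" "\<delta> < 1"
      "\<And>\<zeta> z w. norm \<zeta> = 1 \<Longrightarrow> z \<in> unit_disc \<inter> ball \<zeta> \<delta> \<Longrightarrow> w \<in> unit_disc \<inter> ball \<zeta> \<delta> \<Longrightarrow> norm (F z - F w) < e"
      by fastforce
    have sub: "cball 0 (1 - \<delta> / 2) \<subseteq> unit_disc" using \<delta> by auto
    have "uniformly_continuous_on (cball 0 (1 - \<delta> / 2)) F"
      by (intro compact_uniformly_continuous continuous_on_subset[OF contF sub] compact_cball)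
    then obtain \<delta>' where \<delta>': "\<delta>' > 0"
      "\<And>z w. \<lbrakk>z \<in> cball 0 (1 - \<delta> / 2); w \<in> cball 0 (1 - \<delta> / 2); dist w z < \<delta>'\<rbrakk> \<Longrightarrow> dist (F w) (F z) < e"
      unfolding uniformly_continuous_on_def using \<open>e > 0\<close> by meson
    \<comment> \<open>With \<open>\<zeta>\<close> the radial projection of \<open>z\<close>, the
      distances \<open>\<delta> / 2\<close> from \<open>\<zeta>\<close> to \<open>z\<close> and
      \<open>\<delta> / 4\<close> from \<open>z\<close> to \<open>w\<close> leave both points in the
      cap of radius \<open>\<delta>\<close>.\<close>
    have bdry: "dist (F w) (F z) < e"
      if zw: "z \<in> unit_disc" "w \<in> unit_disc" "dist w z < \<delta> / 4" "norm z > 1 - \<delta> / 2" for z w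
    proof -
      define \<zeta> where "\<zeta> = z / norm z"
      have z0: "norm z > 0" using zw(4) \<delta> by auto
      have \<zeta>: "norm \<zeta> = 1" using z0 by (simp add: \<zeta>_def norm_divide)
      have "\<zeta> - z = of_real (1 - norm z) * \<zeta>" using z0 by (simp add: \<zeta>_def field_simps)
      then have "norm (\<zeta> - z) = 1 - norm z"
        using zw(1) \<zeta> by (simp only: norm_mult norm_of_real) simp
      then have "dist \<zeta> z < \<delta> / 2" using zw(4) by (simp add: dist_norm)
      moreover have "dist \<zeta> w \<le> dist \<zeta> z + dist w z" by (metis dist_commute dist_triangle)
      ultimately show ?thesis
        using \<delta>(3)[OF \<zeta>, of w z] zw \<delta>(1) by (simp add: dist_norm)
    qed
    show "\<exists>d>0. \<forall>x\<in>unit_disc. \<forall>x'\<in>unit_disc. dist x' x < d \<longrightarrow> dist (F x') (F x) < e"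
    proof (intro exI[of _ "min \<delta>' (\<delta> / 4)"] conjI ballI impI)
      show "min \<delta>' (\<delta> / 4) > 0" using \<delta> \<delta>' by auto
      fix x x' assume x: "x \<in> unit_disc" "x' \<in> unit_disc" "dist x' x < min \<delta>' (\<delta> / 4)"
      consider "norm x > 1 - \<delta> / 2" | "norm x' > 1 - \<delta> / 2" | "norm x \<le> 1 - \<delta> / 2" "norm x' \<le> 1 - \<delta> / 2"
        by linarith
      then show "dist (F x') (F x) < e"
      proof cases
        case 1
        then show ?thesis using bdry[of x x'] x by simp
      next
        case 2
        then show ?thesis using bdry[of x' x] x by (simp add: dist_commute)
      next
        case 3
        then show ?thesis using \<delta>'(2)[of x x'] x by simp
      qed
    qed
  qed
qed

text \<open>\<open>F\<close> is a homeomorphism of the disc onto a strictly convex domain that extends continuously to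
  the closed disc; on the disc it is a conformal map \<open>\<phi>\<close> followed by the inverse of \<open>k\<close>.\<close>

locale disc_homeo =
  fixes F \<phi> k :: "complex \<Rightarrow> complex" and V :: "complex set"
  assumes contF: "continuous_on (cball 0 1) F" and injF: "inj_on F unit_disc"
    and imF: "F ` unit_disc = V"
    and convV: "convex V" and bddV: "bounded V"
    and strict: "\<And>a b. \<lbrakk>a \<in> closure V; b \<in> closure V; a \<noteq> b\<rbrakk> \<Longrightarrow> open_segment a b \<subseteq> V"
    and hol: "\<phi> holomorphic_on unit_disc"
    and contk: "continuous_on (closure V) k"
    and kF: "\<And>z. z \<in> unit_disc \<Longrightarrow> k (F z) = \<phi> z"
    and kV: "\<And>a. \<lbrakk>a \<in> closure V; a \<notin> V\<rbrakk> \<Longrightarrow> k a \<notin> \<phi> ` unit_disc"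
begin

section \<open>Boundary values and injectivity on the closed disc\<close>

lemma contF_disc: "continuous_on unit_disc F"
  using contF by (rule continuous_on_subset) auto

lemma openV: "open V"
  using invariance_of_domain[OF contF_disc open_ball injF] imF by simp

lemma homeo: obtains g where "homeomorphism unit_disc V F g"
  using invariance_of_domain_homeomorphism[OF open_ball contF_disc _ injF] imF by auto

lemma image_cball: "F ` cball 0 1 \<subseteq> closure V"
proof -
  have "F ` closure unit_disc \<subseteq> closure (F ` unit_disc)"
    by (rule image_closure_subset) (simp_all add: contF closure_subset)
  then show ?thesis using imF by simp
qed

text \<open>If \<open>F \<zeta> = F w\<close> with \<open>w\<close> inside, the image of a smaller
  disc containing \<open>w\<close> is a neighbourhood of \<open>F \<zeta>\<close>, so it contains
  \<open>F (s \<zeta>)\<close> for \<open>s\<close> near 1, against injectivity.\<close>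

lemma sphere_notin:
  assumes "norm \<zeta> = 1"
  shows "F \<zeta> \<notin> V"
proof
  assume "F \<zeta> \<in> V"
  then obtain w where w: "w \<in> unit_disc" "F \<zeta> = F w" using imF by blast
  define r where "r = (1 + norm w) / 2"
  have r: "norm w < r" "r < 1" using w by (auto simp: r_def)
  then have sub: "ball 0 r \<subseteq> unit_disc" by auto
  have op: "open (F ` ball 0 r)"
    using contF_disc injF sub by (intro invariance_of_domain) (auto intro: continuous_on_subset inj_on_subset)
  have "F \<zeta> \<in> F ` ball 0 r" using w r by auto
  moreover have "(F \<longlongrightarrow> F \<zeta>) (at \<zeta> within cball 0 1)"
    using contF assms by (simp add: continuous_on_def)
  ultimately have "\<forall>\<^sub>F z in at \<zeta> within cball 0 1. F z \<in> F ` ball 0 r"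
    using op topological_tendstoD by blast
  then obtain d where d: "d > 0" "\<And>z. z \<in> cball 0 1 \<Longrightarrow> z \<noteq> \<zeta> \<Longrightarrow> dist z \<zeta> < d \<Longrightarrow> F z \<in> F ` ball 0 r"
    unfolding eventually_at by blast
  define s where "s = max r (1 - d / 2)"
  have s: "0 \<le> s" "s < 1" "r \<le> s" "1 - s < d" using r d(1) norm_ge_zero[of w] unfolding s_def by linarith+
  have ns: "norm (s *\<^sub>R \<zeta>) = s" using s assms by simp
  have "s *\<^sub>R \<zeta> - \<zeta> = (s - 1) *\<^sub>R \<zeta>" by (simp add: algebra_simps)
  then have "dist (s *\<^sub>R \<zeta>) \<zeta> = 1 - s" using s assms by (simp add: dist_norm)
  then have "F (s *\<^sub>R \<zeta>) \<in> F ` ball 0 r"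
    using d(2)[of "s *\<^sub>R \<zeta>"] s ns assms by (metis dist_self diff_gt_0_iff_gt less_irrefl less_imp_le mem_cball_0)
  then have "s *\<^sub>R \<zeta> \<in> ball 0 r"
    using inj_on_image_mem_iff[OF injF _ sub] ns s(2) by auto
  then show False using s(3) by (simp only: mem_ball_0 ns)
qed

text \<open>\<open>F\<close> need not be holomorphic, but \<open>k o F\<close> extends the
  holomorphic \<open>\<phi>\<close> to the circle. Finitely many rotations of the arc cover the
  circle, so the product of the rotated functions \<open>k (F (cis t * z)) - b\<close> vanishes
  there and, by the maximum modulus principle, at 0, where all factors agree. Thus
  \<open>\<phi> 0 = b\<close>, which \<open>kV\<close> excludes.\<close>

lemma no_constant_arc:
  assumes W: "open W" "\<zeta>0 \<in> W" "norm \<zeta>0 = 1"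
    and const: "\<And>\<zeta>. \<lbrakk>\<zeta> \<in> W; norm \<zeta> = 1\<rbrakk> \<Longrightarrow> F \<zeta> = a"
  shows False
proof -
  define T where "T = (\<lambda>t. (\<lambda>z. cis t * z) -` W)"
  have "sphere 0 1 \<subseteq> (\<Union>t. T t)"
  proof
    fix \<zeta> :: complex assume "\<zeta> \<in> sphere 0 1"
    then have "cis (Arg (\<zeta>0 / \<zeta>)) * \<zeta> = \<zeta>0"
      using W(3) by (subst cis_Arg) (auto simp: sgn_div_norm norm_divide)
    then show "\<zeta> \<in> (\<Union>t. T t)" using W(2) by (auto simp: T_def intro!: exI[of _ "Arg (\<zeta>0 / \<zeta>)"])
  qed
  moreover have "open (T t)" for t
    unfolding T_def by (rule open_vimage[OF W(1)]) (intro continuous_intros)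
  ultimately obtain C where C: "finite C" "sphere 0 1 \<subseteq> (\<Union>t\<in>C. T t)"
    using compactE_image[OF compact_sphere, of UNIV T 0 1] by auto
  define b where "b = k a"
  have a: "a = F \<zeta>0" using const[OF W(2,3)] by simp
  then have "a \<in> closure V" "a \<notin> V" using image_cball W(3) sphere_notin by auto
  then have b: "b \<notin> \<phi> ` unit_disc" using kV by (simp add: b_def)
  define P where "P = (\<lambda>z. \<Prod>t\<in>C. k (F (cis t * z)) - b)"
  have "norm (P 0) \<le> 0"
  proof (rule maximum_modulus_frontier[of P unit_disc])
    have "(\<lambda>z. \<Prod>t\<in>C. \<phi> (cis t * z) - b) holomorphic_on unit_disc"
      by (intro holomorphic_intros holomorphic_on_compose_gen[OF _ hol, unfolded o_def]) (auto simp: norm_mult)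
    then show "P holomorphic_on interior unit_disc"
      by (rule holomorphic_transform[THEN holomorphic_on_subset]) (auto simp: P_def norm_mult kF)
    have "continuous_on (cball 0 1) (\<lambda>z. k (F (cis t * z)))" for t
    proof -
      have "continuous_on (cball 0 1) (\<lambda>z. F (cis t * z))"
        by (rule continuous_on_compose2[OF contF]) (auto intro!: continuous_intros simp: norm_mult)
      then show ?thesis
        by (rule continuous_on_compose2[OF contk]) (use image_cball in \<open>force simp: norm_mult\<close>)
    qed
    then have "continuous_on (cball 0 1) P"
      unfolding P_def by (intro continuous_intros)
    then show "continuous_on (closure unit_disc) P" by simp
    fix z assume "z \<in> frontier unit_disc"
    then have z: "norm z = 1" by simp
    then obtain t where t: "t \<in> C" "cis t * z \<in> W" using C(2) by (auto simp: T_def)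
    have "F (cis t * z) = a" using const[OF t(2)] z by (simp add: norm_mult)
    then have "P z = 0" unfolding P_def b_def using C(1) t(1) by (auto simp: prod_zero_iff)
    then show "norm (P z) \<le> 0" by simp
  qed auto
  then have "P 0 = 0" by simp
  then have "k (F 0) = b" using C(1) unfolding P_def by (auto simp: prod_zero_iff)
  then show False using kF[of 0] b by auto
qed

text \<open>If the ends of a chord had the same image \<open>a\<close>, the image of the chord would
  be a Jordan curve \<open>J\<close>, inside \<open>V\<close> except for \<open>a\<close>. One side
  of the chord in the disc then maps into the inside of \<open>J\<close>, so the arc bounding that
  side has its images in \<open>V\<close> or at \<open>a\<close>. Points of the circle avoid
  \<open>V\<close>, so the arc collapses to \<open>a\<close>.\<close>

lemma chord_endpoints_neq:
  assumes \<zeta>: "norm \<zeta>1 = 1" "norm \<zeta>2 = 1" "\<zeta>1 \<noteq> \<zeta>2"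
  shows "F \<zeta>1 \<noteq> F \<zeta>2"
proof
  assume eq: "F \<zeta>1 = F \<zeta>2"
  define a where "a = F \<zeta>1"
  have a: "a \<in> closure V" "a \<notin> V" using image_cball \<zeta> sphere_notin by (auto simp: a_def)
  obtain g where g: "homeomorphism unit_disc V F g" by (rule homeo)
  define L where "L = (\<lambda>z. Im ((z - \<zeta>1) * cnj (\<zeta>2 - \<zeta>1)))"
  define c where "c = F \<circ> linepath \<zeta>1 \<zeta>2"
  define J where "J = path_image c"
  have seg: "linepath \<zeta>1 \<zeta>2 t \<in> unit_disc" if "0 < t" "t < 1" for t
  proof -
    have "linepath \<zeta>1 \<zeta>2 t \<in> open_segment \<zeta>1 \<zeta>2"
      using that \<zeta>(3) unfolding in_segment linepath_def by blast
    then show ?thesis using norm_less_1_open_segment[of \<zeta>1 \<zeta>2] \<zeta> by simp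
  qed
  have cin: "c t \<in> V" if "0 < t" "t < 1" for t
    using seg[OF that] imF by (auto simp: c_def)
  have c01: "c 0 = a" "c 1 = a" using eq by (auto simp: c_def a_def linepath_def)
  have "closed_segment \<zeta>1 \<zeta>2 \<subseteq> cball 0 1"
    by (rule closed_segment_subset) (use \<zeta> in auto)
  then have "path c" unfolding c_def
    using contF by (intro path_continuous_image) (auto intro: continuous_on_subset)
  have "simple_path c"
    unfolding simple_path_def loop_free_def
  proof (intro conjI ballI impI)
    fix x y :: real assume xy: "x \<in> {0..1}" "y \<in> {0..1}" "c x = c y"
    show "x = y \<or> x = 0 \<and> y = 1 \<or> x = 1 \<and> y = 0"
    proof (cases "0 < x \<and> x < 1")
      case True
      then have "c y \<in> V" using cin xy(3) by metis
      then have y: "0 < y" "y < 1" using xy(2) a(2) c01 by (metis atLeastAtMost_iff less_eq_real_def)+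
      have "linepath \<zeta>1 \<zeta>2 x = linepath \<zeta>1 \<zeta>2 y"
        using injF seg y True xy(3) unfolding c_def inj_on_def by auto
      then have "(x - y) *\<^sub>R (\<zeta>2 - \<zeta>1) = 0" by (simp add: linepath_def algebra_simps)
      then show ?thesis using \<zeta>(3) by simp
    next
      case False
      then have x: "x = 0 \<or> x = 1" using xy(1) by auto
      then have "c y \<notin> V" using xy(3) a(2) c01 by metis
      then have "y = 0 \<or> y = 1" using cin[of y] xy(2) by fastforce
      then show ?thesis using x by auto
    qed
  qed (rule \<open>path c\<close>)
  moreover have "pathfinish c = pathstart c" using c01 by (simp add: pathfinish_def pathstart_def)
  ultimately have ins: "inside J \<noteq> {}" "open (inside J)" "connected (inside J)" "frontier (inside J) = J"
    unfolding J_def using Jordan_inside_outside by blast+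
  have Jsub: "J \<subseteq> insert a V"
  proof
    fix y assume "y \<in> J"
    then obtain t where t: "0 \<le> t" "t \<le> 1" "y = c t" unfolding J_def path_image_def by auto
    then show "y \<in> insert a V" using cin[of t] c01 by (metis insert_iff less_eq_real_def)
  qed
  have disj: "inside J \<inter> J = {}" by (simp add: inside_no_overlap)
  \<comment> \<open>\<open>J\<close> lies in the convex set \<open>closure V\<close>, so the
    complement of \<open>closure V\<close> is outside \<open>J\<close>; the open set
    \<open>inside J\<close> is thus in the interior of \<open>closure V\<close>, which is
    \<open>V\<close>.\<close>
  have insV: "inside J \<subseteq> V"
  proof -
    have "J \<subseteq> closure V" using Jsub a closure_subset by blast
    then have "- closure V \<subseteq> outside J" by (intro outside_subset_convex convex_closure convV)
    then have "inside J \<subseteq> closure V" using inside_Int_outside[of J] by blast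
    then have "inside J \<subseteq> interior (closure V)" using ins(2) interior_maximal by blast
    then show ?thesis using convex_interior_closure[OF convV] openV by (simp add: interior_open)
  qed
  have chord: "F z \<in> J" if z: "z \<in> unit_disc" "L z = 0" for z
  proof -
    define s where "s = Re ((z - \<zeta>1) * cnj (\<zeta>2 - \<zeta>1)) / (norm (\<zeta>2 - \<zeta>1))\<^sup>2"
    have n0: "norm (\<zeta>2 - \<zeta>1) > 0" using \<zeta>(3) by simp
    have "(z - \<zeta>1) * cnj (\<zeta>2 - \<zeta>1) = of_real (s * (norm (\<zeta>2 - \<zeta>1))\<^sup>2)"
      using z(2) n0 by (simp add: complex_eq_iff L_def s_def)
    also have "\<dots> = of_real s * ((\<zeta>2 - \<zeta>1) * cnj (\<zeta>2 - \<zeta>1))"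
      by (simp only: of_real_mult complex_norm_square)
    finally have "z - \<zeta>1 = of_real s * (\<zeta>2 - \<zeta>1)" using \<zeta>(3) by (simp add: mult.assoc[symmetric])
    then have zs: "z = (1 - s) *\<^sub>R \<zeta>1 + s *\<^sub>R \<zeta>2" by (simp add: scaleR_conv_of_real algebra_simps)
    have "s > 0"
    proof (rule ccontr)
      assume "\<not> s > 0"
      then have s: "s \<le> 0" by simp
      have "\<zeta>1 = (1 - (- s / (1 - s))) *\<^sub>R z + (- s / (1 - s)) *\<^sub>R \<zeta>2"
        using s by (simp add: zs scaleR_conv_of_real divide_simps)
      moreover have "z \<noteq> \<zeta>2" using z(1) \<zeta> by auto
      ultimately have "\<zeta>1 = z \<or> \<zeta>1 \<in> open_segment z \<zeta>2"
        using s unfolding in_segment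
        by (cases "s = 0") (auto intro!: exI[of _ "- s / (1 - s)"] simp: zs divide_simps)
      then show False using norm_less_1_open_segment[of z \<zeta>2 \<zeta>1] z(1) \<zeta> by auto
    qed
    moreover have "s < 1"
    proof (rule ccontr)
      assume "\<not> s < 1"
      then have s: "s \<ge> 1" by simp
      have "\<zeta>2 = (1 - 1 / s) *\<^sub>R \<zeta>1 + (1 / s) *\<^sub>R z"
        using s by (simp add: zs scaleR_conv_of_real divide_simps) (simp add: algebra_simps)
      moreover have "z \<noteq> \<zeta>1" using z(1) \<zeta> by auto
      ultimately have "\<zeta>2 = z \<or> \<zeta>2 \<in> open_segment \<zeta>1 z"
        using s unfolding in_segment
        by (cases "s = 1") (auto intro!: exI[of _ "1 / s"] simp: zs)
      then show False using norm_less_1_open_segment[of \<zeta>1 z \<zeta>2] z(1) \<zeta> by auto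
    qed
    ultimately show ?thesis
      unfolding J_def path_image_def c_def zs by (auto simp: linepath_def intro!: image_eqI[of _ _ s])
  qed
  have side: False if \<sigma>: "\<sigma> = 1 \<or> \<sigma> = (-1::real)" and T: "z0 \<in> g ` inside J" "\<sigma> * L z0 > 0" for \<sigma> z0
  proof -
    define S where "S = {z. \<sigma> * L z > 0} \<inter> unit_disc"
    have contL: "continuous_on A L" for A unfolding L_def by (intro continuous_intros)
    have opS: "open {z. \<sigma> * L z > 0}" by (intro open_Collect_less continuous_intros contL)
    have "convex {z. \<sigma> * L z > 0}"
    proof (rule convexI)
      fix x y u v assume *: "x \<in> {z. \<sigma> * L z > 0}" "y \<in> {z. \<sigma> * L z > 0}" and uv: "0 \<le> u" "0 \<le> v" "u + v = (1::real)"
      have "L (u *\<^sub>R x + v *\<^sub>R y) = u * L x + v * L y"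
      proof -
        have eq: "u *\<^sub>R x + v *\<^sub>R y - \<zeta>1 = u *\<^sub>R (x - \<zeta>1) + v *\<^sub>R (y - \<zeta>1)"
          using uv(3) by (simp add: algebra_simps flip: scaleR_add_left)
        show ?thesis unfolding L_def eq
          by (simp only: distrib_right mult_scaleR_left plus_complex.sel scaleR_complex.sel)
      qed
      then have "\<sigma> * L (u *\<^sub>R x + v *\<^sub>R y) = u * (\<sigma> * L x) + v * (\<sigma> * L y)" by (simp add: algebra_simps)
      moreover have "u * (\<sigma> * L x) + v * (\<sigma> * L y) > 0"
      proof (cases "u = 0")
        case False
        then have "0 < u" "0 < \<sigma> * L x" "0 \<le> \<sigma> * L y" using * uv by auto
        then have "u * (\<sigma> * L x) > 0" "v * (\<sigma> * L y) \<ge> 0"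
          using mult_pos_pos[of u "\<sigma> * L x"] mult_nonneg_nonneg[of v "\<sigma> * L y"] uv(2) by blast+
        then show ?thesis by linarith
      qed (use * uv in auto)
      ultimately show "u *\<^sub>R x + v *\<^sub>R y \<in> {z. \<sigma> * L z > 0}" by simp
    qed
    then have convS: "convex S" unfolding S_def by (intro convex_Int convex_ball)
    have "connected (F ` S)"
      by (intro connected_continuous_image continuous_on_subset[OF contF_disc] convex_connected[OF convS])
        (auto simp: S_def)
    moreover have "F ` S \<inter> frontier (inside J) = {}"
    proof -
      have False if z: "z \<in> S" "F z \<in> J" for z
      proof -
        obtain t where t: "0 \<le> t" "t \<le> 1" "F z = c t" using z(2) unfolding J_def path_image_def by auto
        have "F z \<in> V" using z(1) imF by (auto simp: S_def)
        then have "0 < t" "t < 1" using t a(2) c01 by (metis less_eq_real_def)+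
        then have "z = linepath \<zeta>1 \<zeta>2 t"
          using injF seg z(1) t(3) unfolding c_def S_def inj_on_def by auto
        then have eq: "z - \<zeta>1 = t *\<^sub>R (\<zeta>2 - \<zeta>1)" by (simp add: linepath_def algebra_simps)
        have "L z = 0" unfolding L_def eq by (simp add: algebra_simps)
        then show False using z(1) by (simp add: S_def)
      qed
      then show ?thesis using ins(4) by blast
    qed
    moreover have "F ` S \<inter> inside J \<noteq> {}"
    proof -
      obtain y where y: "y \<in> inside J" "z0 = g y" using T(1) by blast
      then have "z0 \<in> unit_disc" "F z0 = y" using g insV by (auto simp: homeomorphism_def)
      moreover from this have "z0 \<in> S" using T(2) by (simp add: S_def)
      ultimately show ?thesis using y by blast
    qed
    ultimately have FS: "F ` S \<subseteq> inside J" using connected_Int_frontier by blast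
    have const: "F \<zeta> = a" if "\<zeta> \<in> {z. \<sigma> * L z > 0}" "norm \<zeta> = 1" for \<zeta>
    proof -
      have "\<zeta> \<in> {z. \<sigma> * L z > 0} \<inter> closure unit_disc" using that by simp
      then have "\<zeta> \<in> closure S" unfolding S_def using open_Int_closure_subset[OF opS] by blast
      moreover have "F ` closure S \<subseteq> closure (inside J)"
      proof (rule image_closure_subset)
        have "closure S \<subseteq> cball 0 1" unfolding S_def
          by (rule closure_minimal) auto
        then show "continuous_on (closure S) F" using contF continuous_on_subset by blast
        show "F ` S \<subseteq> closure (inside J)" using FS closure_subset by blast
      qed auto
      ultimately have "F \<zeta> \<in> inside J \<union> J"
        using closure_Un_frontier[of "inside J"] ins(4) by blast
      then show ?thesis using sphere_notin[OF that(2)] insV Jsub by blast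
    qed
    \<comment> \<open>\<open>\<zeta>0\<close> is the unit normal of the chord pointing to side
      \<open>\<sigma>\<close>, the middle of the arc on that side. It lies strictly on that side
      because \<open>Re q = - norm d ^ 2 / 2\<close> is nonzero.\<close>
    define w where "w = \<i> * (\<zeta>2 - \<zeta>1) * of_real \<sigma>"
    define \<zeta>0 where "\<zeta>0 = w / norm w"
    have nz: "\<zeta>2 - \<zeta>1 \<noteq> 0" using \<zeta>(3) by simp
    then have w0: "w \<noteq> 0" using \<sigma> by (auto simp: w_def)
    have n0: "norm \<zeta>0 = 1" using w0 by (simp add: \<zeta>0_def norm_divide)
    have "\<sigma> * L \<zeta>0 > 0"
    proof -
      define d where "d = \<zeta>2 - \<zeta>1"
      define q where "q = \<zeta>1 * cnj d"
      have nd: "norm d > 0" using nz by (simp add: d_def)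
      have "norm q = norm d" using \<zeta> by (simp add: q_def norm_mult)
      have "(norm \<zeta>2)\<^sup>2 = (norm \<zeta>1)\<^sup>2 + 2 * Re q + (norm d)\<^sup>2"
        unfolding cmod_power2 by (simp add: q_def d_def power2_eq_square algebra_simps)
      then have "Re q = - (norm d)\<^sup>2 / 2" using \<zeta> by simp
      then have "Re q \<noteq> 0" using nd by simp
      then have "(Im q)\<^sup>2 < (norm q)\<^sup>2" by (simp add: cmod_power2)
      then have Imq: "\<bar>Im q\<bar> < norm d"
        unfolding \<open>norm q = norm d\<close> by (metis abs_ge_zero abs_norm_cancel power2_abs power_less_imp_less_base norm_ge_zero)
      have eq: "\<zeta>0 * cnj d = of_real (\<sigma> * norm d) * \<i>"
      proof -
        have nw: "norm w = norm d" using \<sigma> by (auto simp: w_def d_def norm_mult)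
        have "\<zeta>0 * cnj d = \<i> * of_real \<sigma> * (d * cnj d) / norm d"
          by (simp add: \<zeta>0_def nw) (simp add: w_def d_def)
        also have "d * cnj d = of_real (norm d) * of_real (norm d)"
          by (simp only: complex_norm_square[symmetric] power2_eq_square of_real_mult)
        finally show ?thesis using nd by simp
      qed
      have "L \<zeta>0 = Im (\<zeta>0 * cnj d - q)"
        by (simp only: L_def q_def d_def left_diff_distrib)
      then have "L \<zeta>0 = \<sigma> * norm d - Im q"
        unfolding eq by simp
      then show ?thesis using \<sigma> Imq by auto
    qed
    then show False
      by (intro no_constant_arc[OF opS _ n0 const]) auto
  qed
  obtain y where y: "y \<in> inside J" using ins(1) by blast
  have "g y \<in> unit_disc" "F (g y) = y" using g insV y by (auto simp: homeomorphism_def)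
  then have "L (g y) \<noteq> 0" using chord[of "g y"] y disj by (metis IntI emptyE)
  then have "1 * L (g y) > 0 \<or> -1 * L (g y) > 0" by linarith
  then show False using side[of 1 "g y"] side[of "-1" "g y"] y by blast
qed

end

section \<open>Monotonicity along hyperbolic translations\<close>

lemma collinear_middle_open_segment:
  fixes x y z :: complex
  assumes "Im x < Im y" "Im y < Im z" "Re x = Re y" "Re y = Re z"
  shows "y \<in> open_segment x z"
proof -
  define t where "t = (Im y - Im x) / (Im z - Im x)"
  have t: "0 < t" "t < 1" using assms by (auto simp: t_def)
  have "t * (Im z - Im x) = Im y - Im x"
    using assms by (simp add: t_def)
  then have "Im y = (1 - t) * Im x + t * Im z" by (simp add: algebra_simps)
  then have "y = (1 - t) *\<^sub>R x + t *\<^sub>R z"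
    using assms by (simp add: complex_eq_iff algebra_simps)
  then show ?thesis using t assms unfolding in_segment by auto
qed

context disc_homeo
begin

lemma F_inj_cball:
  assumes "z \<in> cball 0 1" "w \<in> cball 0 1" "norm z = 1" "F z = F w"
  shows "z = w"
proof (cases "norm w = 1")
  case True
  then show ?thesis using chord_endpoints_neq[of z w] assms by blast
next
  case False
  then have "F w \<in> V" using assms imF by auto
  then show ?thesis using sphere_notin[OF assms(3)] assms(4) by simp
qed

section \<open>Peaks of linear functionals of the boundary map\<close>

definition u :: "real \<Rightarrow> complex \<Rightarrow> real" where "u \<alpha> z = Re (cis \<alpha> * F z)"

lemma u_plus_pi: "u (\<alpha> + pi) z = - u \<alpha> z"
  by (simp add: u_def flip: cis_mult)

lemma cont_u: "continuous_on (cball 0 1) (u \<alpha>)"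
  unfolding u_def by (intro continuous_intros contF)

lemma u_exceeded_in_disc:
  assumes "z \<in> unit_disc"
  shows "\<exists>w\<in>unit_disc. u \<alpha> w > u \<alpha> z"
proof -
  have "F z \<in> V" using assms imF by blast
  then obtain e where e: "e > 0" "ball (F z) e \<subseteq> V" using openV openE by blast
  define v where "v = F z + of_real (e / 2) * cis (- \<alpha>)"
  have "norm (v - F z) = e / 2" using e by (simp add: v_def norm_mult)
  then have "v \<in> V" using e by (auto simp: dist_norm norm_minus_commute)
  then obtain w where w: "w \<in> unit_disc" "F w = v" using imF by blast
  have "cis \<alpha> * v = cis \<alpha> * F z + of_real (e / 2) * (cis \<alpha> * cis (- \<alpha>))"
    by (simp add: v_def algebra_simps)
  also have "cis \<alpha> * cis (- \<alpha>) = 1" by (simp add: cis_mult)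
  finally have "u \<alpha> w = u \<alpha> z + e / 2" using w by (simp add: u_def)
  then show ?thesis using w(1) e(1) by (intro bexI[of _ w]) auto
qed

text \<open>Since \<open>V\<close> is open, no maximum of \<open>u\<close> is attained in the disc.
  Two maximizers would have distinct images, whose midpoint lies in \<open>V\<close> by strict
  convexity and would be the image of an interior maximizer.\<close>

lemma exists_peak:
  "\<exists>p. norm p = 1 \<and> (\<forall>z\<in>cball 0 1. z \<noteq> p \<longrightarrow> u \<alpha> z < u \<alpha> p)"
proof -
  obtain p where p: "p \<in> cball 0 1" "\<And>z. z \<in> cball 0 1 \<Longrightarrow> u \<alpha> z \<le> u \<alpha> p"
    using continuous_attains_sup[OF compact_cball _ cont_u[of \<alpha>]] by auto
  have no: "u \<alpha> z < u \<alpha> p" if z: "z \<in> unit_disc" for z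
  proof -
    obtain w where "w \<in> unit_disc" "u \<alpha> w > u \<alpha> z" using u_exceeded_in_disc[OF z] by blast
    then show ?thesis using p(2)[of w] by simp
  qed
  then have np: "norm p = 1" using p(1) by (metis less_irrefl mem_ball_0 mem_cball_0 less_eq_real_def)
  have "u \<alpha> z < u \<alpha> p" if z: "z \<in> cball 0 1" "z \<noteq> p" for z
  proof (rule ccontr)
    assume "\<not> ?thesis"
    then have eq: "u \<alpha> z = u \<alpha> p" using p(2)[OF z(1)] by simp
    have "F z \<noteq> F p" using F_inj_cball[OF p(1) z(1) np] z(2) by auto
    then have "open_segment (F z) (F p) \<subseteq> V"
      using image_cball z(1) p(1) by (intro strict) auto
    moreover have "midpoint (F z) (F p) \<in> open_segment (F z) (F p)" using \<open>F z \<noteq> F p\<close> by simp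
    ultimately have "midpoint (F z) (F p) \<in> F ` unit_disc" unfolding imF by (rule subsetD)
    then obtain w where w: "w \<in> unit_disc" "F w = midpoint (F z) (F p)" by (metis imageE)
    have "2 * u \<alpha> w = u \<alpha> z + u \<alpha> p"
      unfolding u_def w(2) midpoint_def by (simp add: algebra_simps)
    then show False using no[OF w(1)] eq by simp
  qed
  then show ?thesis using np by blast
qed

definition peak :: "real \<Rightarrow> complex" where
  "peak \<alpha> = (SOME p. norm p = 1 \<and> (\<forall>z\<in>cball 0 1. z \<noteq> p \<longrightarrow> u \<alpha> z < u \<alpha> p))"

lemma norm_peak [simp]: "norm (peak \<alpha>) = 1"
  and u_less_peak: "\<lbrakk>norm z \<le> 1; z \<noteq> peak \<alpha>\<rbrakk> \<Longrightarrow> u \<alpha> z < u \<alpha> (peak \<alpha>)"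
  using someI_ex[OF exists_peak[of \<alpha>]] unfolding peak_def[symmetric] by auto

lemma peak_eqI:
  assumes "norm q = 1" "\<And>z. norm z = 1 \<Longrightarrow> u \<alpha> z \<le> u \<alpha> q"
  shows "peak \<alpha> = q"
proof (rule ccontr)
  assume "peak \<alpha> \<noteq> q"
  then have "u \<alpha> q < u \<alpha> (peak \<alpha>)" using u_less_peak assms(1) by simp
  then show False using assms(2)[of "peak \<alpha>"] by simp
qed

text \<open>A map into a compact set is continuous if its graph is closed, and by uniqueness of the
  peak the graph is cut out by the closed conditions
  \<open>u \<alpha> z \<le> u \<alpha> q\<close>.\<close>

lemma continuous_peak: "continuous_on UNIV peak"
proof (rule continuous_from_closed_graph)
  show "compact (sphere 0 1 :: complex set)" by simp
  show "peak \<in> UNIV \<rightarrow> sphere 0 1" by simp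
  have "(\<lambda>x. (x, peak x)) ` UNIV = (\<Inter>z\<in>sphere 0 1. (UNIV \<times> sphere 0 1) \<inter> (\<lambda>(\<alpha>, q). u \<alpha> q - u \<alpha> z) -` {0..})"
    (is "?G = ?R")
  proof
    have "u \<alpha> z \<le> u \<alpha> (peak \<alpha>)" if "norm z = 1" for \<alpha> z
      using u_less_peak[of z \<alpha>] that by (cases "z = peak \<alpha>") auto
    then show "?G \<subseteq> ?R" by auto
    show "?R \<subseteq> ?G"
    proof
      fix y assume y: "y \<in> ?R"
      obtain \<alpha> q where yq: "y = (\<alpha>, q)" by (cases y)
      have *: "\<forall>z\<in>sphere 0 1. norm q = 1 \<and> u \<alpha> z \<le> u \<alpha> q" using y unfolding yq by auto
      then have "norm q = 1" using norm_peak by (metis mem_sphere_0)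
      then have "peak \<alpha> = q" using * by (intro peak_eqI) auto
      then show "y \<in> ?G" using yq by auto
    qed
  qed
  moreover have "closed \<dots>"
  proof (intro closed_INT ballI continuous_closed_preimage)
    fix z :: complex assume "z \<in> sphere 0 1"
    have "continuous_on (UNIV \<times> sphere 0 1) (\<lambda>x. F (snd x))"
      by (rule continuous_on_compose2[OF contF]) (auto intro!: continuous_intros)
    then show "continuous_on (UNIV \<times> sphere 0 1) (\<lambda>(\<alpha>, q). u \<alpha> q - u \<alpha> z)"
      unfolding u_def case_prod_beta cis.ctr Complex_eq by (intro continuous_intros)
  qed (auto intro: closed_Times)
  ultimately show "closed ((\<lambda>x. (x, peak x)) ` UNIV)" by simp
qed

lemma peak_plus_pi_neq: "peak (\<alpha> + pi) \<noteq> peak \<alpha>"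
proof
  assume eq: "peak (\<alpha> + pi) = peak \<alpha>"
  have "peak \<alpha> \<noteq> 0" using norm_peak[of \<alpha>] by (metis norm_zero zero_neq_one)
  then have "u \<alpha> 0 < u \<alpha> (peak \<alpha>)" "u (\<alpha> + pi) 0 < u (\<alpha> + pi) (peak \<alpha>)"
    using u_less_peak[of 0 \<alpha>] u_less_peak[of 0 "\<alpha> + pi"] eq by auto
  then show False by (simp add: u_plus_pi)
qed

lemma peak_plus_2pi: "peak (\<alpha> + pi + pi) = peak \<alpha>"
proof (rule peak_eqI)
  fix z :: complex assume "norm z = 1"
  then have "u \<alpha> z \<le> u \<alpha> (peak \<alpha>)" using u_less_peak[of z \<alpha>] by (cases "z = peak \<alpha>") auto
  then show "u (\<alpha> + pi + pi) z \<le> u (\<alpha> + pi + pi) (peak \<alpha>)" by (simp only: u_plus_pi minus_minus)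
qed simp

text \<open>\<open>d \<alpha> = 1\<close> is the goal, and \<open>d \<alpha> = -1\<close> would mean
  coinciding peaks, so the principal argument \<open>\<theta>\<close> of \<open>d\<close> is
  continuous. Advancing \<open>\<alpha>\<close> by \<open>pi\<close> exchanges the two peaks and
  inverts \<open>d\<close>, hence \<open>\<theta> pi = - \<theta> 0\<close>.\<close>

lemma exists_antipodal_peaks: "\<exists>\<alpha>. peak (\<alpha> + pi) = - peak \<alpha>"
proof -
  define d where "d = (\<lambda>\<alpha>. - (peak (\<alpha> + pi) / peak \<alpha>))"
  have nz: "peak \<alpha> \<noteq> 0" for \<alpha> using norm_peak[of \<alpha>] by (metis norm_zero zero_neq_one)
  have nd: "norm (d \<alpha>) = 1" for \<alpha> by (simp add: d_def norm_divide)
  have slit: "d \<alpha> \<notin> \<real>\<^sub>\<le>\<^sub>0" for \<alpha>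
  proof
    assume "d \<alpha> \<in> \<real>\<^sub>\<le>\<^sub>0"
    then obtain r where r: "d \<alpha> = of_real r" "r \<le> 0" by (auto elim: nonpos_Reals_cases)
    then have "r = -1" using nd[of \<alpha>] by simp
    then have "peak (\<alpha> + pi) = peak \<alpha>" using r nz[of \<alpha>] by (simp add: d_def)
    then show False using peak_plus_pi_neq by blast
  qed
  define \<theta> where "\<theta> = (\<lambda>\<alpha>. Im (Ln (d \<alpha>)))"
  have contp: "continuous_on A peak" for A using continuous_peak continuous_on_subset by blast
  have contp': "continuous_on A (\<lambda>\<alpha>. peak (\<alpha> + pi))" for A
    by (rule continuous_on_compose2[OF continuous_peak]) (auto intro!: continuous_intros)
  have "continuous_on {0..pi} \<theta>"
    unfolding \<theta>_def d_def using nz slit[unfolded d_def]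
    by (intro continuous_intros contp contp') auto
  moreover have "\<theta> pi = - \<theta> 0"
  proof -
    have "d (0 + pi) = inverse (d 0)"
      unfolding d_def peak_plus_2pi using nz by (simp add: field_simps)
    then have "Ln (d pi) = - Ln (d 0)" using slit[of 0] by (simp add: Ln_inverse)
    then show ?thesis by (simp add: \<theta>_def)
  qed
  ultimately have "\<exists>\<alpha>. \<theta> \<alpha> = 0"
    using IVT'[of \<theta> 0 0 pi] IVT2'[of \<theta> pi 0 0] by (cases "\<theta> 0 \<le> 0") auto
  then obtain \<alpha> where "\<theta> \<alpha> = 0" by blast
  then have "Im (Ln (d \<alpha>)) = 0" by (simp add: \<theta>_def)
  moreover have "Re (Ln (d \<alpha>)) = 0" using nd[of \<alpha>] by (metis Re_Ln norm_zero zero_neq_one ln_one)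
  ultimately have "Ln (d \<alpha>) = 0" by (simp add: complex_eq_iff)
  then have "d \<alpha> = 1" using nd[of \<alpha>] by (metis exp_Ln exp_zero norm_zero zero_neq_one)
  then have "peak (\<alpha> + pi) = - peak \<alpha>" using nz[of \<alpha>] by (simp add: d_def field_simps) (metis minus_minus)
  then show ?thesis by blast
qed

text \<open>The three images are distinct, collinear and in \<open>closure V\<close>; the middle one
  lies in an open segment, hence in \<open>V\<close>, impossible for a point of the circle. The
  coordinate \<open>I\<close> along the line decides which one is the middle.\<close>

lemma not_three_on_line:
  assumes "norm x = 1" "norm y = 1" "norm z = 1" "x \<noteq> y" "y \<noteq> z" "x \<noteq> z"
    and eq: "u \<alpha> x = c" "u \<alpha> y = c" "u \<alpha> z = c"
  shows False
proof -
  define I where "I = (\<lambda>z. Im (cis \<alpha> * F z))"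
  have *: False if n: "norm x = 1" "norm y = 1" "norm z = 1" and e: "u \<alpha> x = c" "u \<alpha> y = c" "u \<alpha> z = c"
    and less: "I x < I y" "I y < I z" for x y z
  proof -
    have "cis \<alpha> * F y \<in> open_segment (cis \<alpha> * F x) (cis \<alpha> * F z)"
      using e less by (intro collinear_middle_open_segment) (auto simp: u_def I_def)
    then obtain t where t: "0 < t" "t < 1" "cis \<alpha> * F y = (1 - t) *\<^sub>R (cis \<alpha> * F x) + t *\<^sub>R (cis \<alpha> * F z)"
      unfolding in_segment by blast
    then have "cis \<alpha> * F y = cis \<alpha> * ((1 - t) *\<^sub>R F x + t *\<^sub>R F z)" by (simp add: algebra_simps)
    then have "F y = (1 - t) *\<^sub>R F x + t *\<^sub>R F z" by simp
    moreover have "F x \<noteq> F z" using less by (auto simp: I_def)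
    ultimately have "F y \<in> open_segment (F x) (F z)" using t unfolding in_segment by blast
    moreover have "F x \<in> closure V" "F z \<in> closure V" using image_cball n by (auto simp: image_subset_iff)
    ultimately have "F y \<in> V" using strict \<open>F x \<noteq> F z\<close> by blast
    then show False using sphere_notin n by blast
  qed
  have ne: "I v \<noteq> I w" if "norm v = 1" "norm w = 1" "v \<noteq> w" "u \<alpha> v = c" "u \<alpha> w = c" for v w
  proof
    assume "I v = I w"
    then have "cis \<alpha> * F v = cis \<alpha> * F w" using that by (simp add: complex_eq_iff I_def u_def)
    then have "F v = F w" by simp
    then show False using chord_endpoints_neq that by blast
  qed
  have "I x \<noteq> I y" "I y \<noteq> I z" "I x \<noteq> I z" using ne assms by blast+
  then consider "I x < I y" "I y < I z" | "I x < I z" "I z < I y" | "I y < I x" "I x < I z"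
    | "I y < I z" "I z < I x" | "I z < I x" "I x < I y" | "I z < I y" "I y < I x" by linarith
  then show False
  proof cases
    case 1
    then show ?thesis by (rule *[OF assms(1) assms(2) assms(3) eq(1) eq(2) eq(3)])
  next
    case 2
    then show ?thesis by (rule *[OF assms(1) assms(3) assms(2) eq(1) eq(3) eq(2)])
  next
    case 3
    then show ?thesis by (rule *[OF assms(2) assms(1) assms(3) eq(2) eq(1) eq(3)])
  next
    case 4
    then show ?thesis by (rule *[OF assms(2) assms(3) assms(1) eq(2) eq(3) eq(1)])
  next
    case 5
    then show ?thesis by (rule *[OF assms(3) assms(1) assms(2) eq(3) eq(1) eq(2)])
  next
    case 6
    then show ?thesis by (rule *[OF assms(3) assms(2) assms(1) eq(3) eq(2) eq(1)])
  qed
qed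

end

text \<open>The maximum principle for the harmonic \<open>Re \<Psi>\<close>, obtained from
  \<open>exp \<Psi>\<close>. Only the real part is assumed to extend to the circle, as
  \<open>d\<close>.\<close>

lemma Re_le_0_on_disc_if_on_sphere:
  assumes hol: "\<Psi> holomorphic_on unit_disc" and cont: "continuous_on (cball 0 1) d"
    and eq: "\<And>z. z \<in> unit_disc \<Longrightarrow> d z = Re (\<Psi> z)" and le: "\<And>z. norm z = 1 \<Longrightarrow> d z \<le> (0::real)"
    and z: "z \<in> unit_disc"
  shows "d z \<le> 0"
proof (rule ccontr)
  assume "\<not> d z \<le> 0"
  obtain w where w: "w \<in> cball 0 1" "\<And>x. x \<in> cball 0 1 \<Longrightarrow> d x \<le> d w"
    using continuous_attains_sup[OF compact_cball _ cont] by auto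
  have pos: "d w > 0" using w(2)[of z] z \<open>\<not> d z \<le> 0\<close> by auto
  then have "norm w \<noteq> 1" using le[of w] by auto
  then have wd: "w \<in> unit_disc" using w(1) by auto
  have "(\<lambda>z. exp (\<Psi> z)) constant_on unit_disc"
  proof (rule maximum_modulus_principle[where \<xi> = w and U = unit_disc])
    show "(\<lambda>z. exp (\<Psi> z)) holomorphic_on unit_disc" by (intro holomorphic_intros hol)
    fix x assume "x \<in> unit_disc"
    then show "norm (exp (\<Psi> x)) \<le> norm (exp (\<Psi> w))"
      using w(2)[of x] eq[of x] eq[OF wd] by (simp add: norm_exp_eq_Re)
  qed (use wd in auto)
  then have const: "exp (\<Psi> x) = exp (\<Psi> w)" if "x \<in> unit_disc" for x
    using that wd unfolding constant_on_def by metis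
  have "d x = d w" if "x \<in> unit_disc" for x
  proof -
    have "norm (exp (\<Psi> x)) = norm (exp (\<Psi> w))" using const[OF that] by simp
    then show ?thesis using eq[OF that] eq[OF wd] by (simp add: norm_exp_eq_Re)
  qed
  then have "d 1 = d w"
    by (intro continuous_constant_on_closure[of unit_disc d "d w" 1]) (use cont in auto)
  then show False using le[of 1] pos by simp
qed

section \<open>Hyperbolic translations of the disc\<close>

lemma cis_sgn_arccos:
  assumes "norm w = 1"
  shows "w = cis ((if Im w \<ge> 0 then 1 else -1) * arccos (Re w))"
proof -
  have "(Re w)\<^sup>2 + (Im w)\<^sup>2 = 1" using assms by (metis cmod_power2 one_power2)
  then have "(Im w)\<^sup>2 = 1 - (Re w)\<^sup>2" by simp
  then have s: "sqrt (1 - (Re w)\<^sup>2) = \<bar>Im w\<bar>" by (metis real_sqrt_abs)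
  have "\<bar>Re w\<bar> \<le> 1" using abs_Re_le_cmod[of w] assms by simp
  then have "cos (arccos (Re w)) = Re w" "sin (arccos (Re w)) = \<bar>Im w\<bar>"
    using sin_arccos_abs[of "Re w"] s by (auto simp: cos_arccos_abs)
  then show ?thesis by (simp add: complex_eq_iff)
qed

text \<open>For \<open>0 < s < 1\<close> this is the automorphism of the disc that fixes 1 and -1
  and moves all other points towards 1. Its derivative in \<open>s\<close> at 0 is
  \<open>1 - w^2\<close>, the source of the factor \<open>p - cnj p * z^2\<close>.\<close>

definition hyp_translation :: "real \<Rightarrow> complex \<Rightarrow> complex" where
  "hyp_translation s w = (w + of_real s) / (1 + of_real s * w)"

lemma hyp_translation_denom_nonzero:
  assumes "\<bar>s\<bar> < 1" "norm w \<le> 1"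
  shows "1 + complex_of_real s * w \<noteq> 0"
proof
  assume "1 + complex_of_real s * w = 0"
  then have "norm (complex_of_real s * w) = 1" by (metis add_eq_0_iff norm_minus_cancel norm_one)
  moreover have "\<bar>s\<bar> * norm w \<le> \<bar>s\<bar> * 1" using assms by (intro mult_left_mono) auto
  ultimately show False using assms by (simp add: norm_mult)
qed

text \<open>All parts follow from the identity \<open>norm (1 + s w) ^ 2 - norm (w + s) ^ 2 = (1 -
  s^2) * (1 - norm w ^ 2)\<close>.\<close>

lemma hyp_translation_norm:
  assumes "\<bar>s\<bar> < 1" "norm w \<le> 1"
  shows "norm (hyp_translation s w) \<le> 1" and "norm w < 1 \<Longrightarrow> norm (hyp_translation s w) < 1"
    and "norm w = 1 \<Longrightarrow> norm (hyp_translation s w) = 1"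
proof -
  define N where "N = norm (1 + of_real s * w)"
  have N: "N > 0" using hyp_translation_denom_nonzero[OF assms] by (simp add: N_def)
  have s: "1 - s\<^sup>2 > 0" using assms(1) by (simp add: abs_square_less_1)
  have "N\<^sup>2 - (norm (w + of_real s))\<^sup>2 = (1 - s\<^sup>2) * (1 - (norm w)\<^sup>2)"
    unfolding N_def cmod_power2 by (simp add: power2_eq_square algebra_simps)
  then have *: "(norm (w + of_real s))\<^sup>2 = N\<^sup>2 - (1 - s\<^sup>2) * (1 - (norm w)\<^sup>2)" by simp
  have nT: "norm (hyp_translation s w) = norm (w + of_real s) / N"
    by (simp add: hyp_translation_def N_def norm_divide)
  have "(norm w)\<^sup>2 \<le> 1" using assms(2) by (simp add: abs_square_le_1)
  then have "(norm (w + of_real s))\<^sup>2 \<le> N\<^sup>2" using * s by simp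
  then have "norm (w + of_real s) \<le> N" by (rule power2_le_imp_le) (use N in simp)
  then show "norm (hyp_translation s w) \<le> 1" unfolding nT using N by simp
  show "norm (hyp_translation s w) < 1" if "norm w < 1"
  proof -
    have "(norm w)\<^sup>2 < 1" using that by (simp add: abs_square_less_1)
    then have "(1 - s\<^sup>2) * (1 - (norm w)\<^sup>2) > 0" using s by (intro mult_pos_pos) auto
    then have "(norm (w + of_real s))\<^sup>2 < N\<^sup>2" using * by linarith
    then have "norm (w + of_real s) < N" by (rule power2_less_imp_less) (use N in simp)
    then show ?thesis unfolding nT using N by simp
  qed
  show "norm (hyp_translation s w) = 1" if "norm w = 1"
  proof -
    have "(norm (w + of_real s))\<^sup>2 = N\<^sup>2" using * that by simp
    then have "norm (w + of_real s) = N" using N by (simp add: power2_eq_iff_nonneg)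
    then show ?thesis unfolding nT using N by simp
  qed
qed

lemma hyp_translation_holomorphic:
  assumes "\<bar>s\<bar> < 1"
  shows "hyp_translation s holomorphic_on unit_disc" "continuous_on (cball 0 1) (hyp_translation s)"
  unfolding hyp_translation_def using hyp_translation_denom_nonzero[OF assms]
  by (auto intro!: holomorphic_intros continuous_intros)

text \<open>On the circle the translation does not decrease the real part and keeps the sign of the
  imaginary part; so the angle from 1 shrinks from \<open>t2\<close> to \<open>t1\<close> within one
  half circle.\<close>

lemma hyp_translation_on_circle:
  assumes s: "0 \<le> s" "s < 1" and w: "norm w = 1"
  obtains \<sigma> t1 t2 where "\<sigma> = 1 \<or> \<sigma> = (-1::real)" "0 \<le> t1" "t1 \<le> t2" "t2 \<le> pi"
    "w = cis (\<sigma> * t2)" "hyp_translation s w = cis (\<sigma> * t1)"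
proof -
  define T where "T = hyp_translation s w"
  define N where "N = 1 + 2 * s * Re w + s\<^sup>2"
  have w2: "(Re w)\<^sup>2 + (Im w)\<^sup>2 = 1" using w by (metis cmod_power2 one_power2)
  have nz: "1 + complex_of_real s * w \<noteq> 0" using hyp_translation_denom_nonzero[of s w] s w by simp
  have N: "N = (norm (1 + of_real s * w))\<^sup>2"
  proof -
    have "(norm (1 + of_real s * w))\<^sup>2 = 1 + 2 * s * Re w + s\<^sup>2 * ((Re w)\<^sup>2 + (Im w)\<^sup>2)"
      unfolding cmod_power2 by (simp add: power2_eq_square algebra_simps)
    then show ?thesis by (simp add: w2 N_def)
  qed
  have Npos: "N > 0" unfolding N using nz by simp
  have s2: "1 - s\<^sup>2 > 0" using s by (simp add: abs_square_less_1)
  have ReT: "Re T = (Re w * (1 + s\<^sup>2) + 2 * s) / N"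
  proof -
    have "Re T = ((Re w + s) * (1 + s * Re w) + Im w * (s * Im w)) / N"
      unfolding T_def hyp_translation_def Re_divide N cmod_power2 by simp
    also have "(Re w + s) * (1 + s * Re w) + Im w * (s * Im w) = Re w * (1 + s\<^sup>2) + s + s * ((Re w)\<^sup>2 + (Im w)\<^sup>2)"
      by (simp add: power2_eq_square algebra_simps)
    finally show ?thesis by (simp add: w2)
  qed
  have ImT: "Im T = (1 - s\<^sup>2) * Im w / N"
  proof -
    have "Im T = (Im w * (1 + s * Re w) - (Re w + s) * (s * Im w)) / N"
      unfolding T_def hyp_translation_def Im_divide N cmod_power2 by simp
    also have "Im w * (1 + s * Re w) - (Re w + s) * (s * Im w) = (1 - s\<^sup>2) * Im w"
      by (simp add: power2_eq_square algebra_simps)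
    finally show ?thesis .
  qed
  have "Re T - Re w = 2 * s * (1 - (Re w)\<^sup>2) / N"
    unfolding ReT using Npos by (simp add: field_simps) (simp add: N_def power2_eq_square algebra_simps)
  moreover have "(Re w)\<^sup>2 \<le> 1" using w2 by (metis add_increasing2 zero_le_power2 le_add_same_cancel1)
  ultimately have le: "Re w \<le> Re T" using s Npos by (metis diff_ge_0_iff_ge divide_nonneg_pos mult_nonneg_nonneg zero_le_numeral)
  have nT: "norm T = 1" unfolding T_def using hyp_translation_norm(3)[of s w] s w by simp
  have sgn: "Im T \<ge> 0 \<longleftrightarrow> Im w \<ge> 0"
    unfolding ImT using Npos s2 by (simp add: zero_le_divide_iff zero_le_mult_iff)
  have b: "\<bar>Re w\<bar> \<le> 1" "\<bar>Re T\<bar> \<le> 1" using abs_Re_le_cmod[of w] abs_Re_le_cmod[of T] w nT by auto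
  show thesis
  proof (rule that[of "if Im w \<ge> 0 then 1 else -1" "arccos (Re T)" "arccos (Re w)"])
    show "w = cis ((if Im w \<ge> 0 then 1 else -1) * arccos (Re w))" by (rule cis_sgn_arccos[OF w])
    show "hyp_translation s w = cis ((if Im w \<ge> 0 then 1 else -1) * arccos (Re T))"
      using cis_sgn_arccos[OF nT] unfolding sgn by (simp only: T_def)
    show "arccos (Re T) \<le> arccos (Re w)" using le b by (simp add: arccos_le_mono)
  qed (use b in \<open>auto simp: arccos_lbound arccos_ubound abs_le_iff\<close>)
qed

context disc_homeo
begin

text \<open>If \<open>u\<close> increased from \<open>t1\<close> to \<open>t2\<close>, a level
  \<open>c\<close> strictly between the two values would be taken before \<open>t1\<close>, between
  \<open>t1\<close> and \<open>t2\<close>, and once more on the other half circle, which also runs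
  from the maximum to the minimum: three points on one level.\<close>

lemma u_monotone_on_half_circles:
  assumes anti: "peak (\<alpha> + pi) = - peak \<alpha>"
    and \<sigma>: "\<sigma> = 1 \<or> \<sigma> = (-1::real)" and t: "0 \<le> t1" "t1 \<le> t2" "t2 \<le> pi"
  shows "u \<alpha> (peak \<alpha> * cis (\<sigma> * t2)) \<le> u \<alpha> (peak \<alpha> * cis (\<sigma> * t1))"
proof (rule ccontr)
  define p where "p = peak \<alpha>"
  define \<gamma> where "\<gamma> = (\<lambda>\<tau> t. u \<alpha> (p * cis (\<tau> * t)))"
  assume "\<not> ?thesis"
  then have lt: "\<gamma> \<sigma> t1 < \<gamma> \<sigma> t2" by (simp add: \<gamma>_def p_def)
  then have t12: "t1 < t2" using t(2) by (cases "t1 = t2") auto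
  have np: "norm p = 1" by (simp add: p_def)
  have contg: "continuous_on A (\<gamma> \<tau>)" for A \<tau>
    unfolding \<gamma>_def
    by (rule continuous_on_compose2[OF cont_u]) (auto simp: norm_mult np intro!: continuous_intros)
  have max: "\<gamma> \<tau> t \<le> \<gamma> \<tau>' 0" for \<tau> \<tau>' t
    using u_less_peak[of "p * cis (\<tau> * t)" \<alpha>] unfolding \<gamma>_def p_def
    by (cases "peak \<alpha> * cis (\<tau> * t) = peak \<alpha>") (auto simp: norm_mult)
  have gpi: "\<gamma> \<tau> pi = u \<alpha> (- p)" if "\<tau> = 1 \<or> \<tau> = -1" for \<tau>
  proof -
    have "cis (\<tau> * pi) = -1" using that by (auto simp: complex_eq_iff)
    then show ?thesis by (simp add: \<gamma>_def)
  qed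
  have min: "u \<alpha> (- p) \<le> \<gamma> \<tau> t" for \<tau> t
    using u_less_peak[of "p * cis (\<tau> * t)" "\<alpha> + pi"] unfolding \<gamma>_def anti u_plus_pi p_def
    by (cases "peak \<alpha> * cis (\<tau> * t) = - peak \<alpha>") (auto simp: norm_mult)
  define c where "c = (\<gamma> \<sigma> t1 + \<gamma> \<sigma> t2) / 2"
  have c: "\<gamma> \<sigma> t1 < c" "c < \<gamma> \<sigma> t2" using lt by (auto simp: c_def)
  obtain s1 where s1: "0 \<le> s1" "s1 \<le> t1" "\<gamma> \<sigma> s1 = c"
    using IVT2'[of "\<gamma> \<sigma>" t1 c 0] c max[of \<sigma> t2 \<sigma>] t contg by (metis less_le_trans less_imp_le)
  obtain s2 where s2: "t1 \<le> s2" "s2 \<le> t2" "\<gamma> \<sigma> s2 = c"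
    using IVT'[of "\<gamma> \<sigma>" t1 c t2] c t contg by (metis less_imp_le)
  have \<sigma>': "- \<sigma> = 1 \<or> - \<sigma> = -1" using \<sigma> by auto
  have "\<gamma> (- \<sigma>) pi \<le> c" using gpi[OF \<sigma>'] min[of \<sigma> t1] c by simp
  moreover have "c \<le> \<gamma> (- \<sigma>) 0" using max[of \<sigma> t2 "- \<sigma>"] c by simp
  ultimately obtain s3 where s3: "0 \<le> s3" "s3 \<le> pi" "\<gamma> (- \<sigma>) s3 = c"
    using IVT2'[of "\<gamma> (- \<sigma>)" pi c 0] contg pi_ge_zero by metis
  have "\<gamma> \<sigma> 0 \<noteq> c" using max[of \<sigma> t2 \<sigma>] c by simp
  then have pos: "0 < s1" using s1 by (cases "s1 = 0") auto
  have "s1 \<noteq> t1" "s2 \<noteq> t1" using s1 s2 c by auto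
  then have s12: "s1 < s2" "s1 < pi" using s1 s2 t by auto
  have "\<gamma> (- \<sigma>) 0 \<noteq> c" "\<gamma> (- \<sigma>) pi \<noteq> c" using max[of \<sigma> t2 "- \<sigma>"] gpi[OF \<sigma>'] min[of \<sigma> t1] c by auto
  then have "s3 \<noteq> 0" "s3 \<noteq> pi" using s3(3) by auto
  then have s3': "0 < s3" "s3 < pi" using s3 by auto
  have cosinj: "a = b" if "cis (\<tau> * a) = cis (\<tau>' * b)" "\<tau> = 1 \<or> \<tau> = -1" "\<tau>' = 1 \<or> \<tau>' = (-1::real)"
     "0 \<le> a" "a \<le> pi" "0 \<le> b" "b \<le> pi" for a b \<tau> \<tau>'
  proof -
    have "cos (\<tau> * a) = cos (\<tau>' * b)" using that(1) by (metis cis.sel(1))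
    then have "cos a = cos b" using that(2,3) by auto
    then show ?thesis using cos_inj_pi that by blast
  qed
  have opp: False if "cis (\<sigma> * a) = cis (- \<sigma> * a)" "0 < a" "a < pi" for a
  proof -
    have "sin (\<sigma> * a) = sin (- \<sigma> * a)" using that(1) by (metis cis.sel(2))
    then have "sin a = 0" using \<sigma> by auto
    then show False using sin_gt_zero[OF that(2,3)] by simp
  qed
  have p0: "p \<noteq> 0" using np by auto
  show False
  proof (rule not_three_on_line[of "p * cis (\<sigma> * s1)" "p * cis (\<sigma> * s2)" "p * cis (- \<sigma> * s3)" \<alpha> c])
    show "p * cis (\<sigma> * s1) \<noteq> p * cis (\<sigma> * s2)"
      using cosinj[of \<sigma> s1 \<sigma> s2] \<sigma> s1 s2 s12 t p0 by auto
    show "p * cis (\<sigma> * s2) \<noteq> p * cis (- \<sigma> * s3)"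
      using cosinj[of \<sigma> s2 "- \<sigma>" s3] opp[of s3] \<sigma> \<sigma>' s1 s2 s3 s3' t p0 by auto
    show "p * cis (\<sigma> * s1) \<noteq> p * cis (- \<sigma> * s3)"
      using cosinj[of \<sigma> s1 "- \<sigma>" s3] opp[of s3] \<sigma> \<sigma>' s1 s2 s3 s3' s12 t p0 by auto
  qed (use s1 s2 s3 np in \<open>auto simp: norm_mult \<gamma>_def\<close>)
qed

text \<open>On the circle \<open>u\<close> does not decrease under translations towards
  \<open>p\<close>; by the maximum principle neither does it in the disc, where
  \<open>u = Re \<Phi>\<close>. So the derivative in the translation parameter at 0 is nonnegative,
  and it is the real part of \<open>deriv \<Phi> y * p * (1 - (cnj p * y)^2)\<close>.\<close>

lemma exists_positive_shear:
  assumes H: "H holomorphic_on unit_disc" and G: "G holomorphic_on unit_disc"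
    and FHG: "\<And>z. z \<in> unit_disc \<Longrightarrow> F z = H z + cnj (G z)"
  shows "\<exists>c p. norm c = 1 \<and> norm p = 1 \<and>
    (\<forall>z\<in>unit_disc. 0 \<le> Re ((c * deriv H z + cnj c * deriv G z) * (p - cnj p * z\<^sup>2)))"
proof -
  obtain \<alpha> where anti: "peak (\<alpha> + pi) = - peak \<alpha>" using exists_antipodal_peaks by blast
  define p where "p = peak \<alpha>"
  define c where "c = cis \<alpha>"
  have np: "norm p = 1" by (simp add: p_def)
  define \<Phi> where "\<Phi> = (\<lambda>z. c * H z + cnj c * G z)"
  have \<Phi>: "\<Phi> holomorphic_on unit_disc" unfolding \<Phi>_def by (intro holomorphic_intros H G)
  have u\<Phi>: "u \<alpha> z = Re (\<Phi> z)" if "z \<in> unit_disc" for z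
    by (simp add: u_def \<Phi>_def c_def FHG[OF that] algebra_simps)
  have flow: "Re (\<Phi> (p * w)) \<le> Re (\<Phi> (p * hyp_translation s w))"
    if s: "0 \<le> s" "s < 1" and w: "w \<in> unit_disc" for s w
  proof -
    define d where "d = (\<lambda>w. u \<alpha> (p * w) - u \<alpha> (p * hyp_translation s w))"
    have s': "\<bar>s\<bar> < 1" using s by simp
    note T = hyp_translation_norm[OF s'] hyp_translation_holomorphic[OF s']
    have "d w \<le> 0"
    proof (rule Re_le_0_on_disc_if_on_sphere[OF _ _ _ _ w])
      show "(\<lambda>w. \<Phi> (p * w) - \<Phi> (p * hyp_translation s w)) holomorphic_on unit_disc"
        by (intro holomorphic_intros holomorphic_on_compose_gen[OF _ \<Phi>, unfolded o_def] T(4))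
          (auto simp: norm_mult np T(2))
      have "continuous_on (cball 0 1) (\<lambda>w. u \<alpha> (p * w))"
        by (rule continuous_on_compose2[OF cont_u]) (auto simp: norm_mult np intro!: continuous_intros)
      moreover have "continuous_on (cball 0 1) (\<lambda>w. u \<alpha> (p * hyp_translation s w))"
        by (rule continuous_on_compose2[OF cont_u]) (auto simp: norm_mult np T(1) intro!: continuous_intros T(5))
      ultimately show "continuous_on (cball 0 1) d" unfolding d_def by (intro continuous_intros)
      fix z assume "z \<in> unit_disc"
      then show "d z = Re (\<Phi> (p * z) - \<Phi> (p * hyp_translation s z))"
        using T(2)[of z] by (simp add: d_def u\<Phi> norm_mult np)
    next
      fix z :: complex assume "norm z = 1"
      then obtain \<sigma> t1 t2 where "\<sigma> = 1 \<or> \<sigma> = (-1::real)" "0 \<le> t1" "t1 \<le> t2" "t2 \<le> pi"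
        "z = cis (\<sigma> * t2)" "hyp_translation s z = cis (\<sigma> * t1)"
        by (rule hyp_translation_on_circle[OF s])
      then show "d z \<le> 0" using u_monotone_on_half_circles[OF anti] by (simp add: d_def p_def)
    qed
    then show ?thesis using w T(2)[of w] by (simp add: d_def u\<Phi> norm_mult np)
  qed
  have "0 \<le> Re ((c * deriv H y + cnj c * deriv G y) * (p - cnj p * y\<^sup>2))" if y: "y \<in> unit_disc" for y
  proof -
    define z where "z = cnj p * y"
    have pp: "p * cnj p = 1" using np by (simp add: complex_norm_square[symmetric])
    then have pz: "p * z = y" by (simp add: z_def mult.assoc[symmetric])
    have z: "z \<in> unit_disc" using y np by (simp add: z_def norm_mult)
    define D where "D = deriv \<Phi> y * (p * (1 - z * z))"
    have "((\<lambda>w. (z + w) / (1 + w * z)) has_field_derivative (1 - z * z)) (at 0)"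
      by (auto intro!: derivative_eq_intros)
    then have "((\<lambda>w. p * ((z + w) / (1 + w * z))) has_field_derivative p * (1 - z * z)) (at 0)"
      by (rule DERIV_cmult)
    moreover have "(\<Phi> has_field_derivative deriv \<Phi> y) (at (p * ((z + 0) / (1 + 0 * z))))"
      using holomorphic_derivI[OF \<Phi> open_ball y] by (simp add: pz)
    ultimately have "((\<lambda>w. \<Phi> (p * ((z + w) / (1 + w * z)))) has_field_derivative D) (at (of_real 0))"
      unfolding D_def using DERIV_chain2 by fastforce
    from has_vector_derivative_real_field[OF this]
    have "((\<lambda>s. \<Phi> (p * hyp_translation s z)) has_vector_derivative D) (at 0)"
      by (simp add: hyp_translation_def)
    from bounded_linear.has_vector_derivative[OF bounded_linear_Re this]
    have der: "((\<lambda>s. Re (\<Phi> (p * hyp_translation s z))) has_real_derivative Re D) (at 0)"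
      by (simp only: has_real_derivative_iff_has_vector_derivative o_def)
    have "Re D \<ge> 0"
    proof (rule ccontr)
      assume "\<not> Re D \<ge> 0"
      then obtain e where e: "e > 0" "\<And>h. \<lbrakk>h > 0; h < e\<rbrakk> \<Longrightarrow>
          Re (\<Phi> (p * hyp_translation (0 + h) z)) < Re (\<Phi> (p * hyp_translation 0 z))"
        using DERIV_neg_dec_right[OF der] by auto
      define h where "h = min e 1 / 2"
      have "h > 0" "h < e" "h < 1" using e(1) by (auto simp: h_def)
      then have "Re (\<Phi> (p * hyp_translation h z)) < Re (\<Phi> (p * z))"
        using e(2)[of h] by (simp add: hyp_translation_def)
      then show False using flow[of h z] z \<open>h > 0\<close> \<open>h < 1\<close> by simp
    qed
    moreover have "deriv \<Phi> y = c * deriv H y + cnj c * deriv G y"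
      unfolding \<Phi>_def using holomorphic_derivI[OF H open_ball y] holomorphic_derivI[OF G open_ball y]
      by (intro DERIV_imp_deriv) (auto intro!: derivative_eq_intros)
    moreover have "p * (1 - z * z) = p - cnj p * y\<^sup>2"
    proof -
      have "p * (z * z) = (p * cnj p) * (cnj p * y\<^sup>2)" by (simp add: z_def power2_eq_square)
      then show ?thesis by (simp add: pp algebra_simps)
    qed
    ultimately show ?thesis by (simp add: D_def)
  qed
  then show ?thesis using np by (intro exI[of _ c] exI[of _ p]) (auto simp: c_def)
qed

end

section \<open>Coefficient bounds for convex harmonic maps\<close>

lemma norm_convex_combination_sq:
  fixes x y :: complex
  shows "(norm ((1 - t) *\<^sub>R x + t *\<^sub>R y))\<^sup>2 = (1 - t) * (norm x)\<^sup>2 + t * (norm y)\<^sup>2 - t * (1 - t) * (norm (x - y))\<^sup>2"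
  unfolding cmod_power2 by (simp add: power2_eq_square algebra_simps)

lemma infdist_convex_combination:
  fixes C :: "complex set"
  assumes C: "convex C" "closed C" "C \<noteq> {}" and t: "0 \<le> t" "t \<le> 1"
  shows "infdist ((1 - t) *\<^sub>R x + t *\<^sub>R y) C \<le> (1 - t) * infdist x C + t * infdist y C"
proof -
  obtain a b where ab: "a \<in> C" "infdist x C = dist x a" "b \<in> C" "infdist y C = dist y b"
    using infdist_attains_inf[OF C(2,3)] by metis
  have "(1 - t) *\<^sub>R a + t *\<^sub>R b \<in> C" using C(1) ab t by (simp add: convex_alt)
  then have "infdist ((1 - t) *\<^sub>R x + t *\<^sub>R y) C \<le> dist ((1 - t) *\<^sub>R x + t *\<^sub>R y) ((1 - t) *\<^sub>R a + t *\<^sub>R b)"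
    by (rule infdist_le)
  also have "\<dots> = norm ((1 - t) *\<^sub>R (x - a) + t *\<^sub>R (y - b))"
    by (simp add: dist_norm algebra_simps)
  also have "\<dots> \<le> (1 - t) * norm (x - a) + t * norm (y - b)"
    using t norm_triangle_ineq[of "(1 - t) *\<^sub>R (x - a)" "t *\<^sub>R (y - b)"] by simp
  finally show ?thesis using ab by (simp add: dist_norm)
qed

text \<open>Sublevel sets of the distance to the hull \<open>C\<close> are convex but may have
  segments in their boundary. Adding \<open>\<eta> * norm x ^ 2\<close> makes the function strictly
  convex, with the gain computed in \<open>norm_convex_combination_sq\<close>, and its sublevel sets
  become strictly convex.\<close>

lemma strictly_convex_between:
  fixes K \<Omega> :: "complex set"
  assumes K: "compact K" "K \<noteq> {}" and \<Omega>: "open \<Omega>" "convex \<Omega>" and sub: "K \<subseteq> \<Omega>"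
  obtains V where "open V" "convex V" "bounded V" "K \<subseteq> V" "closure V \<subseteq> \<Omega>"
    "\<And>a b. \<lbrakk>a \<in> closure V; b \<in> closure V; a \<noteq> b\<rbrakk> \<Longrightarrow> open_segment a b \<subseteq> V"
proof -
  define C where "C = convex hull K"
  have C: "compact C" "convex C" "C \<noteq> {}" "K \<subseteq> C" "C \<subseteq> \<Omega>"
    using K \<Omega> sub by (auto simp: C_def compact_convex_hull hull_subset hull_minimal)
  then have closedC: "closed C" by (simp add: compact_imp_closed)
  obtain e where e: "e > 0" "{x. infdist x C \<le> e} \<subseteq> \<Omega>"
    using compact_in_open_separated[OF C(3,1) \<Omega>(1) C(5)] by auto
  obtain B where B: "\<And>x. x \<in> C \<Longrightarrow> norm x \<le> B" using C(1) compact_imp_bounded bounded_iff by metis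
  \<comment> \<open>Small enough that \<open>\<psi> < e\<close> on \<open>C\<close>, where the
    distance vanishes and \<open>norm x \<le> B\<close>.\<close>
  define \<eta> where "\<eta> = e / (B\<^sup>2 + 1)"
  have B1: "B\<^sup>2 + 1 > 0" by (simp add: add_nonneg_pos)
  then have \<eta>: "\<eta> > 0" using e by (simp add: \<eta>_def)
  define \<psi> where "\<psi> = (\<lambda>x. infdist x C + \<eta> * (norm x)\<^sup>2)"
  define V where "V = {x. \<psi> x < e}"
  have cont\<psi>: "continuous_on UNIV \<psi>" unfolding \<psi>_def by (intro continuous_intros)
  have \<psi>conv: "\<psi> ((1 - t) *\<^sub>R x + t *\<^sub>R y) \<le> (1 - t) * \<psi> x + t * \<psi> y - \<eta> * (t * (1 - t) * (norm (x - y))\<^sup>2)"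
    if "0 \<le> t" "t \<le> 1" for t x y
    using infdist_convex_combination[OF C(2) closedC C(3) that, of x y]
    unfolding \<psi>_def norm_convex_combination_sq by (simp add: algebra_simps)
  have \<psi>le: "(1 - t) * \<psi> x + t * \<psi> y \<le> m" if "0 \<le> t" "t \<le> 1" "\<psi> x \<le> m" "\<psi> y \<le> m" for t x y m
    using convex_bound_le[of "\<psi> x" m "\<psi> y" "1 - t" t] that by simp
  have "open V" unfolding V_def by (intro open_Collect_less cont\<psi> continuous_intros)
  moreover have "convex V"
    unfolding convex_alt
  proof (intro ballI allI impI)
    fix x y t assume xy: "x \<in> V" "y \<in> V" and t: "0 \<le> t \<and> t \<le> (1::real)"
    define m where "m = max (\<psi> x) (\<psi> y)"
    have "\<psi> ((1 - t) *\<^sub>R x + t *\<^sub>R y) \<le> m"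
    proof -
      have "\<eta> * (t * (1 - t) * (norm (x - y))\<^sup>2) \<ge> 0" using t \<eta> by simp
      moreover have "(1 - t) * \<psi> x + t * \<psi> y \<le> m" using t by (intro \<psi>le) (auto simp: m_def)
      ultimately show ?thesis using \<psi>conv[of t x y] t by linarith
    qed
    then show "(1 - t) *\<^sub>R x + t *\<^sub>R y \<in> V" using xy by (simp add: V_def m_def)
  qed
  moreover have "bounded V"
  proof -
    have "norm x \<le> sqrt (e / \<eta>)" if "x \<in> V" for x
    proof -
      have "\<eta> * (norm x)\<^sup>2 < e" using that infdist_nonneg[of x C] by (simp add: V_def \<psi>_def)
      then have "(norm x)\<^sup>2 \<le> e / \<eta>" using \<eta> by (simp add: field_simps)
      then show ?thesis by (simp add: real_le_rsqrt)
    qed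
    then show ?thesis unfolding bounded_iff by blast
  qed
  moreover have "K \<subseteq> V"
  proof
    fix x assume "x \<in> K"
    then have x: "x \<in> C" using C by auto
    have "(norm x)\<^sup>2 < B\<^sup>2 + 1" using power_mono[OF B[OF x] norm_ge_zero, of 2] by simp
    then have "\<eta> * (norm x)\<^sup>2 < \<eta> * (B\<^sup>2 + 1)" using \<eta> by (rule mult_strict_left_mono)
    also have "\<dots> = e" using B1 by (simp add: \<eta>_def)
    finally show "x \<in> V" using x by (simp add: V_def \<psi>_def)
  qed
  moreover have cl: "closure V \<subseteq> {x. \<psi> x \<le> e}"
    unfolding V_def by (intro closure_minimal closed_Collect_le cont\<psi> continuous_intros) auto
  have "closure V \<subseteq> \<Omega>"
  proof -
    have "infdist x C \<le> \<psi> x" for x using \<eta> by (simp add: \<psi>_def)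
    then show ?thesis using cl e(2) by (auto intro: order_trans)
  qed
  moreover have "open_segment a b \<subseteq> V" if ab: "a \<in> closure V" "b \<in> closure V" "a \<noteq> b" for a b
  proof
    fix x assume "x \<in> open_segment a b"
    then obtain t where t: "0 < t" "t < 1" "x = (1 - t) *\<^sub>R a + t *\<^sub>R b" unfolding in_segment by blast
    have "\<psi> a \<le> e" "\<psi> b \<le> e" using ab cl by auto
    then have "(1 - t) * \<psi> a + t * \<psi> b \<le> e" using \<psi>le t by simp
    moreover have "\<eta> * (t * (1 - t) * (norm (a - b))\<^sup>2) > 0" using \<eta> t ab by simp
    ultimately show "x \<in> V" using \<psi>conv[of t a b] t by (simp add: V_def)
  qed
  ultimately show thesis by (rule that)
qed

section \<open>Normalized conformal maps near the identity\<close>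

lemma normalized_Riemann_map:
  assumes U: "open U" "simply_connected U" "U \<noteq> UNIV" "0 \<in> U"
  obtains \<phi> \<psi> where "\<phi> holomorphic_on unit_disc" "\<psi> holomorphic_on U" "\<phi> 0 = 0"
    "\<And>z. z \<in> unit_disc \<Longrightarrow> \<phi> z \<in> U \<and> \<psi> (\<phi> z) = z" "\<And>z. z \<in> U \<Longrightarrow> \<psi> z \<in> unit_disc \<and> \<phi> (\<psi> z) = z"
    "deriv \<phi> 0 = of_real (norm (deriv \<phi> 0))"
proof -
  obtain f g where fg: "f holomorphic_on U" "g holomorphic_on unit_disc"
    "\<And>z. z \<in> U \<Longrightarrow> f z \<in> unit_disc \<and> g (f z) = z" "\<And>z. z \<in> unit_disc \<Longrightarrow> g z \<in> U \<and> f (g z) = z"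
    using Riemann_mapping_theorem[of U] U by blast
  have "f 0 \<in> unit_disc" using fg(3)[OF U(4)] by blast
  then obtain m m' where m: "m (f 0) = 0" "m holomorphic_on unit_disc" "m ` unit_disc \<subseteq> unit_disc"
    "m' holomorphic_on unit_disc" "m' ` unit_disc \<subseteq> unit_disc"
    "\<And>z. z \<in> unit_disc \<Longrightarrow> m (m' z) = z" "\<And>z. z \<in> unit_disc \<Longrightarrow> m' (m z) = z"
    using ball_biholomorphism_exists[of "f 0"] by metis
  define \<phi>1 where "\<phi>1 = (\<lambda>z. g (m' z))"
  have \<phi>1: "\<phi>1 holomorphic_on unit_disc"
    unfolding \<phi>1_def by (rule holomorphic_on_compose_gen[OF m(4) fg(2) m(5), unfolded o_def])
  define d where "d = deriv \<phi>1 0"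
  \<comment> \<open>A rotation that makes the derivative at 0 nonnegative; the value 1 for
    \<open>d = 0\<close> is a default that keeps \<open>c\<close> unimodular.\<close>
  define c where "c = (if d = 0 then 1 else cnj d / norm d)"
  have c: "norm c = 1" by (simp add: c_def norm_divide)
  then have c0: "c \<noteq> 0" by auto
  define \<phi> where "\<phi> = (\<lambda>z. \<phi>1 (c * z))"
  define \<psi> where "\<psi> = (\<lambda>z. m (f z) / c)"
  have cz: "c * z \<in> unit_disc" if "z \<in> unit_disc" for z using that c by (simp add: norm_mult)
  have \<phi>: "\<phi> holomorphic_on unit_disc"
    unfolding \<phi>_def by (rule holomorphic_on_compose_gen[OF _ \<phi>1, unfolded o_def]) (use cz in \<open>auto intro!: holomorphic_intros\<close>)
  moreover have "\<psi> holomorphic_on U"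
    unfolding \<psi>_def using c0 fg(3)
    by (intro holomorphic_intros holomorphic_on_compose_gen[OF fg(1) m(2), unfolded o_def]) auto
  moreover have "\<phi> 0 = 0"
  proof -
    have "m' 0 = f 0" using m(1) m(7)[OF \<open>f 0 \<in> unit_disc\<close>] by simp
    then show ?thesis using fg(3)[OF U(4)] by (simp add: \<phi>_def \<phi>1_def)
  qed
  moreover have "\<phi> z \<in> U \<and> \<psi> (\<phi> z) = z" if z: "z \<in> unit_disc" for z
  proof -
    have "m' (c * z) \<in> unit_disc" using m(5) cz[OF z] by blast
    then show ?thesis using fg(4) m(6)[OF cz[OF z]] c0 by (simp add: \<phi>_def \<phi>1_def \<psi>_def)
  qed
  moreover have "\<psi> z \<in> unit_disc \<and> \<phi> (\<psi> z) = z" if z: "z \<in> U" for z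
  proof -
    have "m (f z) \<in> unit_disc" using m(3) fg(3)[OF z] by blast
    then show ?thesis using fg(3)[OF z] m(7) c c0 by (simp add: \<phi>_def \<phi>1_def \<psi>_def norm_divide)
  qed
  moreover have "deriv \<phi> 0 = of_real (norm (deriv \<phi> 0))"
  proof -
    have "(\<phi>1 has_field_derivative d) (at (c * 0))"
      unfolding d_def using holomorphic_derivI[OF \<phi>1, of 0] by simp
    moreover have "((\<lambda>z. c * z) has_field_derivative c) (at 0)" by (auto intro!: derivative_eq_intros)
    ultimately have "(\<phi> has_field_derivative d * c) (at 0)"
      unfolding \<phi>_def by (rule DERIV_chain2)
    then have "deriv \<phi> 0 = d * c" by (rule DERIV_imp_deriv)
    also have "d * c = of_real (norm d)"
      by (simp add: c_def complex_norm_square[symmetric] power2_eq_square)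
    finally show ?thesis by simp
  qed
  ultimately show thesis by (rule that)
qed

text \<open>In \<open>\<phi> z = z * q z\<close> the function \<open>1 - q\<close> has nonnegative
  real part by the Schwarz lemma and the value \<open>1 - t\<close> at 0, so its coefficients are at
  most \<open>2 * (1 - t)\<close>; the geometric series at \<open>norm z \<le> 1 / 2\<close> turns
  this into \<open>4 * (1 - t)\<close>.\<close>

lemma schwarz_near_identity:
  assumes \<phi>: "\<phi> holomorphic_on unit_disc" "\<phi> 0 = 0" "\<And>z. z \<in> unit_disc \<Longrightarrow> \<phi> z \<in> unit_disc"
    and d: "deriv \<phi> 0 = of_real t" "0 \<le> t" and z: "norm z \<le> 1 / 2"
  shows "norm (\<phi> z) \<le> norm z" and "norm (\<phi> z - z) \<le> 4 * (1 - t)" and "t \<le> 1"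
proof -
  have S: "norm (\<phi> x) \<le> norm x" if "norm x < 1" for x
    using Schwarz_Lemma(1)[OF \<phi>(1,2) _ that] \<phi>(3) by simp
  show "norm (\<phi> z) \<le> norm z" using S z by simp
  have "norm (deriv \<phi> 0) \<le> 1" using Schwarz_Lemma(2)[OF \<phi>(1,2), of 0] \<phi>(3) by simp
  then show t: "t \<le> 1" using d by simp
  obtain q where q: "q holomorphic_on unit_disc" "\<And>z. norm z < 1 \<Longrightarrow> \<phi> z = z * q z" "deriv \<phi> 0 = q 0"
    using Schwarz3[OF \<phi>(1,2)] by metis
  define X where "X = (\<lambda>z. 1 - q z)"
  have X: "X holomorphic_on unit_disc" unfolding X_def by (intro holomorphic_intros q)
  have "norm (q x) \<le> 1" if x: "norm x < 1" for x
  proof (cases "x = 0")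
    case True
    moreover have "norm (q 0) = t" using q(3) d by (metis norm_of_real abs_of_nonneg)
    ultimately show ?thesis using t by simp
  next
    case False
    then show ?thesis using S[OF x] q(2)[OF x] by (simp add: norm_mult)
  qed
  then have pos: "0 \<le> Re (X x)" if "x \<in> unit_disc" for x
    using that complex_Re_le_cmod[of "q x"] by (force simp: X_def intro: order_trans)
  have X0: "X 0 = of_real (1 - t)" using q(3) d by (simp add: X_def)
  have coeff: "norm (tcoeff X n) \<le> 2 * (1 - t)" for n
  proof (cases "n \<ge> 1")
    case True
    then show ?thesis using tcoeff_Caratheodory[OF X pos] X0 by simp
  next
    case False
    then have "n = 0" by simp
    then have "tcoeff X n = of_real (1 - t)" using X0 by (simp add: fps_expansion_def)
    then show ?thesis using t by (simp del: of_real_diff)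
  qed
  have "(\<lambda>n. tcoeff X n * z ^ n) sums X z" using z by (intro tcoeff_sums X) simp
  moreover have "(\<lambda>n. 2 * (1 - t) * (1 / 2) ^ n) sums (2 * (1 - t) * (1 / (1 - 1 / 2)))"
    by (intro sums_mult geometric_sums) simp
  moreover have "norm (tcoeff X n * z ^ n) \<le> 2 * (1 - t) * (1 / 2) ^ n" for n
    unfolding norm_mult norm_power using coeff z t by (intro mult_mono power_mono) auto
  ultimately have "norm (X z) \<le> 4 * (1 - t)" using norm_sums_le by fastforce
  moreover have "\<phi> z - z = - (z * X z)" using q(2)[of z] z by (simp add: X_def algebra_simps)
  ultimately have "norm (\<phi> z - z) \<le> 1 * (4 * (1 - t))"
    using z t by (simp only: norm_minus_cancel norm_mult) (intro mult_mono, auto)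
  then show "norm (\<phi> z - z) \<le> 4 * (1 - t)" by simp
qed

lemma tcoeff_diff_le:
  assumes h: "h holomorphic_on unit_disc" and k: "k holomorphic_on unit_disc"
    and le: "\<And>z. norm z = 1 / 2 \<Longrightarrow> norm (h z - k z) \<le> e"
  shows "norm (tcoeff h n - tcoeff k n) \<le> e * 2 ^ n"
proof -
  have sub: "cball (0::complex) (1 / 2) \<subseteq> unit_disc" by auto
  have hol: "(\<lambda>z. h z - k z) holomorphic_on unit_disc" by (intro holomorphic_intros h k)
  have "norm ((deriv ^^ n) (\<lambda>z. h z - k z) 0) \<le> fact n * e / (1 / 2) ^ n"
  proof (rule Cauchy_inequality)
    show "(\<lambda>z. h z - k z) holomorphic_on ball 0 (1 / 2)"
      by (rule holomorphic_on_subset[OF hol]) auto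
    show "continuous_on (cball 0 (1 / 2)) (\<lambda>z. h z - k z)"
      by (rule continuous_on_subset[OF holomorphic_on_imp_continuous_on[OF hol] sub])
  qed (use le in auto)
  then have "norm (tcoeff (\<lambda>z. h z - k z) n) \<le> e * 2 ^ n"
    by (simp add: fps_expansion_def norm_divide field_simps)
  moreover have "fps_expansion (\<lambda>z. h z - k z) 0 = fps_expansion h 0 - fps_expansion k 0"
    by (intro fps_expansion_eqI fps_expansion_intros has_fps_expansion_tcoeff h k)
  ultimately show ?thesis by simp
qed

lemma K_hat0_D:
  assumes "f \<in> K_hat0" and dec: "harmonic_decomp f h g"
  shows "inj_on f unit_disc" "convex (f ` unit_disc)" "deriv g 0 = 0"
    "\<And>z. z \<in> unit_disc \<Longrightarrow> norm (deriv g z) < norm (deriv h z)"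
proof -
  have f: "f \<in> S_hat0" "convex (f ` unit_disc)" using assms(1) by (auto simp: K_hat0_def)
  then have "f \<in> S_hat" and ex: "\<exists>h g. harmonic_decomp f h g \<and> deriv g 0 = 0" by (auto simp: S_hat0_def)
  then have inj: "inj_on f unit_disc" and sp: "sense_preserving_on unit_disc f" by (auto simp: S_hat_def)
  show "inj_on f unit_disc" "convex (f ` unit_disc)" by (fact inj, fact f(2))
  have der: "(f has_derivative (\<lambda>v. deriv h z * v + cnj (deriv g z * v))) (at z)"
    if dec: "harmonic_decomp f h g" and z: "z \<in> unit_disc" for h g z
  proof -
    have hg: "h holomorphic_on unit_disc" "g holomorphic_on unit_disc"
      and feq: "\<And>z. z \<in> unit_disc \<Longrightarrow> f z = h z + cnj (g z)" using dec by (auto simp: harmonic_decomp_def)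
    have "(h has_derivative (*) (deriv h z)) (at z)" "(g has_derivative (*) (deriv g z)) (at z)"
      using holomorphic_derivI[OF hg(1) open_ball z] holomorphic_derivI[OF hg(2) open_ball z]
      by (auto simp: has_field_derivative_def)
    then have "((\<lambda>z. h z + cnj (g z)) has_derivative (\<lambda>v. deriv h z * v + cnj (deriv g z * v))) (at z)"
      by (intro has_derivative_add has_derivative_cnj)
    then show ?thesis
      by (rule has_derivative_transform_within_open[OF _ open_ball z]) (simp add: feq)
  qed
  show "norm (deriv g z) < norm (deriv h z)" if z: "z \<in> unit_disc" for z
  proof -
    obtain f' where f': "(f has_derivative f') (at z)" "Re (f' 1) * Im (f' \<i>) - Im (f' 1) * Re (f' \<i>) > 0"
      using sp z unfolding sense_preserving_on_def by blast
    have "f' = (\<lambda>v. deriv h z * v + cnj (deriv g z * v))"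
      using has_derivative_unique[OF f'(1) der[OF dec z]] .
    then have "(norm (deriv h z))\<^sup>2 - (norm (deriv g z))\<^sup>2 > 0"
      using f'(2) unfolding cmod_power2 by (simp add: power2_eq_square algebra_simps)
    then show ?thesis by (intro power2_less_imp_less[of "norm (deriv g z)" "norm (deriv h z)"]) simp_all
  qed
  obtain h2 g2 where dec2: "harmonic_decomp f h2 g2" "deriv g2 0 = 0" using ex by blast
  \<comment> \<open>\<open>S_hat0\<close> provides some decomposition with vanishing derivative, not
    yet the given one. Comparing the real derivatives of \<open>f\<close> at 0 in the directions 1
    and \<open>i\<close> transfers this to \<open>g\<close>.\<close>
  have eq: "(\<lambda>v. deriv h 0 * v + cnj (deriv g 0 * v)) = (\<lambda>v. deriv h2 0 * v + cnj (deriv g2 0 * v))"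
    using has_derivative_unique[OF der[OF dec, of 0] der[OF dec2(1), of 0]] by simp
  have "deriv h 0 + cnj (deriv g 0) = deriv h2 0" using fun_cong[OF eq, of 1] dec2(2) by simp
  moreover have "\<i> * (deriv h 0 - cnj (deriv g 0)) = \<i> * deriv h2 0"
    using fun_cong[OF eq, of \<i>] dec2(2) by (simp add: algebra_simps)
  then have "deriv h 0 - cnj (deriv g 0) = deriv h2 0" by simp
  ultimately have "deriv h 0 + cnj (deriv g 0) = deriv h 0 - cnj (deriv g 0)" by simp
  then have "2 * cnj (deriv g 0) = 0" by (simp only: diff_conv_add_uminus add_left_cancel mult_2 eq_neg_iff_add_eq_0)
  then show "deriv g 0 = 0" by simp
qed

text \<open>The parameter \<open>\<rho>\<close> gives an exhaustion: \<open>\<phi>\<close> maps the disc onto the preimage under \<open>f\<close> of a strictly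
  convex domain whose closure lies in the image of \<open>f\<close>, and \<open>\<phi>\<close> tends to the identity as \<open>\<rho>\<close> tends to 1.\<close>

lemma exhausting_reparametrization:
  assumes fK: "f \<in> K_hat0" and dec: "harmonic_decomp f h g" and \<rho>: "0 < \<rho>" "\<rho> < 1"
  shows "\<exists>\<phi> t c p. \<phi> holomorphic_on unit_disc \<and> inj_on \<phi> unit_disc \<and> \<phi> ` unit_disc \<subseteq> unit_disc \<and> \<phi> 0 = 0 \<and>
    deriv \<phi> 0 = complex_of_real t \<and> \<rho> \<le> t \<and> norm c = 1 \<and> norm p = 1 \<and>
    (\<forall>z\<in>unit_disc.
       0 \<le> Re ((c * deriv (\<lambda>z. h (\<phi> z)) z + cnj c * deriv (\<lambda>z. g (\<phi> z)) z) * (p - cnj p * z\<^sup>2)))"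
proof -
  note K = K_hat0_D[OF fK dec]
  have hg: "h holomorphic_on unit_disc" "g holomorphic_on unit_disc" "h 0 = 0" "g 0 = 0"
    and feq: "\<And>z. z \<in> unit_disc \<Longrightarrow> f z = h z + cnj (g z)" using dec by (auto simp: harmonic_decomp_def)
  have "continuous_on unit_disc (\<lambda>z. h z + cnj (g z))"
    by (intro continuous_intros holomorphic_on_imp_continuous_on hg)
  then have contf: "continuous_on unit_disc f"
    using feq continuous_on_cong by (metis (no_types, lifting))
  define \<Omega> where "\<Omega> = f ` unit_disc"
  have op\<Omega>: "open \<Omega>" unfolding \<Omega>_def by (rule invariance_of_domain[OF contf open_ball K(1)])
  obtain k where k: "homeomorphism unit_disc \<Omega> f k"
    using invariance_of_domain_homeomorphism[OF open_ball contf _ K(1)] unfolding \<Omega>_def by auto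
  have sub\<rho>: "cball 0 \<rho> \<subseteq> unit_disc" using \<rho> by auto
  have "compact (f ` cball 0 \<rho>)"
    by (intro compact_continuous_image continuous_on_subset[OF contf sub\<rho>] compact_cball)
  moreover have "f ` cball 0 \<rho> \<noteq> {}" using \<rho> by auto
  moreover have "f ` cball 0 \<rho> \<subseteq> \<Omega>" unfolding \<Omega>_def using sub\<rho> by blast
  ultimately obtain V where V: "open V" "convex V" "bounded V" "f ` cball 0 \<rho> \<subseteq> V" "closure V \<subseteq> \<Omega>"
    "\<And>a b. \<lbrakk>a \<in> closure V; b \<in> closure V; a \<noteq> b\<rbrakk> \<Longrightarrow> open_segment a b \<subseteq> V"
    using strictly_convex_between[of "f ` cball 0 \<rho>" \<Omega>] op\<Omega> K(2) unfolding \<Omega>_def by metis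
  have V\<Omega>: "V \<subseteq> \<Omega>" using V(5) closure_subset by blast
  define U where "U = k ` V"
  have kf: "\<And>z. z \<in> unit_disc \<Longrightarrow> k (f z) = z" and fk: "\<And>y. y \<in> \<Omega> \<Longrightarrow> k y \<in> unit_disc \<and> f (k y) = y"
    using k by (auto simp: homeomorphism_def)
  have contk: "continuous_on \<Omega> k" using k by (simp add: homeomorphism_def)
  have Usub: "U \<subseteq> unit_disc" using fk V\<Omega> by (auto simp: U_def)
  have fU: "f ` U = V" using fk V\<Omega> by (force simp: U_def image_iff)
  have homUV: "homeomorphism V U k f"
    unfolding homeomorphism_def
    using continuous_on_subset[OF contk V\<Omega>] continuous_on_subset[OF contf Usub] fk V\<Omega> fU
    by (auto simp: U_def)
  have "inj_on k V" using fk V\<Omega> by (intro inj_on_inverseI[of _ f]) blast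
  then have opU: "open U"
    unfolding U_def using invariance_of_domain[OF continuous_on_subset[OF contk V\<Omega>] V(1)] by blast
  have scU: "simply_connected U"
    using homeomorphic_simply_connected[of V U] homUV convex_imp_simply_connected[OF V(2)]
    unfolding homeomorphic_def by blast
  have U\<rho>: "z \<in> U" if "norm z \<le> \<rho>" for z
  proof -
    have "z \<in> cball 0 \<rho>" using that by simp
    then have "f z \<in> V" "k (f z) = z" using V(4) sub\<rho> kf by blast+
    then show ?thesis unfolding U_def by (metis imageI)
  qed
  have "U \<noteq> UNIV" using Usub by (metis UNIV_I mem_ball_0 norm_one order_less_irrefl subsetD)
  then obtain \<phi> \<psi> where \<phi>: "\<phi> holomorphic_on unit_disc" "\<psi> holomorphic_on U" "\<phi> 0 = 0"
    "\<And>z. z \<in> unit_disc \<Longrightarrow> \<phi> z \<in> U \<and> \<psi> (\<phi> z) = z" "\<And>z. z \<in> U \<Longrightarrow> \<psi> z \<in> unit_disc \<and> \<phi> (\<psi> z) = z"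
    "deriv \<phi> 0 = of_real (norm (deriv \<phi> 0))"
    using normalized_Riemann_map[OF opU scU] U\<rho>[of 0] \<rho> by (metis norm_zero less_imp_le)
  have inj\<phi>: "inj_on \<phi> unit_disc" using \<phi>(4) by (intro inj_on_inverseI[of _ \<psi>]) blast
  have im\<phi>: "\<phi> ` unit_disc = U" using \<phi>(4,5) by force
  have \<phi>disc: "\<phi> ` unit_disc \<subseteq> unit_disc" using im\<phi> Usub by blast
  then have \<phi>d: "\<phi> z \<in> unit_disc" if "z \<in> unit_disc" for z using that by blast
  define t where "t = norm (deriv \<phi> 0)"
  \<comment> \<open>\<open>U\<close> contains the disc of radius \<open>\<rho>\<close>, so the
    Schwarz lemma applies to \<open>\<psi> (\<rho> * z)\<close>, with \<open>\<psi>\<close> the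
    inverse of \<open>\<phi>\<close>, and bounds \<open>norm (deriv \<psi> 0) * \<rho>\<close> by
    \<open>1 = norm (deriv \<psi> 0) * t\<close>.\<close>
  have t: "\<rho> \<le> t"
  proof -
    have "\<psi> 0 = 0" using \<phi>(4)[of 0] \<phi>(3) by simp
    define s where "s = deriv \<psi> 0"
    have ds: "(\<psi> has_field_derivative s) (at 0)"
      unfolding s_def by (rule holomorphic_derivI[OF \<phi>(2) opU U\<rho>]) (use \<rho> in simp)
    have "((\<lambda>z. \<psi> (\<phi> z)) has_field_derivative s * deriv \<phi> 0) (at 0)"
    proof -
      have "(\<psi> has_field_derivative s) (at (\<phi> 0))" using ds \<phi>(3) by simp
      moreover have "(\<phi> has_field_derivative deriv \<phi> 0) (at 0)" by (rule holomorphic_derivI[OF \<phi>(1) open_ball]) simp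
      ultimately show ?thesis by (rule DERIV_chain2)
    qed
    moreover have "((\<lambda>z. \<psi> (\<phi> z)) has_field_derivative 1) (at 0)"
      by (rule has_field_derivative_transform_within_open[OF DERIV_ident open_ball[of 0 1]]) (use \<phi>(4) in auto)
    ultimately have "s * deriv \<phi> 0 = 1" by (rule DERIV_unique)
    then have st: "norm s * t = 1" unfolding t_def by (metis norm_mult norm_one)
    have "norm (deriv (\<lambda>z. \<psi> (\<rho> * z)) 0) \<le> 1"
    proof (rule Schwarz_Lemma(2)[of _ 0])
      have sm: "\<rho> * z \<in> U" if "z \<in> unit_disc" for z :: complex
        using that \<rho> by (intro U\<rho>) (simp add: norm_mult mult_left_le)
      then show "(\<lambda>z. \<psi> (\<rho> * z)) holomorphic_on unit_disc"
        by (intro holomorphic_on_compose_gen[OF _ \<phi>(2), unfolded o_def]) (auto intro!: holomorphic_intros)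
      show "norm (\<psi> (\<rho> * z)) < 1" if "norm z < 1" for z :: complex
        using sm[of z] \<phi>(5)[of "\<rho> * z"] that by simp
    qed (use \<open>\<psi> 0 = 0\<close> in auto)
    moreover have "deriv (\<lambda>z. \<psi> (\<rho> * z)) 0 = s * \<rho>"
    proof (rule DERIV_imp_deriv)
      have "((\<lambda>z. \<rho> * z) has_field_derivative (\<rho> :: complex)) (at 0)" by (auto intro!: derivative_eq_intros)
      then show "((\<lambda>z. \<psi> (\<rho> * z)) has_field_derivative s * \<rho>) (at 0)"
        by (intro DERIV_chain2[of \<psi> s]) (use ds in auto)
    qed
    ultimately have "norm s * \<rho> \<le> norm s * t" using \<rho> st by (simp add: norm_mult)
    moreover have "norm s > 0" using st by (metis mult_zero_left norm_ge_zero order_le_less zero_neq_one)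
    ultimately show ?thesis by simp
  qed
  define F0 where "F0 = (\<lambda>z. f (\<phi> z))"
  have contF0: "continuous_on unit_disc F0"
    unfolding F0_def by (rule continuous_on_compose2[OF contf holomorphic_on_imp_continuous_on[OF \<phi>(1)]]) (use \<phi>disc in auto)
  have imF0: "F0 ` unit_disc = V"
  proof -
    have "F0 ` unit_disc = f ` (\<phi> ` unit_disc)" unfolding F0_def by (simp only: image_image)
    then show ?thesis by (simp only: im\<phi> fU)
  qed
  have injF0: "inj_on F0 unit_disc"
    using K(1) inj\<phi> \<phi>disc unfolding F0_def inj_on_def by blast
  \<comment> \<open>\<open>closure V\<close> is compact inside the image of \<open>f\<close>, so
    \<open>f\<close> is uniformly continuous on its preimage; crosscuts with short image under
    \<open>\<phi>\<close> thus have short image under \<open>F0\<close>.\<close>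
  have "compact (k ` closure V)"
    using V(3) by (intro compact_continuous_image continuous_on_subset[OF contk V(5)]) (simp add: compact_closure)
  moreover have "k ` closure V \<subseteq> unit_disc" using fk V(5) by blast
  ultimately have "uniformly_continuous_on (k ` closure V) f"
    by (intro compact_uniformly_continuous continuous_on_subset[OF contf])
  moreover have "U \<subseteq> k ` closure V" unfolding U_def using closure_subset by blast
  ultimately have ucf: "uniformly_continuous_on U f"
    unfolding uniformly_continuous_on_def by (meson subsetD)
  have "uniformly_continuous_on unit_disc F0"
  proof (rule uniformly_continuous_on_disc_if_short_crosscuts[OF contF0 injF0 V(1) imF0 V(2,3)])
    fix e :: real assume "e > 0"
    then obtain d where d: "d > 0" "\<And>x y. \<lbrakk>x \<in> U; y \<in> U; dist y x < d\<rbrakk> \<Longrightarrow> dist (f y) (f x) < e"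
      using ucf unfolding uniformly_continuous_on_def by meson
    from short_crosscut[OF d(1)] obtain \<delta> where \<delta>: "0 < \<delta>" "\<delta> < 1"
      "\<And>\<zeta>. norm \<zeta> = 1 \<Longrightarrow> \<exists>\<rho>>\<delta>. \<rho> < 1 \<and>
         (\<forall>z\<in>unit_disc \<inter> sphere \<zeta> \<rho>. \<forall>w\<in>unit_disc \<inter> sphere \<zeta> \<rho>. norm (\<phi> z - \<phi> w) < d)"
      using \<phi>(1) inj\<phi> \<phi>disc by blast
    have "\<exists>\<rho>>\<delta>. \<rho> < 1 \<and>
         (\<forall>z\<in>unit_disc \<inter> sphere \<zeta> \<rho>. \<forall>w\<in>unit_disc \<inter> sphere \<zeta> \<rho>. norm (F0 z - F0 w) < e)" if \<zeta>: "norm \<zeta> = 1" for \<zeta>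
    proof -
      obtain \<rho> where \<rho>: "\<delta> < \<rho>" "\<rho> < 1"
        "\<forall>z\<in>unit_disc \<inter> sphere \<zeta> \<rho>. \<forall>w\<in>unit_disc \<inter> sphere \<zeta> \<rho>. norm (\<phi> z - \<phi> w) < d"
        using \<delta>(3)[OF \<zeta>] by blast
      have "norm (F0 z - F0 w) < e" if "z \<in> unit_disc \<inter> sphere \<zeta> \<rho>" "w \<in> unit_disc \<inter> sphere \<zeta> \<rho>" for z w
      proof -
        have "norm (\<phi> z - \<phi> w) < d" using \<rho>(3) that by blast
        moreover have "\<phi> z \<in> U" "\<phi> w \<in> U" using \<phi>(4) that by blast+
        ultimately show ?thesis using d(2)[of "\<phi> w" "\<phi> z"] unfolding F0_def by (simp add: dist_norm)
      qed
      then show ?thesis using \<rho>(1,2) by blast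
    qed
    then show "\<exists>\<delta>>0. \<delta> < 1 \<and> (\<forall>\<zeta>. norm \<zeta> = 1 \<longrightarrow> (\<exists>\<rho>>\<delta>. \<rho> < 1 \<and>
       (\<forall>z\<in>unit_disc \<inter> sphere \<zeta> \<rho>. \<forall>w\<in>unit_disc \<inter> sphere \<zeta> \<rho>. norm (F0 z - F0 w) < e)))"
      using \<delta>(1,2) by blast
  qed
  then obtain F where F: "uniformly_continuous_on (closure unit_disc) F" "\<And>z. z \<in> unit_disc \<Longrightarrow> F0 z = F z"
    using uniformly_continuous_on_extension_on_closure by metis
  have "continuous_on (cball 0 1) F" using uniformly_continuous_imp_continuous[OF F(1)] by simp
  moreover have "inj_on F unit_disc" using injF0 F(2) unfolding inj_on_def by metis
  moreover have "F ` unit_disc = V" unfolding imF0[symmetric] by (rule image_cong) (simp_all add: F(2))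
  moreover have "k (F z) = \<phi> z" if "z \<in> unit_disc" for z
    using F(2)[OF that] kf[OF \<phi>d[OF that]] by (simp add: F0_def)
  moreover have "k a \<notin> \<phi> ` unit_disc" if "a \<in> closure V" "a \<notin> V" for a
  proof
    assume "k a \<in> \<phi> ` unit_disc"
    then obtain b where "b \<in> V" "k a = k b" unfolding im\<phi> U_def by blast
    then have "a = b" using fk[of a] fk[of b] V(5) V\<Omega> that by (metis subsetD)
    then show False using \<open>b \<in> V\<close> that by simp
  qed
  ultimately interpret disc_homeo F \<phi> k V
    using V \<phi>(1) continuous_on_subset[OF contk V(5)] by unfold_locales blast+
  have hol: "(\<lambda>z. h (\<phi> z)) holomorphic_on unit_disc" "(\<lambda>z. g (\<phi> z)) holomorphic_on unit_disc"
    using holomorphic_on_compose_gen[OF \<phi>(1) _ \<phi>disc] hg unfolding o_def by blast+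
  have Fhg: "F z = h (\<phi> z) + cnj (g (\<phi> z))" if "z \<in> unit_disc" for z
    using F(2)[OF that] feq[OF \<phi>d[OF that]] by (simp add: F0_def)
  obtain c p where cp: "norm c = 1" "norm p = 1"
    "\<forall>z\<in>unit_disc. 0 \<le> Re ((c * deriv (\<lambda>z. h (\<phi> z)) z + cnj c * deriv (\<lambda>z. g (\<phi> z)) z) * (p - cnj p * z\<^sup>2))"
    using exists_positive_shear[OF hol Fhg] by auto
  show ?thesis
    by (rule exI[of _ \<phi>], rule exI[of _ t], rule exI[of _ c], rule exI[of _ p])
      (intro conjI \<phi>(1,3) inj\<phi> \<phi>disc \<phi>(6)[folded t_def] t cp)
qed

section \<open>Coefficient bounds in the limit\<close>

lemma tcoeff_deriv:
  assumes "h holomorphic_on unit_disc" "n \<ge> 1"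
  shows "tcoeff (deriv h) (n - 1) = of_nat n * tcoeff h n"
proof -
  have "fps_expansion (deriv h) 0 = fps_deriv (fps_expansion h 0)"
    by (intro fps_expansion_eqI has_fps_expansion_deriv has_fps_expansion_tcoeff assms)
  then show ?thesis using assms(2) by simp
qed

text \<open>When \<open>t\<close> is near 1, \<open>\<phi>\<close> is near the identity on the
  circle of radius 1/2, where Cauchy's inequality compares the coefficients of \<open>h\<close> and
  \<open>h o \<phi>\<close>. Hence the bound survives without loss.\<close>

lemma tcoeff_limit:
  assumes h: "h holomorphic_on unit_disc"
    and approx: "\<And>\<rho>. \<lbrakk>0 < \<rho>; \<rho> < 1\<rbrakk> \<Longrightarrow> \<exists>\<phi> t. \<phi> holomorphic_on unit_disc \<and> \<phi> ` unit_disc \<subseteq> unit_disc \<and> \<phi> 0 = 0 \<and>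
      deriv \<phi> 0 = complex_of_real t \<and> \<rho> \<le> t \<and> norm (tcoeff (\<lambda>z. h (\<phi> z)) n) \<le> B"
  shows "norm (tcoeff h n) \<le> B"
proof (rule field_le_epsilon)
  fix e :: real assume "e > 0"
  define e' where "e' = e / 2 ^ n"
  have e': "e' > 0" using \<open>e > 0\<close> by (simp add: e'_def)
  have sub: "cball (0::complex) (1 / 2) \<subseteq> unit_disc" by auto
  have "uniformly_continuous_on (cball 0 (1 / 2)) h"
    by (intro compact_uniformly_continuous compact_cball continuous_on_subset[OF holomorphic_on_imp_continuous_on[OF h] sub])
  then obtain d where d: "d > 0" "\<And>x y. \<lbrakk>x \<in> cball 0 (1 / 2); y \<in> cball 0 (1 / 2); dist y x < d\<rbrakk> \<Longrightarrow> dist (h y) (h x) < e'"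
    unfolding uniformly_continuous_on_def using e' by meson
  define \<rho> where "\<rho> = max (1 / 2) (1 - d / 8)"
  have \<rho>: "0 < \<rho>" "\<rho> < 1" "4 * (1 - \<rho>) < d" using d(1) by (auto simp: \<rho>_def max_def)
  obtain \<phi> t where \<phi>: "\<phi> holomorphic_on unit_disc" "\<phi> ` unit_disc \<subseteq> unit_disc" "\<phi> 0 = 0"
    "deriv \<phi> 0 = complex_of_real t" "\<rho> \<le> t" "norm (tcoeff (\<lambda>z. h (\<phi> z)) n) \<le> B"
    using approx[OF \<rho>(1,2)] by blast
  have hol: "(\<lambda>z. h (\<phi> z)) holomorphic_on unit_disc"
    using holomorphic_on_compose_gen[OF \<phi>(1) h \<phi>(2)] by (simp add: o_def)
  have "norm (h z - h (\<phi> z)) \<le> e'" if z: "norm z = 1 / 2" for z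
  proof -
    have "0 \<le> t" "norm z \<le> 1 / 2" using \<rho> \<phi>(5) z by auto
    note S = schwarz_near_identity[OF \<phi>(1,3) _ \<phi>(4) this]
    have "norm (\<phi> z) \<le> norm z" "norm (\<phi> z - z) \<le> 4 * (1 - t)" using S \<phi>(2) by blast+
    then have "dist z (\<phi> z) < d" using \<rho>(3) \<phi>(5) by (simp add: dist_norm norm_minus_commute)
    then have "dist (h z) (h (\<phi> z)) < e'" using d(2)[of "\<phi> z" z] z \<open>norm (\<phi> z) \<le> norm z\<close> by simp
    then show ?thesis by (simp add: dist_norm)
  qed
  from tcoeff_diff_le[OF h hol this, of n]
  have "norm (tcoeff h n - tcoeff (\<lambda>z. h (\<phi> z)) n) \<le> e" by (simp add: e'_def)
  moreover have "norm (tcoeff h n) \<le> norm (tcoeff (\<lambda>z. h (\<phi> z)) n) + norm (tcoeff h n - tcoeff (\<lambda>z. h (\<phi> z)) n)"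
    by (rule norm_triangle_sub)
  ultimately show "norm (tcoeff h n) \<le> B + e" using \<phi>(6) by linarith
qed

lemma K_hat0_coeff_bounds:
  assumes fK: "f \<in> K_hat0" and dec: "harmonic_decomp f h g" and n: "n \<ge> 1"
  shows "norm (tcoeff h n) \<le> (real n + 1) / 2" and "norm (tcoeff g n) \<le> (real n - 1) / 2"
proof -
  note K = K_hat0_D[OF fK dec]
  have hg: "h holomorphic_on unit_disc" "g holomorphic_on unit_disc" "deriv h 0 = 1"
    using dec by (auto simp: harmonic_decomp_def)
  have *: "\<exists>\<phi> t. \<phi> holomorphic_on unit_disc \<and> \<phi> ` unit_disc \<subseteq> unit_disc \<and> \<phi> 0 = 0 \<and>
      deriv \<phi> 0 = complex_of_real t \<and> \<rho> \<le> t \<and> norm (tcoeff (\<lambda>z. h (\<phi> z)) n) \<le> (real n + 1) / 2 \<and>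
      norm (tcoeff (\<lambda>z. g (\<phi> z)) n) \<le> (real n - 1) / 2" if \<rho>: "0 < \<rho>" "\<rho> < 1" for \<rho>
  proof -
    obtain \<phi> t c p where \<phi>: "\<phi> holomorphic_on unit_disc" "inj_on \<phi> unit_disc" "\<phi> ` unit_disc \<subseteq> unit_disc" "\<phi> 0 = 0"
      "deriv \<phi> 0 = complex_of_real t" "\<rho> \<le> t" "norm c = 1" "norm p = 1"
      "\<And>z. z \<in> unit_disc \<Longrightarrow>
         0 \<le> Re ((c * deriv (\<lambda>z. h (\<phi> z)) z + cnj c * deriv (\<lambda>z. g (\<phi> z)) z) * (p - cnj p * z\<^sup>2))"
      using exhausting_reparametrization[OF fK dec \<rho>] by (elim exE conjE) simp
    define H where "H = (\<lambda>z. h (\<phi> z))"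
    define G where "G = (\<lambda>z. g (\<phi> z))"
    have hol: "H holomorphic_on unit_disc" "G holomorphic_on unit_disc"
      using holomorphic_on_compose_gen[OF \<phi>(1) _ \<phi>(3)] hg unfolding o_def H_def G_def by blast+
    have chain: "deriv (\<lambda>z. k (\<phi> z)) z = deriv k (\<phi> z) * deriv \<phi> z"
      if k: "k holomorphic_on unit_disc" and z: "z \<in> unit_disc" for k z
    proof -
      have "\<phi> z \<in> unit_disc" using \<phi>(3) z by blast
      then have "(k has_field_derivative deriv k (\<phi> z)) (at (\<phi> z))" by (rule holomorphic_derivI[OF k open_ball])
      from DERIV_chain2[OF this holomorphic_derivI[OF \<phi>(1) open_ball z]]
      show ?thesis by (rule DERIV_imp_deriv)
    qed
    have H': "deriv H z = deriv h (\<phi> z) * deriv \<phi> z" and G': "deriv G z = deriv g (\<phi> z) * deriv \<phi> z"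
      if "z \<in> unit_disc" for z unfolding H_def G_def using chain hg that by blast+
    have t: "0 \<le> t" "t \<le> 1"
    proof -
      show t0: "0 \<le> t" using \<phi>(6) \<rho> by simp
      have "\<phi> z \<in> unit_disc" if "z \<in> unit_disc" for z using \<phi>(3) that by blast
      from schwarz_near_identity(3)[OF \<phi>(1,4) this \<phi>(5) t0, of 0] show "t \<le> 1" by simp
    qed
    have cc: "c * cnj c = 1" using \<phi>(7) by (simp add: complex_norm_square[symmetric])
    have dH: "deriv H holomorphic_on unit_disc" and dG: "deriv G holomorphic_on unit_disc"
      using hol by (auto intro: holomorphic_deriv)
    \<comment> \<open>The dilatation of the reparametrized map is that of \<open>f\<close> composed
      with \<open>\<phi>\<close>: the common factor \<open>deriv \<phi> z\<close> cancels, being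
      nonzero by injectivity.\<close>
    have lt: "norm (deriv G z) < norm (deriv H z)" if z: "z \<in> unit_disc" for z
    proof -
      have "deriv \<phi> z \<noteq> 0" by (rule holomorphic_injective_imp_regular[OF \<phi>(1) open_ball \<phi>(2) z])
      moreover have "\<phi> z \<in> unit_disc" using \<phi>(3) z by blast
      ultimately show ?thesis using K(4)[of "\<phi> z"] H'[OF z] G'[OF z] by (simp add: norm_mult)
    qed
    have G0: "deriv G 0 = 0" using G'[of 0] K(3) \<phi>(4) by simp
    have nH0: "norm (deriv H 0) = t" using H'[of 0] hg(3) \<phi>(4,5) t by simp
    \<comment> \<open>Extracting \<open>c\<close> from
      \<open>c * deriv H z + cnj c * deriv G z\<close> leaves the unimodular factor
      \<open>(cnj c)^2\<close> on the second term, since \<open>1 / c = cnj c\<close>.\<close>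
    have ne: "norm (cnj c * cnj c) = 1" using \<phi>(7) by (simp add: norm_mult)
    have "0 \<le> Re (c * (deriv H z + cnj c * cnj c * deriv G z) * (p - cnj p * z\<^sup>2))" if "z \<in> unit_disc" for z
    proof -
      have "c * (deriv H z + cnj c * cnj c * deriv G z) = c * deriv H z + (c * cnj c) * cnj c * deriv G z"
        by (simp add: algebra_simps)
      also have "\<dots> = c * deriv H z + cnj c * deriv G z" unfolding cc by simp
      finally show ?thesis using \<phi>(9)[OF that] unfolding H_def G_def by metis
    qed
    \<comment> \<open>Applied to the derivatives at index \<open>n - 1\<close>; dividing by
      \<open>n\<close> returns to the coefficients, and the scale is
      \<open>norm (deriv H 0) = t \<le> 1\<close>.\<close>
    note B = shear_coeff_bounds[OF dH dG lt G0 ne \<phi>(7,8) this, of "n - 1"]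
    have nn: "real (n - 1) = real n - 1" using n by (simp add: of_nat_diff)
    have "real n * norm (tcoeff H n) \<le> t * (real n * (real n + 1) / 2)"
      using B(1) unfolding tcoeff_deriv[OF hol(1) n] nH0 nn by (simp add: norm_mult add.commute)
    also have "\<dots> \<le> 1 * (real n * (real n + 1) / 2)" using t by (intro mult_right_mono) auto
    finally have "real n * norm (tcoeff H n) \<le> real n * ((real n + 1) / 2)" by simp
    then have 1: "norm (tcoeff H n) \<le> (real n + 1) / 2" by (rule mult_left_le_imp_le) (use n in simp)
    have "real n * norm (tcoeff G n) \<le> t * ((real n - 1) * real n / 2)"
      using B(2) unfolding tcoeff_deriv[OF hol(2) n] nH0 nn by (simp add: norm_mult)
    also have "\<dots> \<le> 1 * ((real n - 1) * real n / 2)" using t n by (intro mult_right_mono) auto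
    finally have "real n * norm (tcoeff G n) \<le> real n * ((real n - 1) / 2)" by (simp add: mult.commute)
    then have 2: "norm (tcoeff G n) \<le> (real n - 1) / 2" by (rule mult_left_le_imp_le) (use n in simp)
    show ?thesis using \<phi> 1 2 unfolding H_def G_def by blast
  qed
  show "norm (tcoeff h n) \<le> (real n + 1) / 2" by (rule tcoeff_limit[OF hg(1)]) (use * in blast)
  show "norm (tcoeff g n) \<le> (real n - 1) / 2" by (rule tcoeff_limit[OF hg(2)]) (use * in blast)
qed

section \<open>The Wright operator\<close>

lemma fps_conv_radius_ge_1I:
  fixes F :: "complex fps"
  assumes "\<And>r::real. 0 < r \<Longrightarrow> r < 1 \<Longrightarrow> summable (\<lambda>n. norm (fps_nth F n) * r ^ n)"
  shows "fps_conv_radius F \<ge> 1"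
  unfolding fps_conv_radius_def
proof (rule conv_radius_geI_ex)
  fix r :: real assume "0 < r" "ereal r < 1"
  then have "summable (\<lambda>n. norm (fps_nth F n * of_real r ^ n))"
    using assms[of r] by (simp add: norm_mult norm_power)
  then show "\<exists>z. norm z = r \<and> summable (\<lambda>n. fps_nth F n * z ^ n)"
    using \<open>0 < r\<close> by (intro exI[of _ "of_real r"]) (auto dest: summable_norm_cancel)
qed

lemma eval_fps_on_unit_disc:
  assumes "fps_conv_radius F \<ge> 1"
  shows "eval_fps F holomorphic_on unit_disc" "fps_expansion (eval_fps F) 0 = F"
proof -
  show "eval_fps F holomorphic_on unit_disc"
  proof (rule holomorphic_on_eval_fps)
    have "ereal (norm x) < fps_conv_radius F" if "norm x < 1" for x :: complex
      by (rule less_le_trans[OF _ assms]) (use that in simp)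
    then show "unit_disc \<subseteq> eball 0 (fps_conv_radius F)" by (auto simp: in_eball_iff)
  qed
  have "fps_conv_radius F > 0" by (rule less_le_trans[OF _ assms]) simp
  then show "fps_expansion (eval_fps F) 0 = F"
    by (intro fps_expansion_eqI eval_fps_has_fps_expansion)
qed

text \<open>A bounded sequence of multipliers does not shrink the disc of convergence; for
  \<open>wright\<close> the bound will be the sum of its nonnegative coefficients.\<close>

lemma hadamard_holomorphic:
  assumes p: "p holomorphic_on unit_disc" and q: "\<And>n. norm (tcoeff q n) \<le> M"
  shows "hadamard p q holomorphic_on unit_disc"
    and "tcoeff (hadamard p q) n = tcoeff p n * tcoeff q n"
proof -
  define F where "F = Abs_fps (\<lambda>n. tcoeff p n * tcoeff q n)"
  have "fps_conv_radius F \<ge> 1"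
  proof (rule fps_conv_radius_ge_1I)
    fix r :: real assume r: "0 < r" "r < 1"
    have cr: "fps_conv_radius (fps_expansion p 0) \<ge> 1"
      using conv_radius_fps_expansion[of p 0 1] p by (simp add: one_ereal_def)
    have "summable (\<lambda>n. norm (tcoeff p n * of_real r ^ n))"
      using r unfolding fps_conv_radius_def
      by (intro abs_summable_in_conv_radius less_le_trans[OF _ cr[unfolded fps_conv_radius_def]]) simp
    then have "summable (\<lambda>n. norm (tcoeff p n) * r ^ n)"
      using r by (simp add: norm_mult norm_power)
    from summable_mult[OF this, of M] show "summable (\<lambda>n. norm (fps_nth F n) * r ^ n)"
    proof (rule summable_comparison_test')
      fix n
      have "norm (tcoeff q n) * (norm (tcoeff p n) * r ^ n) \<le> M * (norm (tcoeff p n) * r ^ n)"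
        using q r by (intro mult_right_mono) auto
      then show "norm (norm (fps_nth F n) * r ^ n) \<le> M * (norm (tcoeff p n) * r ^ n)"
        using r by (simp add: F_def norm_mult norm_power mult_ac)
    qed
  qed
  note F = eval_fps_on_unit_disc[OF this]
  have "hadamard p q = eval_fps F"
    by (simp add: fun_eq_iff hadamard_def eval_fps_def F_def)
  with F show "hadamard p q holomorphic_on unit_disc"
    and "tcoeff (hadamard p q) n = tcoeff p n * tcoeff q n"
    by (auto simp: F_def)
qed

lemma wright_coeff_nonneg:
  assumes "a > 0" "b \<ge> 0" "c > 0" "d \<ge> 0"
  shows "0 \<le> wright_coeff a b c d n"
  using assms unfolding wright_coeff_def
  by (auto intro!: divide_nonneg_nonneg mult_nonneg_nonneg less_imp_le[OF Gamma_real_pos] add_pos_nonneg)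

lemma tcoeff_wright:
  assumes "summable (wright_coeff a b c d)" "a > 0" "b \<ge> 0" "c > 0" "d \<ge> 0"
  shows "tcoeff (wright a b c d) n = of_real (wright_coeff a b c d n)"
proof -
  define F where "F = Abs_fps (\<lambda>n. complex_of_real (wright_coeff a b c d n))"
  have nn: "0 \<le> wright_coeff a b c d n" for n using wright_coeff_nonneg assms by blast
  have "fps_conv_radius F \<ge> 1"
  proof (rule fps_conv_radius_ge_1I)
    fix r :: real assume r: "0 < r" "r < 1"
    show "summable (\<lambda>n. norm (fps_nth F n) * r ^ n)"
    proof (rule summable_comparison_test'[OF assms(1)])
      fix n
      have "wright_coeff a b c d n * r ^ n \<le> wright_coeff a b c d n * 1"
        using r nn by (intro mult_left_mono power_le_one) auto
      then show "norm (norm (fps_nth F n) * r ^ n) \<le> wright_coeff a b c d n"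
        using r nn by (simp add: F_def abs_mult)
    qed
  qed
  from eval_fps_on_unit_disc(2)[OF this]
  have "fps_expansion (eval_fps F) 0 = F" .
  moreover have "wright a b c d = eval_fps F"
    by (simp add: fun_eq_iff wright_def eval_fps_def F_def)
  ultimately show ?thesis by (simp add: F_def)
qed

text \<open>The \<open>k\<close>-th termwise derivative has its index shifted by \<open>k\<close>,
  so 2, 1 and 0 initial terms are dropped; among them only the one coming from
  \<open>w 1 = 1\<close> is nonzero, hence the subtracted units.\<close>

lemma wright_deriv_at_1_sums:
  assumes "\<And>k. k \<le> 2 \<Longrightarrow> summable (wright_deriv_coeff k a b c d)"
  defines "w \<equiv> wright_coeff a b c d"
  shows "(\<lambda>n. w (n + 2)) sums (wright_deriv_at_1 0 a b c d - 1)"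
    and "(\<lambda>n. real (n + 2) * w (n + 2)) sums (wright_deriv_at_1 1 a b c d - 1)"
    and "(\<lambda>n. real (n + 2) * real (n + 1) * w (n + 2)) sums wright_deriv_at_1 2 a b c d"
proof -
  have s: "wright_deriv_coeff k a b c d sums wright_deriv_at_1 k a b c d" if "k \<le> 2" for k
    using assms(1)[OF that] unfolding wright_deriv_at_1_def by (rule summable_sums)
  have w: "w 0 = 0" "w 1 = 1" by (auto simp: w_def wright_coeff_def)
  show "(\<lambda>n. w (n + 2)) sums (wright_deriv_at_1 0 a b c d - 1)"
    using sums_split_initial_segment[OF s[of 0], of 2] w
    by (simp add: wright_deriv_coeff_def w_def eval_nat_numeral)
  show "(\<lambda>n. real (n + 2) * w (n + 2)) sums (wright_deriv_at_1 1 a b c d - 1)"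
    using sums_split_initial_segment[OF s[of 1], of 1] w
    by (simp add: wright_deriv_coeff_def w_def diffs_def)
  show "(\<lambda>n. real (n + 2) * real (n + 1) * w (n + 2)) sums wright_deriv_at_1 2 a b c d"
    using s[of 2] by (simp add: wright_deriv_coeff_def w_def diffs_def eval_nat_numeral algebra_simps)
qed

theorem theorem3:
  fixes \<alpha> \<alpha>1 \<beta>1 \<gamma>1 \<delta>1 \<alpha>2 \<beta>2 \<gamma>2 \<delta>2 :: real
    and \<sigma> :: complex
    and f h g :: "complex \<Rightarrow> complex"
    and W1 W2 :: "nat \<Rightarrow> real"
  defines "W1 \<equiv> \<lambda>k. wright_deriv_at_1 k \<alpha>1 \<beta>1 \<gamma>1 \<delta>1"
    and "W2 \<equiv> \<lambda>k. wright_deriv_at_1 k \<alpha>2 \<beta>2 \<gamma>2 \<delta>2"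
  assumes "0 \<le> \<alpha>" "\<alpha> < 1"
    and "\<beta>1 \<ge> 0" "\<beta>2 \<ge> 0" "\<delta>1 \<ge> 0" "\<delta>2 \<ge> 0"
    and "\<alpha>1 > 0" "\<alpha>2 > 0" "\<gamma>1 > 0" "\<gamma>2 > 0"
    and "norm \<sigma> < 1"
    and "f \<in> K_hat0" "harmonic_decomp f h g"
    and "\<And>k. k \<le> 2 \<Longrightarrow> summable (wright_deriv_coeff k \<alpha>1 \<beta>1 \<gamma>1 \<delta>1)"
    and "\<And>k. k \<le> 2 \<Longrightarrow> summable (wright_deriv_coeff k \<alpha>2 \<beta>2 \<gamma>2 \<delta>2)"
    and "W1 2 + (2 - \<alpha>) * (W1 1 - 1) - \<alpha> * (W1 0 - 1)
           + norm \<sigma> * (W2 2 + \<alpha> * (W2 1 - W2 0)) \<le> 2 * (1 - \<alpha>)"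
  shows "wright_op \<alpha>1 \<beta>1 \<gamma>1 \<delta>1 \<alpha>2 \<beta>2 \<gamma>2 \<delta>2 \<sigma> h g \<in> HS_star \<alpha>"
proof -
  define w1 where "w1 = wright_coeff \<alpha>1 \<beta>1 \<gamma>1 \<delta>1"
  define w2 where "w2 = wright_coeff \<alpha>2 \<beta>2 \<gamma>2 \<delta>2"
  have w_nonneg: "w1 n \<ge> 0" "w2 n \<ge> 0" for n
    using wright_coeff_nonneg assms(5-12) unfolding w1_def w2_def by blast+
  have w_01: "w1 0 = 0" "w1 1 = 1" "w2 0 = 0" "w2 1 = 1"
    by (auto simp: w1_def w2_def wright_coeff_def)
  have w_summable: "summable w1" "summable w2"
    using assms(16)[of 0] assms(17)[of 0] by (simp_all add: wright_deriv_coeff_def w1_def w2_def)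
  have tc: "tcoeff (wright \<alpha>1 \<beta>1 \<gamma>1 \<delta>1) n = w1 n" "tcoeff (wright \<alpha>2 \<beta>2 \<gamma>2 \<delta>2) n = w2 n" for n
    using tcoeff_wright w_summable assms(5-12) unfolding w1_def w2_def by blast+
  have hol: "h holomorphic_on unit_disc" "g holomorphic_on unit_disc"
    and h01: "h 0 = 0" "deriv h 0 = 1" "g 0 = 0"
    using assms(15) by (auto simp: harmonic_decomp_def)
  have bd: "norm (tcoeff h n) \<le> (real n + 1) / 2" "norm (tcoeff g n) \<le> (real n - 1) / 2" if "n \<ge> 1" for n
    using K_hat0_coeff_bounds assms(14,15) that by blast+
  have g1: "tcoeff g 1 = 0" using bd(2)[of 1] by simp
  define H where "H = hadamard h (wright \<alpha>1 \<beta>1 \<gamma>1 \<delta>1)"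
  define G where "G = (\<lambda>z. \<sigma> * hadamard g (wright \<alpha>2 \<beta>2 \<gamma>2 \<delta>2) z)"
  have "w1 n \<le> suminf w1" "w2 n \<le> suminf w2" for n
    using sum_le_suminf[OF w_summable(1), of "{n}"] sum_le_suminf[OF w_summable(2), of "{n}"] w_nonneg
    by auto
  then have le: "norm (tcoeff (wright \<alpha>1 \<beta>1 \<gamma>1 \<delta>1) n) \<le> suminf w1"
    "norm (tcoeff (wright \<alpha>2 \<beta>2 \<gamma>2 \<delta>2) n) \<le> suminf w2" for n
    unfolding tc using w_nonneg by auto
  have H: "H holomorphic_on unit_disc" and Hc: "tcoeff H n = tcoeff h n * w1 n" for n
    using hadamard_holomorphic[OF hol(1) le(1)] tc by (simp_all add: H_def)
  have had: "hadamard g (wright \<alpha>2 \<beta>2 \<gamma>2 \<delta>2) holomorphic_on unit_disc"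
    "tcoeff (hadamard g (wright \<alpha>2 \<beta>2 \<gamma>2 \<delta>2)) n = tcoeff g n * w2 n" for n
    using hadamard_holomorphic[OF hol(2) le(2)] tc by simp_all
  have G: "G holomorphic_on unit_disc" unfolding G_def by (intro holomorphic_intros had)
  have "fps_expansion G 0 = fps_const \<sigma> * fps_expansion (hadamard g (wright \<alpha>2 \<beta>2 \<gamma>2 \<delta>2)) 0"
    unfolding G_def by (intro fps_expansion_eqI fps_expansion_intros has_fps_expansion_tcoeff had)
  then have Gc: "tcoeff G n = \<sigma> * (tcoeff g n * w2 n)" for n
    by (simp add: had)
  have c01: "tcoeff p 0 = p 0" "tcoeff p 1 = deriv p 0" for p by (simp_all add: fps_expansion_def)
  define x where "x = (\<lambda>n. (real (n + 2) - \<alpha>) * norm (tcoeff H (n + 2)) + (real (n + 2) + \<alpha>) * norm (tcoeff G (n + 2)))"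
  \<comment> \<open>\<open>y\<close> is twice the majorant of \<open>x\<close> given by the
    coefficient bounds, rewritten so that the three series of each Wright function appear.\<close>
  define y where "y = (\<lambda>n. (real (n + 2) * real (n + 1) * w1 (n + 2) + (2 - \<alpha>) * (real (n + 2) * w1 (n + 2)) - \<alpha> * w1 (n + 2))
     + norm \<sigma> * (real (n + 2) * real (n + 1) * w2 (n + 2) + \<alpha> * (real (n + 2) * w2 (n + 2) - w2 (n + 2))))"
  have W1: "(\<lambda>n. w1 (n + 2)) sums (W1 0 - 1)" "(\<lambda>n. real (n + 2) * w1 (n + 2)) sums (W1 1 - 1)"
    "(\<lambda>n. real (n + 2) * real (n + 1) * w1 (n + 2)) sums W1 2"
    unfolding w1_def W1_def using wright_deriv_at_1_sums[OF assms(16)] by blast+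
  have W2: "(\<lambda>n. w2 (n + 2)) sums (W2 0 - 1)" "(\<lambda>n. real (n + 2) * w2 (n + 2)) sums (W2 1 - 1)"
    "(\<lambda>n. real (n + 2) * real (n + 1) * w2 (n + 2)) sums W2 2"
    unfolding w2_def W2_def using wright_deriv_at_1_sums[OF assms(17)] by blast+
  \<comment> \<open>In \<open>(W2 1 - 1) - (W2 0 - 1)\<close> the units cancel, which is why the
    hypothesis carries no correction in its second part.\<close>
  have "y sums ((W1 2 + (2 - \<alpha>) * (W1 1 - 1) - \<alpha> * (W1 0 - 1))
           + norm \<sigma> * (W2 2 + \<alpha> * ((W2 1 - 1) - (W2 0 - 1))))"
    unfolding y_def by (intro sums_add sums_diff sums_mult W1 W2)
  then have y: "summable y" "suminf y \<le> 2 * (1 - \<alpha>)"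
    using assms(18) by (auto simp: sums_iff)
  have xy: "x n \<le> y n / 2" for n
  proof -
    have "norm (tcoeff H (n + 2)) \<le> (real (n + 2) + 1) / 2 * w1 (n + 2)"
      unfolding Hc using bd(1)[of "n + 2"] w_nonneg by (simp only: norm_mult norm_of_real abs_of_nonneg mult_right_mono)
    then have "(real (n + 2) - \<alpha>) * norm (tcoeff H (n + 2)) \<le> (real (n + 2) - \<alpha>) * ((real (n + 2) + 1) / 2 * w1 (n + 2))"
      using assms(4) by (intro mult_left_mono) auto
    moreover have "norm (tcoeff g (n + 2)) * w2 (n + 2) \<le> (real (n + 2) - 1) / 2 * w2 (n + 2)"
      using bd(2)[of "n + 2"] w_nonneg by (intro mult_right_mono) auto
    then have "norm (tcoeff G (n + 2)) \<le> norm \<sigma> * ((real (n + 2) - 1) / 2 * w2 (n + 2))"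
      unfolding Gc using w_nonneg by (simp only: norm_mult norm_of_real abs_of_nonneg) (intro mult_left_mono norm_ge_zero)
    then have "(real (n + 2) + \<alpha>) * norm (tcoeff G (n + 2)) \<le> (real (n + 2) + \<alpha>) * (norm \<sigma> * ((real (n + 2) - 1) / 2 * w2 (n + 2)))"
      using assms(3) by (intro mult_left_mono) auto
    ultimately have "x n \<le> (real (n + 2) - \<alpha>) * ((real (n + 2) + 1) / 2 * w1 (n + 2)) + (real (n + 2) + \<alpha>) * (norm \<sigma> * ((real (n + 2) - 1) / 2 * w2 (n + 2)))"
      unfolding x_def by (rule add_mono)
    also have "\<dots> = y n / 2" by (simp add: y_def field_simps)
    finally show ?thesis .
  qed
  have "x n \<ge> 0" for n unfolding x_def using assms(3,4) by (intro add_nonneg_nonneg mult_nonneg_nonneg) auto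
  then have sx: "summable x"
    using xy by (intro summable_comparison_test'[OF summable_divide[OF y(1), of 2]]) auto
  have "suminf x \<le> (\<Sum>n. y n / 2)" using xy by (intro suminf_le sx summable_divide y)
  also have "\<dots> = suminf y / 2" by (rule suminf_divide) (rule y)
  also have "\<dots> \<le> 1 - \<alpha>" using y(2) by simp
  finally have "suminf x \<le> 1 - \<alpha>" .
  moreover have "H 0 = 0" "deriv H 0 = 1" "G 0 = 0" "deriv G 0 = 0"
    using h01 w_01 g1 Hc[of 0] Hc[of 1] Gc[of 0] Gc[of 1]
    by (simp_all only: c01 mult_zero_left mult_zero_right mult_1 of_real_0 of_real_1)
  ultimately have "(\<lambda>z. H z + cnj (G z)) \<in> HS_star \<alpha>"
    using assms(3,4) H G sx unfolding x_def by (intro HS_star_if_coeff_sum_le)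
  moreover have "wright_op \<alpha>1 \<beta>1 \<gamma>1 \<delta>1 \<alpha>2 \<beta>2 \<gamma>2 \<delta>2 \<sigma> h g = (\<lambda>z. H z + cnj (G z))"
    by (simp add: fun_eq_iff wright_op_def H_def G_def)
  ultimately show ?thesis by simp
qed

end
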